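(* Let $f\in\mathcal{M}$ be pretentious, with $\mathbb{D}(f,\chi\cdot n^{it})<+\infty$ for some primitive Dirichlet character $\chi$ and $t\in\mathbb{R}$. Then the following conditions are equivalent: (i) $f$ has a unique Furstenberg system, i.e. $f$ is generic. (ii) $t=0$ and the series $\sum_{p}\frac1p\big(1-f(p)\overline{\chi(p)}\big)$ (over primes $p$ in increasing order) converges. (iii) $f$ is RAP. Moreover, in this case the unique Furstenberg system is an ergodic odometer.
   Context: $\mathcal{M}$ is the class of multiplicative functions $f:\mathbb{N}\to\mathbb{C}$ ($f(mn)=f(m)f(n)$ for coprime $m,n$) with $|f|\le1$. For $f,g\in\mathcal{M}$, $\mathbb{D}(f,g)^2=\sum_{p\text{ prime}}\frac1p\big(1-\mathrm{Re}(f(p)\overline{g(p)})\big)$. $f$ is pretentious if $\mathbb{D}(f,\chi\cdot n^{it})<+\infty$ for some Dirichlet character $\chi$ and $t\in\mathbb{R}$, where $n^{it}$ denotes the function $n\mapsto n^{it}$. The trivial character (modulus 1) is regarded as primitive. Furstenberg systems: let $\mathbb{U}$ be the closed unit disc and $S$ the left shift on $\mathbb{U}^{\mathbb{Z}}$; $f$ is viewed as an element of $\mathbb{U}^{\mathbb{Z}}$ (extended arbitrarily, e.g. by $0$, to non-positive integers; this does not affect what follows), and $X_f=\overline{\{S^nf:n\in\mathbb{Z}\}}$. A Furstenberg system of $f$ is any measure-preserving system $(X_f,\nu,S)$ where $\nu$ is a weak$^*$ limit $\lim_{k\to\infty}\frac1{N_k}\sum_{n\le N_k}\delta_{S^nf}$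 for some $N_k\to\infty$. $f$ has a unique Furstenberg system ($f$ is generic) if $\lim_{N\to\infty}\frac1N\sum_{n\le N}\delta_{S^nf}$ exists in the weak$^*$ topology. $f$ is (Besicovitch) rationally almost periodic (RAP) if for each $\varepsilon>0$ there is a periodic sequence $f_\varepsilon$ with $\limsup_{N\to\infty}\frac1N\sum_{n<N}|f(n)-f_\varepsilon(n)|<\varepsilon$. An odometer is the measure-theoretic system given by addition of $1$ on an inverse limit of finite cyclic groups with Haar measure; the last assertion is up to measure-theoretic isomorphism. *)

theory Defs
  imports "HOL-Probability.Probability" "HOL-Computational_Algebra.Primes"
begin

section \<open>Multiplicative functions, Dirichlet characters, pretentious distance\<close>

text \<open>
  Arithmetic functions have type \<open>nat \<Rightarrow> complex\<close>, but only their values at positive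
  arguments are meaningful; \<open>f 0\<close> is unconstrained and never used.
\<close>

definition unit_multiplicative :: "(nat \<Rightarrow> complex) \<Rightarrow> bool" where
  "unit_multiplicative f \<longleftrightarrow>
     (\<forall>m n. m > 0 \<longrightarrow> n > 0 \<longrightarrow> coprime m n \<longrightarrow> f (m * n) = f m * f n) \<and>
     (\<forall>n > 0. norm (f n) \<le> 1)"

definition dirichlet_character :: "nat \<Rightarrow> (nat \<Rightarrow> complex) \<Rightarrow> bool" where
  "dirichlet_character q chi \<longleftrightarrow> q > 0 \<and>
     (\<forall>n. chi (n + q) = chi n) \<and>
     (\<forall>m n. chi (m * n) = chi m * chi n) \<and>
     (\<forall>n. chi n \<noteq> 0 \<longleftrightarrow> coprime n q)"

text \<open>For \<open>q = 1\<close> there is no proper divisor, so the trivial character is primitive.\<close>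

definition primitive_character :: "nat \<Rightarrow> (nat \<Rightarrow> complex) \<Rightarrow> bool" where
  "primitive_character q chi \<longleftrightarrow> dirichlet_character q chi \<and>
     \<not> (\<exists>d \<psi>. d dvd q \<and> d < q \<and> dirichlet_character d \<psi> \<and>
            (\<forall>n. coprime n q \<longrightarrow> chi n = \<psi> n))"

text \<open>
  For functions bounded by 1 the terms of the series are nonnegative, so the
  truncation performed by \<^const>\<open>ennreal\<close> has no effect.
\<close>

definition pretentious_dist_sq ::
    "(nat \<Rightarrow> complex) \<Rightarrow> (nat \<Rightarrow> complex) \<Rightarrow> ennreal" where
  "pretentious_dist_sq f g =
     (\<Sum>\<^sub>\<infinity>p\<in>{p. prime p}. ennreal (1 / real p * (1 - Re (f p * cnj (g p)))))"

definition pretentious_dist ::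
    "(nat \<Rightarrow> complex) \<Rightarrow> (nat \<Rightarrow> complex) \<Rightarrow> ennreal" where
  "pretentious_dist f g =
     (if pretentious_dist_sq f g = \<infinity> then \<infinity>
      else ennreal (sqrt (enn2real (pretentious_dist_sq f g))))"


section \<open>Besicovitch rational almost periodicity\<close>

definition periodic_seq :: "(nat \<Rightarrow> complex) \<Rightarrow> bool" where
  "periodic_seq g \<longleftrightarrow> (\<exists>q > 0. \<forall>n. g (n + q) = g n)"

definition RAP :: "(nat \<Rightarrow> complex) \<Rightarrow> bool" where
  "RAP f \<longleftrightarrow> (\<forall>\<epsilon> > 0. \<exists>g. periodic_seq g \<and>
     limsup (\<lambda>N. ereal (1 / real N * (\<Sum>n\<in>{1..<N}. norm (f n - g n)))) < ereal \<epsilon>)"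


section \<open>Measure-preserving systems\<close>

definition measure_preserving_system :: "'a measure \<Rightarrow> ('a \<Rightarrow> 'a) \<Rightarrow> bool" where
  "measure_preserving_system M T \<longleftrightarrow>
     prob_space M \<and> T \<in> measurable M M \<and> distr M M T = M"

definition ergodic_system :: "'a measure \<Rightarrow> ('a \<Rightarrow> 'a) \<Rightarrow> bool" where
  "ergodic_system M T \<longleftrightarrow> measure_preserving_system M T \<and>
     (\<forall>A\<in>sets M. T -` A \<inter> space M = A \<longrightarrow> measure M A = 0 \<or> measure M A = 1)"

text \<open>
  Measure-theoretic isomorphism: an equivariant, bimeasurable, measure-preserving
  bijection between forward-invariant measurable sets of full measure.
\<close>

definition isomorphic_systems ::
    "'a measure \<Rightarrow> ('a \<Rightarrow> 'a) \<Rightarrow> 'b measure \<Rightarrow> ('b \<Rightarrow> 'b) \<Rightarrow> bool" where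
  "isomorphic_systems M T N R \<longleftrightarrow>
     measure_preserving_system M T \<and> measure_preserving_system N R \<and>
     (\<exists>A B h. A \<in> sets M \<and> B \<in> sets N \<and> measure M A = 1 \<and> measure N B = 1 \<and>
        T ` A \<subseteq> A \<and> R ` B \<subseteq> B \<and>
        bij_betw h A B \<and>
        h \<in> measurable (restrict_space M A) (restrict_space N B) \<and>
        inv_into A h \<in> measurable (restrict_space N B) (restrict_space M A) \<and>
        distr (restrict_space M A) (restrict_space N B) h = restrict_space N B \<and>
        (\<forall>x\<in>A. h (T x) = R (h x)))"


section \<open>Odometers\<close>

text \<open>
  The inverse limit of \<open>\<int>/m\<^sub>0 \<leftarrow> \<int>/m\<^sub>1 \<leftarrow> \<dots>\<close>, where \<open>m\<^sub>k\<close> divides \<open>m\<^sub>k\<^sub>+\<^sub>1\<close>, with \<open>\<int>/m\<^sub>k\<close>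
  represented by \<open>{0..<m\<^sub>k}\<close>. Eventually constant sequences of moduli, giving a finite
  cyclic group, are allowed.
\<close>

definition odometer_moduli :: "(nat \<Rightarrow> nat) \<Rightarrow> bool" where
  "odometer_moduli m \<longleftrightarrow> (\<forall>k. m k > 0 \<and> m k dvd m (Suc k))"

definition odometer_space :: "(nat \<Rightarrow> nat) \<Rightarrow> (nat \<Rightarrow> nat) set" where
  "odometer_space m = {x. \<forall>k. x k < m k \<and> x (Suc k) mod m k = x k}"

definition odometer_add ::
    "(nat \<Rightarrow> nat) \<Rightarrow> (nat \<Rightarrow> nat) \<Rightarrow> (nat \<Rightarrow> nat) \<Rightarrow> (nat \<Rightarrow> nat)" where
  "odometer_add m x y = (\<lambda>k. (x k + y k) mod m k)"

definition odometer_one :: "(nat \<Rightarrow> nat) \<Rightarrow> (nat \<Rightarrow> nat)" where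
  "odometer_one m = (\<lambda>k. 1 mod m k)"

definition odometer_haar :: "(nat \<Rightarrow> nat) \<Rightarrow> (nat \<Rightarrow> nat) measure \<Rightarrow> bool" where
  "odometer_haar m \<mu> \<longleftrightarrow> prob_space \<mu> \<and>
     sets \<mu> = sets (restrict_space borel (odometer_space m)) \<and>
     (\<forall>y\<in>odometer_space m. distr \<mu> \<mu> (odometer_add m y) = \<mu>)"

definition is_odometer :: "'a measure \<Rightarrow> ('a \<Rightarrow> 'a) \<Rightarrow> bool" where
  "is_odometer M T \<longleftrightarrow> (\<exists>m \<mu>. odometer_moduli m \<and> odometer_haar m \<mu> \<and>
     isomorphic_systems M T \<mu> (odometer_add m (odometer_one m)))"


section \<open>Furstenberg systems\<close>

definition shift_by :: "int \<Rightarrow> (int \<Rightarrow> complex) \<Rightarrow> (int \<Rightarrow> complex)" where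
  "shift_by n x = (\<lambda>k. x (k + n))"

definition extend_by_zero :: "(nat \<Rightarrow> complex) \<Rightarrow> (int \<Rightarrow> complex)" where
  "extend_by_zero f = (\<lambda>n. if n > 0 then f (nat n) else 0)"

text \<open>The closure is taken in the product topology on \<open>int \<Rightarrow> complex\<close>.\<close>

definition orbit_closure :: "(nat \<Rightarrow> complex) \<Rightarrow> (int \<Rightarrow> complex) set" where
  "orbit_closure f = closure (range (\<lambda>n. shift_by n (extend_by_zero f)))"

definition prob_measures_on :: "'a::topological_space set \<Rightarrow> 'a measure set" where
  "prob_measures_on X = {\<nu>. prob_space \<nu> \<and> sets \<nu> = sets (restrict_space borel X)}"

definition weak_star_tendsto ::
    "'a::topological_space set \<Rightarrow> (nat \<Rightarrow> 'a measure) \<Rightarrow> 'a measure \<Rightarrow> bool" where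
  "weak_star_tendsto X \<mu> \<nu> \<longleftrightarrow>
     (\<forall>\<phi> :: 'a \<Rightarrow> complex. continuous_on X \<phi> \<longrightarrow>
        (\<lambda>k. integral\<^sup>L (\<mu> k) \<phi>) \<longlonglongrightarrow> integral\<^sup>L \<nu> \<phi>)"

text \<open>
  The average of the Dirac masses at \<open>S\<^sup>n f\<close>, \<open>1 \<le> n \<le> N\<close>, written as the image of the
  uniform measure on \<open>{1..N}\<close>.
\<close>

definition empirical_measure :: "(nat \<Rightarrow> complex) \<Rightarrow> nat \<Rightarrow> (int \<Rightarrow> complex) measure" where
  "empirical_measure f N =
     distr (uniform_count_measure {1..N}) (restrict_space borel (orbit_closure f))
       (\<lambda>n. shift_by (int n) (extend_by_zero f))"

definition furstenberg_system :: "(nat \<Rightarrow> complex) \<Rightarrow> (int \<Rightarrow> complex) measure \<Rightarrow> bool" where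
  "furstenberg_system f \<nu> \<longleftrightarrow>
     \<nu> \<in> prob_measures_on (orbit_closure f) \<and>
     measure_preserving_system \<nu> (shift_by 1) \<and>
     (\<exists>N :: nat \<Rightarrow> nat. filterlim N at_top sequentially \<and>
        weak_star_tendsto (orbit_closure f) (\<lambda>k. empirical_measure f (N k)) \<nu>)"

definition generic :: "(nat \<Rightarrow> complex) \<Rightarrow> bool" where
  "generic f \<longleftrightarrow> (\<exists>\<nu> \<in> prob_measures_on (orbit_closure f).
     weak_star_tendsto (orbit_closure f) (empirical_measure f) \<nu>)"

end

theory Submission
  imports Defs "HOL-Number_Theory.Number_Theory" "HOL-Real_Asymp.Real_Asymp"
begin

text \<open>
  Put \<open>h(p) = f(p) cnj(\<chi>(p) p\<^sup>i\<^sup>t)\<close> and \<open>G(N) = \<Sum>p\<le>N. (h(p) - 1) / p\<close>. By the Turan-Kubilius inequality the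
  \<open>y\<close>-rough part of \<open>n \<le> N\<close> contributes to \<open>f(n) cnj(\<chi>(n) n\<^sup>i\<^sup>t)\<close> a factor that is close in mean to
  \<open>exp (G(N) - G(y))\<close>, whereas the \<open>y\<close>-smooth part is essentially periodic. Hence
  \<open>f(n) n\<^sup>-\<^sup>i\<^sup>t exp (-G(N))\<close> is Besicovitch close to periodic functions. If \<open>t = 0\<close> and \<open>G\<close> converges, then
  \<open>f\<close> is RAP.

  If \<open>f\<close> is generic, choose a root of unity \<open>z\<close> with \<open>z\<^sup>Q = 1\<close> for which \<open>f(n) n\<^sup>-\<^sup>i\<^sup>t exp (-G(N)) z\<^sup>n\<close> has a nonzero
  mean \<open>c\<close>. The averages of the continuous observables \<open>x \<mapsto> (1/L \<Sum>m<L. x(m) z\<^sup>m)\<^sup>Q\<close> along the orbit converge,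
  and for large \<open>L\<close> they are close to \<open>c\<^sup>Q exp (Q G(N)) N\<^sup>i\<^sup>t\<^sup>Q / (1 + itQ)\<close>. Since \<open>G(kN) - G(N)\<close> tends to \<open>0\<close>,
  this forces \<open>k\<^sup>i\<^sup>t\<^sup>Q = 1\<close> for all \<open>k\<close>, so \<open>t = 0\<close>, and then \<open>G\<close> converges.

  A bounded RAP sequence is a limit in mean of its averages along residue classes. These averages,
  read along their minimal periods, define an almost everywhere convergent map from an odometer to the
  shift space that sends Haar measure to the Furstenberg system; averaging along the periods inverts it.
\<close>

section \<open>Averages\<close>

text \<open>Finite distance bounds only the real part of \<open>G\<close>. The imaginary part is
  controlled just in square mean and may drift, so every estimate keeps the factor
  \<open>exp (G N)\<close> explicit. The drift is slow by Cauchy-Schwarz on the primes between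
  \<open>sqrt N\<close> and \<open>N\<close>, whose reciprocals sum to at most 2. A nonzero mean
  against some root of unity is not automatic, since \<open>f\<close> may vanish on all powers of
  small primes. A positive lower bound for the mean of \<open>|f|\<close> comes from the progression
  1 modulo \<open>y!\<close>, whose members have no prime factor up to \<open>y\<close>. If all
  those means vanished, expanding a periodic approximant in roots of unity would make its mean
  square too small. A continuous observable sees the shifted sequence but not the position
  \<open>n\<close>, so a window starting at \<open>n\<close> carries the phase
  \<open>cnj z ^ n\<close>. The \<open>Q\<close>-th power removes it. On the RAP side all
  approximations hold only in mean. Geometric error bounds turn them into almost everywhere
  statements, and a linear modulus of continuity turns them into statements on observables.\<close>

definition avg :: "(nat \<Rightarrow> 'a::real_vector) \<Rightarrow> nat \<Rightarrow> 'a" where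
  "avg u N = (\<Sum>n\<in>{1..N}. u n) /\<^sub>R real N"

lemma avg_real: "avg u N = (\<Sum>n\<in>{1..N}. u n) / real N" for u :: "nat \<Rightarrow> real"
  by (simp add: avg_def divide_inverse)

lemma avg_complex: "avg u N = (\<Sum>n\<in>{1..N}. u n) / of_nat N" for u :: "nat \<Rightarrow> complex"
  by (simp add: avg_def divide_inverse scaleR_conv_of_real)

lemma avg_mono:
  fixes u v :: "nat \<Rightarrow> real"
  assumes "\<And>n. 1 \<le> n \<Longrightarrow> n \<le> N \<Longrightarrow> u n \<le> v n"
  shows "avg u N \<le> avg v N"
  unfolding avg_real using assms by (intro divide_right_mono sum_mono) auto

lemma avg_cong:
  assumes "\<And>n. 1 \<le> n \<Longrightarrow> n \<le> N \<Longrightarrow> u n = v n"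
  shows "avg u N = avg v N"
  unfolding avg_def using assms by (intro arg_cong2[where f="scaleR"] sum.cong) auto

lemma avg_add: "avg (\<lambda>n. u n + v n) N = avg u N + avg v N"
  by (simp add: avg_def sum.distrib scaleR_add_right)

lemma avg_diff: "avg (\<lambda>n. u n - v n) N = avg u N - avg v N"
  by (simp add: avg_def sum_subtractf scaleR_diff_right)

lemma avg_mult_left: "avg (\<lambda>n. c * u n) N = c * avg u N" for c :: "'a::real_algebra"
  by (simp add: avg_def sum_distrib_left[symmetric])

lemma avg_mult_right: "avg (\<lambda>n. u n * c) N = avg u N * c" for c :: "'a::real_algebra"
  by (simp add: avg_def sum_distrib_right[symmetric])

lemma avg_sum: "avg (\<lambda>n. \<Sum>i\<in>I. u i n) N = (\<Sum>i\<in>I. avg (u i) N)"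
  unfolding avg_def by (subst sum.swap) (simp add: scaleR_sum_right)

lemma norm_avg_le: "norm (avg u N) \<le> avg (\<lambda>n. norm (u n)) N"
  for u :: "nat \<Rightarrow> 'a::real_normed_vector"
proof -
  have "norm (avg u N) = inverse (real N) * norm (\<Sum>n\<in>{1..N}. u n)"
    by (simp add: avg_def)
  also have "\<dots> \<le> inverse (real N) * (\<Sum>n\<in>{1..N}. norm (u n))"
    by (intro mult_left_mono norm_sum) auto
  finally show ?thesis by (simp add: avg_def)
qed

lemma avg_const: "N > 0 \<Longrightarrow> avg (\<lambda>_. c) N = c"
  by (simp add: avg_def scaleR_conv_of_real sum_constant_scaleR)

lemma avg_nonneg: "(\<And>n. 1 \<le> n \<Longrightarrow> u n \<ge> 0) \<Longrightarrow> avg u N \<ge> 0" for u :: "nat \<Rightarrow> real"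
  unfolding avg_real by (intro divide_nonneg_nonneg sum_nonneg) auto

lemma avg_le_bound:
  fixes u :: "nat \<Rightarrow> real"
  assumes "\<And>n. 1 \<le> n \<Longrightarrow> n \<le> N \<Longrightarrow> u n \<le> c" "c \<ge> 0"
  shows "avg u N \<le> c"
proof (cases "N = 0")
  case False
  then have "avg u N \<le> avg (\<lambda>_. c) N" using assms by (intro avg_mono) auto
  also have "\<dots> = c" using False by (simp add: avg_const)
  finally show ?thesis .
qed (use assms in \<open>simp add: avg_def\<close>)

lemma avg_shift:
  fixes u :: "nat \<Rightarrow> real"
  assumes nn: "\<And>n. 1 \<le> n \<Longrightarrow> 0 \<le> u n" and le: "\<And>n. 1 \<le> n \<Longrightarrow> u n \<le> C"
  shows "avg (\<lambda>n. u (n + m)) N \<le> avg u N + real m * C / real N"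
proof -
  have "(\<Sum>n\<in>{1..N}. u (n + m)) = (\<Sum>n\<in>{1 + m..N + m}. u n)"
    by (rule sum.shift_bounds_cl_nat_ivl[symmetric])
  also have "\<dots> \<le> (\<Sum>n\<in>{1..N} \<union> {N + 1..N + m}. u n)"
    by (rule sum_mono2) (use nn in auto)
  also have "\<dots> = (\<Sum>n\<in>{1..N}. u n) + (\<Sum>n\<in>{N + 1..N + m}. u n)"
    by (rule sum.union_disjoint) auto
  also have "(\<Sum>n\<in>{N + 1..N + m}. u n) \<le> (\<Sum>n\<in>{N + 1..N + m}. C)"
    by (intro sum_mono le) auto
  finally have "(\<Sum>n\<in>{1..N}. u (n + m)) \<le> (\<Sum>n\<in>{1..N}. u n) + real m * C" by simp
  then show ?thesis
    unfolding avg_real add_divide_distrib[symmetric] by (intro divide_right_mono) auto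
qed

lemma avg_tendsto_0:
  fixes u :: "nat \<Rightarrow> 'a::real_normed_vector"
  assumes "u \<longlonglongrightarrow> 0"
  shows "avg u \<longlonglongrightarrow> 0"
proof (rule LIMSEQ_I)
  fix r :: real assume r: "r > 0"
  from assms r obtain n0 where n0: "\<And>n. n \<ge> n0 \<Longrightarrow> norm (u n) < r / 2"
    using LIMSEQ_D[of u 0 "r/2"] by auto
  define C where "C = (\<Sum>n\<in>{1..n0}. norm (u n))"
  obtain n1 :: nat where n1: "real n1 > 2 * C / r" using reals_Archimedean2 by blast
  have "norm (avg u N - 0) < r" if N: "N \<ge> max 1 n1" for N
  proof -
    have N0: "N > 0" "N \<ge> n1" using N by auto
    have "(\<Sum>n\<in>{1..N}. norm (u n)) \<le> (\<Sum>n\<in>{1..N}. (if n \<le> n0 then norm (u n) else 0) + r / 2)"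
    proof (intro sum_mono)
      fix n
      show "norm (u n) \<le> (if n \<le> n0 then norm (u n) else 0) + r / 2"
        using n0[of n] r by auto
    qed
    also have "\<dots> = (\<Sum>n\<in>{1..N}. if n \<le> n0 then norm (u n) else 0) + real N * (r / 2)"
      by (simp add: sum.distrib)
    also have "(\<Sum>n\<in>{1..N}. if n \<le> n0 then norm (u n) else 0) = (\<Sum>n\<in>{1..N} \<inter> {1..n0}. norm (u n))"
      by (subst sum.inter_restrict) (auto intro!: sum.cong)
    also have "\<dots> \<le> C" unfolding C_def by (intro sum_mono2) auto
    finally have *: "(\<Sum>n\<in>{1..N}. norm (u n)) \<le> C + real N * (r / 2)" by simp
    have "norm (avg u N) \<le> avg (\<lambda>n. norm (u n)) N" by (rule norm_avg_le)
    also have "\<dots> \<le> (C + real N * (r / 2)) / real N"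
      unfolding avg_real using * by (intro divide_right_mono) auto
    also have "\<dots> = C / real N + r / 2" using N0 by (simp add: field_simps)
    also have "C / real N < r / 2"
    proof -
      have "2 * C / r < real N" using n1 N0 by linarith
      then show ?thesis using r N0 by (simp add: field_simps)
    qed
    finally show ?thesis by simp
  qed
  then show "\<exists>no. \<forall>n\<ge>no. norm (avg u n - 0) < r" by blast
qed

section \<open>Periodic sequences and their means\<close>

lemma periodic_add_mult:
  fixes g :: "nat \<Rightarrow> 'a"
  assumes "\<And>n. g (n + Q) = g n"
  shows "g (n + k * Q) = g n"
proof (induction k)
  case (Suc k)
  have "g (n + Suc k * Q) = g (n + k * Q + Q)" by (simp add: algebra_simps)
  then show ?case using assms Suc by simp
qed simp

lemma periodic_mod:
  fixes g :: "nat \<Rightarrow> 'a"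
  assumes "\<And>n. g (n + Q) = g n"
  shows "g (n mod Q) = g n"
  using periodic_add_mult[of g Q "n mod Q" "n div Q", OF assms] by (simp add: mult.commute)

lemma sum_period_shift:
  fixes g :: "nat \<Rightarrow> 'a::ab_group_add"
  assumes "\<And>n. g (n + Q) = g n"
  shows "(\<Sum>n\<in>{a..<a + Q}. g n) = (\<Sum>n<Q. g n)"
proof (induction a)
  case (Suc a)
  show ?case
  proof (cases "Q = 0")
    case False
    have "(\<Sum>n\<in>{a..<a + Q}. g n) + g (a + Q) = (\<Sum>n\<in>{a..<Suc (a + Q)}. g n)" by simp
    also have "\<dots> = g a + (\<Sum>n\<in>{Suc a..<Suc (a + Q)}. g n)"
      by (rule sum.atLeast_Suc_lessThan) simp
    finally show ?thesis using Suc assms[of a] by simp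
  qed simp
qed (simp add: atLeast0LessThan)

lemma sum_periods_shift:
  fixes g :: "nat \<Rightarrow> 'a::real_vector"
  assumes "\<And>n. g (n + Q) = g n"
  shows "(\<Sum>n\<in>{a..<a + k * Q}. g n) = real k *\<^sub>R (\<Sum>n<Q. g n)"
proof (induction k)
  case (Suc k)
  have "(\<Sum>n\<in>{a..<a + Suc k * Q}. g n) =
      (\<Sum>n\<in>{a..<a + k * Q}. g n) + (\<Sum>n\<in>{a + k * Q..<(a + k * Q) + Q}. g n)"
    by (subst sum.atLeastLessThan_concat) (auto simp: algebra_simps)
  then show ?case using Suc sum_period_shift[of g Q "a + k * Q", OF assms]
    by (simp add: scaleR_add_left)
qed simp

text \<open>The full periods inside the block reproduce the mean exactly, so only the fewer than
  \<open>Q\<close> leftover terms and their share of the mean remain, each at most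
  \<open>Q * K\<close>. Uniformity in the starting point \<open>a\<close> is what the sliding
  windows need later.\<close>

lemma periodic_sum_bound:
  fixes g :: "nat \<Rightarrow> 'a::real_normed_vector"
  assumes per: "\<And>n. g (n + Q) = g n" and Q: "Q > 0" and K: "\<And>n. norm (g n) \<le> K"
  shows "norm ((\<Sum>n\<in>{a..<a + L}. g n) - real L *\<^sub>R ((\<Sum>n<Q. g n) /\<^sub>R real Q)) \<le> 2 * real Q * K"
proof -
  define k r where "k = L div Q" and "r = L mod Q"
  have L: "L = k * Q + r" and r: "r < Q" using Q by (auto simp: k_def r_def)
  have K0: "K \<ge> 0" using K[of 0] norm_ge_zero order_trans by blast
  have 1: "(\<Sum>n\<in>{a..<a + L}. g n) = real k *\<^sub>R (\<Sum>n<Q. g n) + (\<Sum>n\<in>{a + k * Q..<a + k * Q + r}. g n)"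
    using sum_periods_shift[of g Q a k, OF per]
    using sum.atLeastLessThan_concat[of a "a + k * Q" "a + k * Q + r" g] by (simp add: L add.assoc)
  have 2: "real L *\<^sub>R ((\<Sum>n<Q. g n) /\<^sub>R real Q) = real k *\<^sub>R (\<Sum>n<Q. g n) + real r *\<^sub>R ((\<Sum>n<Q. g n) /\<^sub>R real Q)"
    using Q by (simp add: L scaleR_add_left distrib_right)
  have 3: "norm (\<Sum>n\<in>{a + k * Q..<a + k * Q + r}. g n) \<le> real Q * K"
  proof -
    have "norm (\<Sum>n\<in>{a + k * Q..<a + k * Q + r}. g n) \<le> (\<Sum>n\<in>{a + k * Q..<a + k * Q + r}. K)"
      by (rule sum_norm_le) (use K in auto)
    also have "\<dots> = real r * K" by simp
    also have "\<dots> \<le> real Q * K" using r K0 by (intro mult_right_mono) auto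
    finally show ?thesis .
  qed
  have m: "norm ((\<Sum>n<Q. g n) /\<^sub>R real Q) \<le> K"
  proof -
    have "norm (\<Sum>n<Q. g n) \<le> (\<Sum>n<Q. K)" by (rule sum_norm_le) (use K in auto)
    then show ?thesis using Q by (simp add: field_simps)
  qed
  have 4: "norm (real r *\<^sub>R ((\<Sum>n<Q. g n) /\<^sub>R real Q)) \<le> real Q * K"
    unfolding norm_scaleR using m r K0 by (intro mult_mono) auto
  show ?thesis unfolding 1 2 using 3 4
      norm_triangle_ineq4[of "\<Sum>n\<in>{a + k * Q..<a + k * Q + r}. g n" "real r *\<^sub>R ((\<Sum>n<Q. g n) /\<^sub>R real Q)"]
    by simp
qed

lemma periodic_bounded:
  fixes g :: "nat \<Rightarrow> 'a::real_normed_vector"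
  assumes per: "\<And>n. g (n + Q) = g n" and Q: "Q > 0"
  obtains K where "K > 0" "\<And>n. norm (g n) \<le> K"
proof
  show "(\<Sum>n<Q. norm (g n)) + 1 > 0" by (simp add: add_nonneg_pos sum_nonneg)
  fix n
  have "norm (g n) = norm (g (n mod Q))" by (simp add: periodic_mod[of g Q, OF per])
  also have "\<dots> \<le> (\<Sum>n<Q. norm (g n))" by (rule member_le_sum) (use Q in auto)
  finally show "norm (g n) \<le> (\<Sum>n<Q. norm (g n)) + 1" by simp
qed

lemma avg_periodic_tendsto:
  fixes g :: "nat \<Rightarrow> 'a::real_normed_vector"
  assumes per: "\<And>n. g (n + Q) = g n" and Q: "Q > 0"
  shows "avg g \<longlonglongrightarrow> (\<Sum>n<Q. g n) /\<^sub>R real Q"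
proof -
  obtain K where K: "K > 0" "\<And>n. norm (g n) \<le> K" using periodic_bounded[of g Q] per Q by blast
  show ?thesis
  proof (rule LIM_zero_cancel, rule Lim_null_comparison)
    show "\<forall>\<^sub>F N in sequentially. norm (avg g N - (\<Sum>n<Q. g n) /\<^sub>R real Q) \<le> 2 * real Q * K / real N"
    proof (rule eventually_sequentiallyI[of 1])
      fix N :: nat assume N: "1 \<le> N"
      have "avg g N - (\<Sum>n<Q. g n) /\<^sub>R real Q =
         ((\<Sum>n\<in>{1..<1 + N}. g n) - real N *\<^sub>R ((\<Sum>n<Q. g n) /\<^sub>R real Q)) /\<^sub>R real N"
        using N by (simp add: avg_def scaleR_diff_right atLeastLessThanSuc_atLeastAtMost)
      then show "norm (avg g N - (\<Sum>n<Q. g n) /\<^sub>R real Q) \<le> 2 * real Q * K / real N"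
        using periodic_sum_bound[of g Q K 1 N, OF per Q K(2)] N
        by (simp add: divide_inverse mult.commute mult_right_mono)
    qed
    show "(\<lambda>N. 2 * real Q * K / real N) \<longlonglongrightarrow> 0"
      by (rule lim_const_over_n)
  qed
qed

text \<open>The limsup divides a sum over \<open>n < N\<close> by \<open>N\<close>, whereas
  \<open>avg\<close> includes \<open>n = N\<close>. The shift by one index is absorbed by halving
  \<open>\<epsilon>\<close>.\<close>

lemma RAP_iff:
  "RAP f \<longleftrightarrow> (\<forall>\<epsilon>>0. \<exists>g. periodic_seq g \<and>
     (\<forall>\<^sub>F N in sequentially. avg (\<lambda>n. norm (f n - g n)) N < \<epsilon>))"
proof
  assume R: "RAP f"
  show "\<forall>\<epsilon>>0. \<exists>g. periodic_seq g \<and> (\<forall>\<^sub>F N in sequentially. avg (\<lambda>n. norm (f n - g n)) N < \<epsilon>)"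
  proof (intro allI impI)
    fix \<epsilon> :: real assume e: "\<epsilon> > 0"
    then obtain g where g: "periodic_seq g"
      and l: "limsup (\<lambda>N. ereal (1 / real N * (\<Sum>n\<in>{1..<N}. norm (f n - g n)))) < ereal (\<epsilon> / 2)"
      using R unfolding RAP_def by (meson half_gt_zero)
    have "\<forall>\<^sub>F N in sequentially. ereal (1 / real N * (\<Sum>n\<in>{1..<N}. norm (f n - g n))) < ereal (\<epsilon> / 2)"
      using Limsup_lessD[OF l] .
    then have "\<forall>\<^sub>F N in sequentially. 1 / real N * (\<Sum>n\<in>{1..<N}. norm (f n - g n)) < \<epsilon> / 2" by simp
    then have ev: "\<forall>\<^sub>F N in sequentially. 1 / real (Suc N) * (\<Sum>n\<in>{1..<Suc N}. norm (f n - g n)) < \<epsilon> / 2"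
      by (subst eventually_sequentially_Suc)
    have "\<forall>\<^sub>F N in sequentially. avg (\<lambda>n. norm (f n - g n)) N < \<epsilon>"
      using ev eventually_gt_at_top[of 0]
    proof eventually_elim
      case (elim N)
      define s where "s = (\<Sum>n\<in>{1..N}. norm (f n - g n))"
      have "s < \<epsilon> / 2 * real (Suc N)"
        using elim(1) by (simp add: s_def field_simps atLeastLessThanSuc_atLeastAtMost)
      \<comment> \<open>\<open>Suc N \<le> 2 * N\<close>: here the halved bound is spent.\<close>
      also have "\<dots> \<le> \<epsilon> / 2 * (2 * real N)"
        using e elim(2) by (intro mult_left_mono) auto
      finally show ?case using elim(2) by (simp add: avg_real s_def field_simps)
    qed
    with g show "\<exists>g. periodic_seq g \<and> (\<forall>\<^sub>F N in sequentially. avg (\<lambda>n. norm (f n - g n)) N < \<epsilon>)"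
      by blast
  qed
next
  assume A: "\<forall>\<epsilon>>0. \<exists>g. periodic_seq g \<and> (\<forall>\<^sub>F N in sequentially. avg (\<lambda>n. norm (f n - g n)) N < \<epsilon>)"
  show "RAP f" unfolding RAP_def
  proof (intro allI impI)
    fix \<epsilon> :: real assume e: "\<epsilon> > 0"
    then obtain g where g: "periodic_seq g"
      and ev: "\<forall>\<^sub>F N in sequentially. avg (\<lambda>n. norm (f n - g n)) N < \<epsilon> / 2"
      using A by (meson half_gt_zero)
    have "limsup (\<lambda>N. ereal (1 / real N * (\<Sum>n\<in>{1..<N}. norm (f n - g n)))) \<le> ereal (\<epsilon> / 2)"
    proof (rule Limsup_bounded)
      show "\<forall>\<^sub>F N in sequentially. ereal (1 / real N * (\<Sum>n\<in>{1..<N}. norm (f n - g n))) \<le> ereal (\<epsilon> / 2)"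
        using ev
      proof eventually_elim
        case (elim N)
        have "(\<Sum>n\<in>{1..<N}. norm (f n - g n)) \<le> (\<Sum>n\<in>{1..N}. norm (f n - g n))"
          by (rule sum_mono2) auto
        then have "1 / real N * (\<Sum>n\<in>{1..<N}. norm (f n - g n)) \<le> avg (\<lambda>n. norm (f n - g n)) N"
          unfolding avg_real by (simp add: divide_right_mono)
        with elim have "1 / real N * (\<Sum>n\<in>{1..<N}. norm (f n - g n)) \<le> \<epsilon> / 2" by linarith
        then show ?case by (rule ereal_less_eq(3)[THEN iffD2])
      qed
    qed
    also have "\<dots> < ereal \<epsilon>" using e by simp
    finally show "\<exists>g. periodic_seq g \<and>
        limsup (\<lambda>N. ereal (1 / real N * (\<Sum>n\<in>{1..<N}. norm (f n - g n)))) < ereal \<epsilon>"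
      using g by blast
  qed
qed

section \<open>The Turan-Kubilius inequality\<close>

lemma real_div_nat_bounds:
  fixes N d :: nat
  assumes "d > 0"
  shows "real (N div d) \<le> real N / real d" "real N / real d \<le> real (N div d) + 1"
proof -
  have "real N = real (N div d * d + N mod d)" by simp
  also have "\<dots> = real (N div d) * real d + real (N mod d)" by (simp only: of_nat_add of_nat_mult)
  finally have "real N = real (N div d) * real d + real (N mod d)" .
  moreover have "real (N mod d) \<le> real d" using assms by (simp add: less_imp_le)
  ultimately show "real (N div d) \<le> real N / real d" "real N / real d \<le> real (N div d) + 1"
    using assms by (auto simp: field_simps)
qed

lemma count_dvd: "(\<Sum>n\<in>{1..N}. of_bool (d dvd n)) = N div d" if "d > 0" for N d :: nat
proof -
  have "(\<Sum>n\<in>{1..N}. of_bool (d dvd n)) = card {n\<in>{1..N}. d dvd n}"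
    by (simp add: Int_def Collect_conj_eq[symmetric])
  also have "{n\<in>{1..N}. d dvd n} = (\<lambda>k. d * k) ` {1..N div d}"
  proof (intro equalityI subsetI)
    fix n assume "n \<in> {n\<in>{1..N}. d dvd n}"
    then obtain k where k: "n = d * k" "1 \<le> n" "n \<le> N" by auto
    then have "k \<ge> 1" "k \<le> N div d"
      using that by (auto simp: less_eq_div_iff_mult_less_eq mult.commute Suc_le_eq)
    then show "n \<in> (\<lambda>k. d * k) ` {1..N div d}" using k by auto
  next
    fix n assume "n \<in> (\<lambda>k. d * k) ` {1..N div d}"
    then show "n \<in> {n\<in>{1..N}. d dvd n}"
      using that by (auto simp: less_eq_div_iff_mult_less_eq mult.commute Suc_le_eq)
  qed
  also have "card \<dots> = N div d" using that by (subst card_image) (auto simp: inj_on_def)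
  finally show ?thesis .
qed

lemma real_count_dvd:
  fixes N d :: nat
  assumes "d > 0"
  obtains \<theta> :: real where "(\<Sum>n\<in>{1..N}. of_bool (d dvd n)) = real N / real d - \<theta>" "0 \<le> \<theta>" "\<theta> \<le> 1"
proof
  have "(\<Sum>n\<in>{1..N}. of_bool (d dvd n) :: real) = real (\<Sum>n\<in>{1..N}. of_bool (d dvd n))" by simp
  also have "\<dots> = real (N div d)" by (subst count_dvd[OF assms]) simp
  finally have *: "(\<Sum>n\<in>{1..N}. of_bool (d dvd n) :: real) = real (N div d)" .
  show "(\<Sum>n\<in>{1..N}. of_bool (d dvd n)) = real N / real d - (real N / real d - real (N div d))"
    using * by simp
  show "0 \<le> real N / real d - real (N div d)" using real_div_nat_bounds[OF assms, of N] by simp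
  show "real N / real d - real (N div d) \<le> 1" using real_div_nat_bounds[OF assms, of N] by simp
qed

text \<open>Once the counts of multiples of \<open>p\<close>, \<open>r\<close> and
  \<open>p * r\<close> are inserted, all terms of order \<open>N\<close> cancel: divisibility by
  distinct primes is independent up to rounding. What remains is \<open>a / r + b / p - c\<close>
  with rounding errors in [0, 1], where \<open>a / r\<close> and \<open>b / p\<close> are at most
  1/2.\<close>

lemma prime_indicator_correlation:
  fixes p r N :: nat
  assumes p: "prime p" and r: "prime r" and ne: "p \<noteq> r"
  shows "\<bar>\<Sum>n\<in>{1..N}. (of_bool (p dvd n) - 1 / real p) * (of_bool (r dvd n) - 1 / real r)\<bar> \<le> 1"
proof -
  have cop: "coprime p r" using p r ne by (simp add: primes_coprime)
  have p0[simp]: "p > 0" and r0[simp]: "r > 0" and pr0: "p * r > 0" using p r by (auto simp: prime_gt_0_nat)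
  have ge2: "real p \<ge> 2" "real r \<ge> 2" using prime_ge_2_nat[OF p] prime_ge_2_nat[OF r] by auto
  obtain a where a: "(\<Sum>n\<in>{1..N}. of_bool (p dvd n)) = real N / real p - a" "0 \<le> a" "a \<le> 1"
    by (rule real_count_dvd[OF p0, of N])
  obtain b where b: "(\<Sum>n\<in>{1..N}. of_bool (r dvd n)) = real N / real r - b" "0 \<le> b" "b \<le> 1"
    by (rule real_count_dvd[OF r0, of N])
  obtain c where c: "(\<Sum>n\<in>{1..N}. of_bool (p * r dvd n)) = real N / real (p * r) - c" "0 \<le> c" "c \<le> 1"
    by (rule real_count_dvd[OF pr0, of N])
  have dvd: "p * r dvd n \<longleftrightarrow> p dvd n \<and> r dvd n" for n
  proof
    show "p * r dvd n \<Longrightarrow> p dvd n \<and> r dvd n" using dvd_mult_left[of p r n] dvd_mult_right[of p r n] by blast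
    show "p dvd n \<and> r dvd n \<Longrightarrow> p * r dvd n" using divides_mult[OF _ _ cop, of n] by blast
  qed
  have "(\<Sum>n\<in>{1..N}. (of_bool (p dvd n) - 1 / real p) * (of_bool (r dvd n) - 1 / real r)) =
     (\<Sum>n\<in>{1..N}. of_bool (p * r dvd n) - of_bool (p dvd n) / real r - of_bool (r dvd n) / real p + 1 / (real p * real r))"
    by (intro sum.cong refl) (auto simp: dvd of_bool_def algebra_simps)
  also have "\<dots> = (\<Sum>n\<in>{1..N}. of_bool (p * r dvd n)) - (\<Sum>n\<in>{1..N}. of_bool (p dvd n)) / real r
      - (\<Sum>n\<in>{1..N}. of_bool (r dvd n)) / real p + real N * (1 / (real p * real r))"
    by (simp only: sum.distrib sum_subtractf sum_divide_distrib sum_constant card_atLeastAtMost) simp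
  also have "\<dots> = a / real r + b / real p - c"
    unfolding a(1) b(1) c(1) using ge2 by (simp add: field_simps)
  finally have eq: "(\<Sum>n\<in>{1..N}. (of_bool (p dvd n) - 1 / real p) * (of_bool (r dvd n) - 1 / real r)) =
     a / real r + b / real p - c" .
  have "a / real r \<le> 1 / 2" using a ge2 by (intro frac_le) auto
  moreover have "b / real p \<le> 1 / 2" using b ge2 by (intro frac_le) auto
  moreover have "a / real r \<ge> 0" "b / real p \<ge> 0" using a b by auto
  ultimately show ?thesis unfolding eq using c by linarith
qed

lemma prime_indicator_variance:
  fixes p N :: nat
  assumes p: "prime p"
  shows "0 \<le> (\<Sum>n\<in>{1..N}. (of_bool (p dvd n) - 1 / real p) * (of_bool (p dvd n) - 1 / real p))"
    and "(\<Sum>n\<in>{1..N}. (of_bool (p dvd n) - 1 / real p) * (of_bool (p dvd n) - 1 / real p)) \<le> real N / real p"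
proof -
  show "0 \<le> (\<Sum>n\<in>{1..N}. (of_bool (p dvd n) - 1 / real p) * (of_bool (p dvd n) - 1 / real p))"
    by (intro sum_nonneg zero_le_square)
  have p0[simp]: "p > 0" using p by (auto simp: prime_gt_0_nat)
  have ge2: "real p \<ge> 2" using prime_ge_2_nat[OF p] by auto
  obtain a where a: "(\<Sum>n\<in>{1..N}. of_bool (p dvd n)) = real N / real p - a" "0 \<le> a" "a \<le> 1"
    by (rule real_count_dvd[OF p0, of N])
  have "(\<Sum>n\<in>{1..N}. (of_bool (p dvd n) - 1 / real p) * (of_bool (p dvd n) - 1 / real p)) =
     (\<Sum>n\<in>{1..N}. of_bool (p dvd n) * (1 - 2 / real p) + 1 / (real p * real p))"
    by (intro sum.cong refl) (simp add: algebra_simps of_bool_def)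
  also have "\<dots> = (\<Sum>n\<in>{1..N}. of_bool (p dvd n)) * (1 - 2 / real p) + real N * (1 / (real p * real p))"
    by (simp only: sum.distrib sum_distrib_right sum_constant card_atLeastAtMost) simp
  also have "\<dots> \<le> real N / real p * (1 - 2 / real p) + real N / real p * (1 / real p)"
    unfolding a(1) using ge2 a by (intro add_mono mult_right_mono) (auto simp: field_simps)
  also have "\<dots> = real N / real p * (1 - 1 / real p)" by (simp add: algebra_simps)
  also have "\<dots> \<le> real N / real p * 1" by (intro mult_left_mono) auto
  finally show "(\<Sum>n\<in>{1..N}. (of_bool (p dvd n) - 1 / real p) * (of_bool (p dvd n) - 1 / real p)) \<le> real N / real p"
    by simp
qed

text \<open>Expanding the square leaves the correlations of the centred indicators, at most
  \<open>N / p\<close> on the diagonal and at most 1 off it. The second term is harmless as long as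
  the primes stay below \<open>sqrt N\<close>; larger primes are treated separately.\<close>

lemma turan_kubilius:
  fixes c :: "nat \<Rightarrow> complex"
  assumes A: "finite A" "\<And>p. p \<in> A \<Longrightarrow> prime p"
  shows "(\<Sum>n\<in>{1..N}. (norm (\<Sum>p\<in>A. c p * (of_bool (p dvd n) - 1 / of_nat p)))\<^sup>2)
    \<le> real N * (\<Sum>p\<in>A. (norm (c p))\<^sup>2 / real p) + (\<Sum>p\<in>A. norm (c p))\<^sup>2"
proof -
  define x :: "nat \<Rightarrow> nat \<Rightarrow> real" where "x p n = of_bool (p dvd n) - 1 / real p" for p n
  define V where "V p r = (\<Sum>n\<in>{1..N}. x p n * x r n)" for p r
  have sq: "(norm (\<Sum>p\<in>A. c p * (of_bool (p dvd n) - 1 / of_nat p)))\<^sup>2 =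
      Re (\<Sum>p\<in>A. \<Sum>r\<in>A. c p * cnj (c r) * of_real (x p n * x r n))" for n
  proof -
    have e: "(\<Sum>p\<in>A. c p * (of_bool (p dvd n) - 1 / of_nat p)) = (\<Sum>p\<in>A. c p * of_real (x p n))"
      by (intro sum.cong) (auto simp: x_def of_bool_def)
    have "complex_of_real ((norm (\<Sum>p\<in>A. c p * of_real (x p n)))\<^sup>2) =
        (\<Sum>p\<in>A. c p * of_real (x p n)) * cnj (\<Sum>p\<in>A. c p * of_real (x p n))"
      by (rule complex_norm_square)
    also have "\<dots> = (\<Sum>p\<in>A. \<Sum>r\<in>A. c p * cnj (c r) * of_real (x p n * x r n))"
      unfolding cnj_sum sum_product by (intro sum.cong refl) simp
    finally show ?thesis unfolding e by (metis Re_complex_of_real)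
  qed
  \<comment> \<open>The product \<open>norm (c p) * norm (c r)\<close> is allowed on the diagonal
    too, so that these terms add up to a full square.\<close>
  have V: "norm (c p * cnj (c r) * of_real (V p r)) \<le> (if p = r then real N * ((norm (c p))\<^sup>2 / real p) else 0) + norm (c p) * norm (c r)"
    if "p \<in> A" "r \<in> A" for p r
  proof (cases "p = r")
    case True
    have "0 \<le> V p p" "V p p \<le> real N / real p"
      unfolding V_def x_def using prime_indicator_variance[of p N] that A by auto
    then have "(norm (c p))\<^sup>2 * \<bar>V p p\<bar> \<le> (norm (c p))\<^sup>2 * (real N / real p)"
      by (intro mult_left_mono) auto
    moreover have "norm (c p) * norm (c p) \<ge> 0" by simp
    moreover have "(norm (c p))\<^sup>2 * (real N / real p) = real N * ((norm (c p))\<^sup>2 / real p)" by simp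
    ultimately have "(norm (c p))\<^sup>2 * \<bar>V p p\<bar> \<le> real N * ((norm (c p))\<^sup>2 / real p) + norm (c p) * norm (c p)"
      by linarith
    then show ?thesis using True by (simp add: norm_mult power2_eq_square mult_ac)
  next
    case False
    have "\<bar>V p r\<bar> \<le> 1"
      unfolding V_def x_def using prime_indicator_correlation[of p r N] that A False by auto
    then have "norm (c p) * norm (c r) * \<bar>V p r\<bar> \<le> norm (c p) * norm (c r) * 1"
      by (intro mult_left_mono) auto
    then show ?thesis using False by (simp add: norm_mult)
  qed
  have "(\<Sum>n\<in>{1..N}. (norm (\<Sum>p\<in>A. c p * (of_bool (p dvd n) - 1 / of_nat p)))\<^sup>2) =
      Re (\<Sum>n\<in>{1..N}. \<Sum>p\<in>A. \<Sum>r\<in>A. c p * cnj (c r) * of_real (x p n * x r n))"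
    unfolding sq by simp
  also have "(\<Sum>n\<in>{1..N}. \<Sum>p\<in>A. \<Sum>r\<in>A. c p * cnj (c r) * of_real (x p n * x r n)) =
      (\<Sum>p\<in>A. \<Sum>r\<in>A. c p * cnj (c r) * of_real (V p r))"
    unfolding V_def of_real_sum sum_distrib_left
    by (subst sum.swap, rule sum.cong[OF refl], subst sum.swap) simp
  also have "Re \<dots> \<le> norm \<dots>" by (rule complex_Re_le_cmod)
  also have "\<dots> \<le> (\<Sum>p\<in>A. \<Sum>r\<in>A. (if p = r then real N * ((norm (c p))\<^sup>2 / real p) else 0) + norm (c p) * norm (c r))"
    by (intro sum_norm_le V)
  also have "\<dots> = real N * (\<Sum>p\<in>A. (norm (c p))\<^sup>2 / real p) + (\<Sum>p\<in>A. norm (c p))\<^sup>2"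
    unfolding power2_eq_square[of "sum _ _"] sum_product using A(1) by (simp add: sum.distrib sum_distrib_left)
  finally show ?thesis .
qed

text \<open>An integer up to \<open>N\<close> has at most one prime factor above the square root of \<open>N\<close>.\<close>

lemma sum_inverse_large_primes:
  fixes N :: nat
  assumes N: "N > 0"
  shows "(\<Sum>p | prime p \<and> p \<le> N \<and> N < p\<^sup>2. 1 / real p) \<le> 2"
proof -
  define A where "A = {p. prime p \<and> p \<le> N \<and> N < p\<^sup>2}"
  have finA: "finite A" by (rule finite_subset[of _ "{..N}"]) (auto simp: A_def)
  have pos: "p > 0" if "p \<in> A" for p using that by (auto simp: A_def prime_gt_0_nat)
  have one: "(\<Sum>p\<in>A. of_bool (p dvd n)) \<le> (1::nat)" if n: "n \<in> {1..N}" for n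
  proof (rule ccontr)
    assume "\<not> ?thesis"
    then have "\<not> card {p\<in>A. p dvd n} \<le> Suc 0" using finA by (simp add: Int_def Collect_conj_eq[symmetric])
    then obtain p r where pr: "p \<in> A" "r \<in> A" "p dvd n" "r dvd n" "p \<noteq> r"
      using finA by (auto simp: card_le_Suc0_iff_eq)
    then have "coprime p r" by (auto simp: A_def primes_coprime)
    with pr have "p * r dvd n" by (simp add: divides_mult)
    then have le: "p * r \<le> N" using n dvd_imp_le[of "p * r" n] by auto
    have "N * N < p\<^sup>2 * r\<^sup>2" using pr pos by (intro mult_strict_mono) (auto simp: A_def)
    also have "\<dots> = (p * r) * (p * r)" by (simp add: power2_eq_square)
    also have "\<dots> \<le> N * N" using le by (intro mult_mono) auto
    finally show False by simp
  qed
  have "(\<Sum>p\<in>A. N div p) = (\<Sum>p\<in>A. \<Sum>n\<in>{1..N}. of_bool (p dvd n))"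
    by (intro sum.cong refl count_dvd[symmetric] pos)
  also have "\<dots> = (\<Sum>n\<in>{1..N}. \<Sum>p\<in>A. of_bool (p dvd n))" by (rule sum.swap)
  also have "\<dots> \<le> (\<Sum>n\<in>{1..N}. 1)" by (intro sum_mono one)
  finally have 1: "(\<Sum>p\<in>A. N div p) \<le> N" by simp
  have "A \<subseteq> {1..N}" using pos by (auto simp: A_def Suc_le_eq)
  then have 2: "card A \<le> N" using card_mono[of "{1..N}" A] by auto
  have "(\<Sum>p\<in>A. real N / real p) \<le> (\<Sum>p\<in>A. real (N div p) + 1)"
    by (intro sum_mono real_div_nat_bounds pos)
  also have "\<dots> = real (\<Sum>p\<in>A. N div p) + real (card A)" by (simp add: sum.distrib)
  also have "\<dots> \<le> real N + real N" using 1 2 by linarith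
  finally have "real N * (\<Sum>p\<in>A. 1 / real p) \<le> real N * 2" by (simp add: sum_distrib_left)
  then show ?thesis using N by (simp add: A_def)
qed

text \<open>Cauchy-Schwarz with the weights \<open>1 / p\<close>. Square-sum information, which is
  what the distance provides, becomes a bound for the plain sum, but only on the range between
  \<open>sqrt N\<close> and \<open>N\<close>.\<close>

lemma sum_large_primes_le:
  fixes w :: "nat \<Rightarrow> real"
  assumes N: "N > 0" and B: "B \<subseteq> {p. prime p \<and> p \<le> N \<and> N < p\<^sup>2}"
  shows "(\<Sum>p\<in>B. \<bar>w p\<bar> / real p) \<le> sqrt (2 * (\<Sum>p\<in>B. (w p)\<^sup>2 / real p))"
proof -
  have finA: "finite {p. prime p \<and> p \<le> N \<and> N < p\<^sup>2}"
    by (rule finite_subset[of _ "{..N}"]) auto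
  then have finB: "finite B" using B finite_subset by blast
  have "(\<Sum>p\<in>B. \<bar>w p\<bar> / real p) = (\<Sum>p\<in>B. (1 / sqrt (real p)) * (\<bar>w p\<bar> / sqrt (real p)))"
    by (intro sum.cong) auto
  also have "\<dots> \<le> sqrt ((\<Sum>p\<in>B. (1 / sqrt (real p))\<^sup>2) * (\<Sum>p\<in>B. (\<bar>w p\<bar> / sqrt (real p))\<^sup>2))"
    by (intro real_le_rsqrt Cauchy_Schwarz_ineq_sum)
  also have "(\<Sum>p\<in>B. (1 / sqrt (real p))\<^sup>2) = (\<Sum>p\<in>B. 1 / real p)" by (simp add: power_divide)
  also have "(\<Sum>p\<in>B. (\<bar>w p\<bar> / sqrt (real p))\<^sup>2) = (\<Sum>p\<in>B. (w p)\<^sup>2 / real p)" by (simp add: power_divide)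
  also have "(\<Sum>p\<in>B. 1 / real p) \<le> 2"
    using sum_mono2[OF finA B, of "\<lambda>p. 1 / real p"] sum_inverse_large_primes[OF N] by simp
  finally show ?thesis by (simp add: mult_right_mono sum_nonneg)
qed

section \<open>Smooth and rough parts, and concentration of multiplicative functions\<close>

definition prime_part :: "nat set \<Rightarrow> nat \<Rightarrow> nat" where
  "prime_part A n = (\<Prod>p\<in>prime_factors n \<inter> A. p ^ multiplicity p n)"

lemma unit_multiplicative_norm: "unit_multiplicative f \<Longrightarrow> n > 0 \<Longrightarrow> norm (f n) \<le> 1"
  by (simp add: unit_multiplicative_def)

lemma unit_multiplicative_prod:
  assumes f: "unit_multiplicative f" "f 1 = 1" and S: "finite S" "\<And>p. p \<in> S \<Longrightarrow> prime p"
  shows "f (\<Prod>p\<in>S. p ^ e p) = (\<Prod>p\<in>S. f (p ^ e p))"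
  using S
proof (induction S rule: finite_induct)
  case (insert p S)
  have "coprime (p ^ e p) (\<Prod>p\<in>S. p ^ e p)"
  proof (rule prod_coprime_right)
    fix r assume "r \<in> S"
    then show "coprime (p ^ e p) (r ^ e r)"
      using insert.hyps insert.prems[of p] insert.prems[of r] primes_coprime[of p r] by auto
  qed
  moreover have "p ^ e p > 0" using insert.prems[of p] prime_gt_0_nat by auto
  moreover have "(\<Prod>p\<in>S. p ^ e p) > 0" using insert.prems prime_gt_0_nat by (intro prod_pos) auto
  ultimately show ?case using insert f(1) by (simp add: unit_multiplicative_def)
qed (use f in simp)

lemma prime_part_pos: "prime_part A n > 0"
  unfolding prime_part_def by (intro prod_pos) (auto dest: in_prime_factors_imp_prime simp: prime_gt_0_nat)

lemma unit_multiplicative_prime_part: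
  assumes "unit_multiplicative f" "f 1 = 1"
  shows "f (prime_part A n) = (\<Prod>p\<in>prime_factors n \<inter> A. f (p ^ multiplicity p n))"
  unfolding prime_part_def by (rule unit_multiplicative_prod[OF assms]) auto

lemma coprime_prime_part: "A \<inter> B = {} \<Longrightarrow> coprime (prime_part A n) (prime_part B n)"
  unfolding prime_part_def
proof (intro prod_coprime_left prod_coprime_right)
  fix p r assume "A \<inter> B = {}" "p \<in> prime_factors n \<inter> A" "r \<in> prime_factors n \<inter> B"
  then have "prime p" "prime r" "p \<noteq> r" by auto
  then show "coprime (p ^ multiplicity p n) (r ^ multiplicity r n)"
    by (simp add: primes_coprime)
qed

lemma prime_part_mult:
  assumes "n > 0"
  shows "prime_part A n * prime_part (- A) n = n"
proof -
  have "prime_part A n * prime_part (- A) n = (\<Prod>p\<in>prime_factors n. p ^ multiplicity p n)"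
    unfolding prime_part_def
    by (subst prod.union_disjoint[symmetric]) (auto intro!: prod.cong)
  also have "\<dots> = n" using prod_prime_factors[of n] assms by simp
  finally show ?thesis .
qed

text \<open>The derivative of \<open>exp\<close> has modulus at most 1 on the left half-plane, which
  is convex.\<close>

lemma norm_exp_diff_le:
  fixes a b :: complex
  assumes "Re a \<le> 0" "Re b \<le> 0"
  shows "norm (exp a - exp b) \<le> norm (a - b)"
proof -
  have "norm (exp a - exp b) \<le> 1 * norm (a - b)"
  proof (rule field_differentiable_bound[where S = "{z. Re z \<le> 0}" and f' = exp])
    show "convex {z. Re z \<le> 0}" by (rule convex_halfspace_Re_le)
    show "(exp has_field_derivative exp z) (at z within {z. Re z \<le> 0})" for z
      by (auto intro!: derivative_eq_intros)
    show "norm (exp z) \<le> 1" if "z \<in> {z. Re z \<le> 0}" for z :: complex using that by simp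
  qed (use assms in auto)
  then show ?thesis by simp
qed

text \<open>Converts the distance, which sees only \<open>1 - Re z\<close>, into control of the
  whole of \<open>z - 1\<close>, imaginary part included, at the price of a square.\<close>

lemma norm_sub_one_sq_le:
  fixes z :: complex
  assumes "norm z \<le> 1"
  shows "(norm (z - 1))\<^sup>2 \<le> 2 * (1 - Re z)"
proof -
  have "(norm (z - 1))\<^sup>2 = (norm z)\<^sup>2 - 2 * Re z + 1"
    unfolding cmod_power2 by (simp add: power2_eq_square algebra_simps)
  moreover have "(norm z)\<^sup>2 \<le> 1" using assms by (simp add: power_le_one)
  ultimately show ?thesis by simp
qed

text \<open>\<open>z\<close> and \<open>exp (z - 1)\<close> agree to first order at
  \<open>z = 1\<close>. The quadratic remainder has the constant \<open>exp 2 \<le> 9\<close>, and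
  the square of \<open>norm (z - 1)\<close> is at most \<open>2 * (1 - Re z)\<close>; hence
  18.\<close>

lemma norm_sub_exp_le:
  fixes z :: complex
  assumes z: "norm z \<le> 1"
  shows "norm (z - exp (z - 1)) \<le> 18 * (1 - Re z)"
proof -
  let ?w = "z - 1"
  have "norm (exp ?w - (\<Sum>k\<le>1. ?w ^ k / (fact k))) \<le> exp \<bar>Re ?w\<bar> * (norm ?w) ^ (Suc 1) / (fact 1)"
    by (rule Taylor_exp)
  then have "norm (exp ?w - z) \<le> exp \<bar>Re ?w\<bar> * (norm ?w)\<^sup>2"
    by (simp add: numeral_2_eq_2)
  also have "exp \<bar>Re ?w\<bar> \<le> 9"
  proof -
    have "\<bar>Re z\<bar> \<le> 1" using abs_Re_le_cmod[of z] z by linarith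
    then have "exp \<bar>Re ?w\<bar> \<le> exp (1 + 1 :: real)" by (subst exp_le_cancel_iff) auto
    also have "\<dots> = exp 1 * exp 1" by (rule exp_add)
    also have "\<dots> \<le> 3 * 3" by (intro mult_mono exp_le) auto
    finally show ?thesis by simp
  qed
  also have "(9::real) * (norm ?w)\<^sup>2 \<le> 9 * (2 * (1 - Re z))"
    by (intro mult_left_mono norm_sub_one_sq_le z) auto
  finally show ?thesis by (simp add: norm_minus_commute mult_right_mono)
qed

lemma avg_le_sqrt_avg_sq:
  fixes u :: "nat \<Rightarrow> real"
  shows "avg u N \<le> sqrt (avg (\<lambda>n. (u n)\<^sup>2) N)"
proof (cases "N = 0")
  case False
  have "(\<Sum>n\<in>{1..N}. u n * 1)\<^sup>2 \<le> (\<Sum>n\<in>{1..N}. (u n)\<^sup>2) * (\<Sum>n\<in>{1..N}. 1\<^sup>2)"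
    by (rule Cauchy_Schwarz_ineq_sum)
  then have "(avg u N)\<^sup>2 \<le> avg (\<lambda>n. (u n)\<^sup>2) N"
    using False unfolding avg_real power_divide
    by (simp add: power2_eq_square[of "real N"] field_simps)
  then show ?thesis by (rule real_le_rsqrt)
qed (simp add: avg_def)

lemma avg_dvd_le:
  assumes "d > 0"
  shows "avg (\<lambda>n. of_bool (d dvd n)) N \<le> 1 / real d"
proof (cases "N = 0")
  case False
  have "(\<Sum>n\<in>{1..N}. of_bool (d dvd n) :: real) = real (\<Sum>n\<in>{1..N}. of_bool (d dvd n))" by simp
  also have "\<dots> = real (N div d)" by (subst count_dvd[OF assms]) simp
  also have "\<dots> \<le> real N / real d" by (rule real_div_nat_bounds[OF assms])
  finally show ?thesis using False by (simp add: avg_real field_simps)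
qed (simp add: avg_def)

text \<open>Primes up to \<open>sqrt N\<close> go through \<open>turan_kubilius\<close>. Above
  \<open>sqrt N\<close> centring brings no gain, and the triangle inequality with
  \<open>sum_large_primes_le\<close> suffices. The two ranges contribute 1 and 2 to the factor
  3.\<close>

lemma additive_concentration:
  fixes c :: "nat \<Rightarrow> complex"
  assumes P: "P \<subseteq> {p. prime p \<and> p \<le> N}" and N: "N > 0"
  shows "avg (\<lambda>n. norm (\<Sum>p\<in>P. c p * (of_bool (p dvd n) - 1 / of_nat p))) N
    \<le> 3 * sqrt (2 * (\<Sum>p\<in>P. (norm (c p))\<^sup>2 / real p))"
proof -
  define P1 P2 where "P1 = {p\<in>P. p\<^sup>2 \<le> N}" and "P2 = {p\<in>P. N < p\<^sup>2}"
  have finP: "finite P" by (rule finite_subset[of _ "{..N}"]) (use P in auto)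
  have fin: "finite P1" "finite P2" using finP by (auto simp: P1_def P2_def)
  have pos: "p > 0" if "p \<in> P" for p using that P by (auto simp: prime_gt_0_nat)
  have split: "(\<Sum>p\<in>P. g p) = (\<Sum>p\<in>P1. g p) + (\<Sum>p\<in>P2. g p)" for g :: "nat \<Rightarrow> complex"
    using finP by (subst sum.union_disjoint[symmetric]) (auto simp: P1_def P2_def intro!: sum.cong)
  define V where "V = (\<Sum>p\<in>P. (norm (c p))\<^sup>2 / real p)"
  have V1: "(\<Sum>p\<in>P1. (norm (c p))\<^sup>2 / real p) \<le> V" and V2: "(\<Sum>p\<in>P2. (norm (c p))\<^sup>2 / real p) \<le> V"
    unfolding V_def by (intro sum_mono2 finP; auto simp: P1_def P2_def)+
  \<comment> \<open>At most \<open>m\<close> primes lie up to the largest element \<open>m\<close>,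
    so their sum is at most the square of \<open>m\<close>, hence at most \<open>N\<close>. This
    tames the second term of \<open>turan_kubilius\<close>.\<close>
  have sumP1: "(\<Sum>p\<in>P1. real p) \<le> real N"
  proof (cases "P1 = {}")
    case False
    define m where "m = Max P1"
    have m: "m \<in> P1" using False fin by (simp add: m_def)
    have "P1 \<subseteq> {1..m}" using fin pos by (auto simp: m_def P1_def Suc_le_eq)
    then have cm: "card P1 \<le> m" using card_mono[of "{1..m}" P1] by auto
    have "(\<Sum>p\<in>P1. real p) \<le> (\<Sum>p\<in>P1. real m)" using fin by (intro sum_mono) (auto simp: m_def)
    also have "\<dots> \<le> real m * real m" using cm by (simp add: mult_right_mono)
    also have "\<dots> \<le> real N" using m unfolding P1_def
      by (metis (mono_tags, lifting) mem_Collect_eq of_nat_le_iff of_nat_mult power2_eq_square)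
    finally show ?thesis .
  qed simp
  have s1: "(\<Sum>p\<in>P1. norm (c p))\<^sup>2 \<le> V * real N"
  proof -
    have "(\<Sum>p\<in>P1. norm (c p)) = (\<Sum>p\<in>P1. (norm (c p) / sqrt (real p)) * sqrt (real p))"
      using pos by (intro sum.cong) (auto simp: P1_def)
    also have "\<dots>\<^sup>2 \<le> (\<Sum>p\<in>P1. (norm (c p) / sqrt (real p))\<^sup>2) * (\<Sum>p\<in>P1. (sqrt (real p))\<^sup>2)"
      by (rule Cauchy_Schwarz_ineq_sum)
    also have "\<dots> = (\<Sum>p\<in>P1. (norm (c p))\<^sup>2 / real p) * (\<Sum>p\<in>P1. real p)" by (simp add: power_divide)
    also have "\<dots> \<le> V * real N" using V1 sumP1 by (intro mult_mono) (auto intro!: sum_nonneg order_trans[OF _ V1])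
    finally show ?thesis .
  qed
  have small: "avg (\<lambda>n. norm (\<Sum>p\<in>P1. c p * (of_bool (p dvd n) - 1 / of_nat p))) N \<le> sqrt (2 * V)"
  proof -
    have "(\<Sum>n\<in>{1..N}. (norm (\<Sum>p\<in>P1. c p * (of_bool (p dvd n) - 1 / of_nat p)))\<^sup>2)
        \<le> real N * (\<Sum>p\<in>P1. (norm (c p))\<^sup>2 / real p) + (\<Sum>p\<in>P1. norm (c p))\<^sup>2"
      by (rule turan_kubilius) (use fin P in \<open>auto simp: P1_def\<close>)
    also have "\<dots> \<le> real N * V + V * real N" using s1 V1 by (intro add_mono mult_left_mono) auto
    finally have "avg (\<lambda>n. (norm (\<Sum>p\<in>P1. c p * (of_bool (p dvd n) - 1 / of_nat p)))\<^sup>2) N \<le> 2 * V"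
      using N by (simp add: avg_real divide_le_eq algebra_simps)
    then show ?thesis using order_trans[OF avg_le_sqrt_avg_sq] by (simp add: real_sqrt_le_mono)
  qed
  have large: "avg (\<lambda>n. norm (\<Sum>p\<in>P2. c p * (of_bool (p dvd n) - 1 / of_nat p))) N \<le> 2 * sqrt (2 * V)"
  proof -
    have "avg (\<lambda>n. norm (\<Sum>p\<in>P2. c p * (of_bool (p dvd n) - 1 / of_nat p))) N
        \<le> avg (\<lambda>n. \<Sum>p\<in>P2. norm (c p) * (of_bool (p dvd n) + 1 / real p)) N"
    proof (intro avg_mono sum_norm_le)
      fix n p
      have "norm (of_bool (p dvd n) - 1 / of_nat p :: complex) \<le> of_bool (p dvd n) + 1 / real p"
        using norm_triangle_ineq4[of "of_bool (p dvd n) :: complex" "1 / of_nat p"]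
        by (auto simp: norm_divide of_bool_def split: if_splits)
      then show "norm (c p * (of_bool (p dvd n) - 1 / of_nat p)) \<le> norm (c p) * (of_bool (p dvd n) + 1 / real p)"
        unfolding norm_mult by (intro mult_left_mono) auto
    qed
    also have "\<dots> = (\<Sum>p\<in>P2. norm (c p) * (avg (\<lambda>n. of_bool (p dvd n)) N + 1 / real p))"
      using N by (simp add: avg_sum avg_mult_left avg_add avg_const)
    also have "\<dots> \<le> (\<Sum>p\<in>P2. norm (c p) * (1 / real p + 1 / real p))"
      using pos by (intro sum_mono mult_left_mono add_mono avg_dvd_le) (auto simp: P2_def)
    also have "\<dots> = 2 * (\<Sum>p\<in>P2. \<bar>norm (c p)\<bar> / real p)"
      by (simp add: sum_distrib_left algebra_simps)
    also have "\<dots> \<le> 2 * sqrt (2 * (\<Sum>p\<in>P2. (norm (c p))\<^sup>2 / real p))"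
      using P by (intro mult_left_mono sum_large_primes_le[OF N]) (auto simp: P2_def)
    also have "\<dots> \<le> 2 * sqrt (2 * V)" using V2 by (simp add: real_sqrt_le_mono)
    finally show ?thesis .
  qed
  have "avg (\<lambda>n. norm (\<Sum>p\<in>P. c p * (of_bool (p dvd n) - 1 / of_nat p))) N \<le>
     avg (\<lambda>n. norm (\<Sum>p\<in>P1. c p * (of_bool (p dvd n) - 1 / of_nat p)) + norm (\<Sum>p\<in>P2. c p * (of_bool (p dvd n) - 1 / of_nat p))) N"
    by (intro avg_mono) (simp add: split norm_triangle_ineq)
  also have "\<dots> \<le> sqrt (2 * V) + 2 * sqrt (2 * V)"
    unfolding avg_add using small large by simp
  finally show ?thesis by (simp add: V_def)
qed

text \<open>The value at the rough part is a product over primes. Replacing a factor by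
  \<open>exp (H p - 1)\<close> costs \<open>18 * (1 - Re (H p))\<close> if \<open>p\<close> divides
  \<open>n\<close> exactly once and at most 2 otherwise. The resulting exponential of an additive
  function is then compared with the exponential of its mean.\<close>

lemma multiplicative_concentration:
  fixes H :: "nat \<Rightarrow> complex" and y N :: nat
  assumes H: "unit_multiplicative H" "H 1 = 1" and N: "N > 0"
  defines "P \<equiv> {p. prime p \<and> y < p \<and> p \<le> N}"
  shows "avg (\<lambda>n. norm (H (prime_part {y<..} n) - exp (\<Sum>p\<in>P. (H p - 1) / of_nat p))) N
     \<le> 18 * (\<Sum>p\<in>P. (1 - Re (H p)) / real p) + 2 * (\<Sum>p\<in>P. 1 / (real p)\<^sup>2)
        + 6 * sqrt (\<Sum>p\<in>P. (1 - Re (H p)) / real p)"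
proof -
  define S where "S = (\<Sum>p\<in>P. (1 - Re (H p)) / real p)"
  define c where "c p = H p - 1" for p
  have finP: "finite P" by (rule finite_subset[of _ "{..N}"]) (auto simp: P_def)
  have Hn: "norm (H p) \<le> 1" if "p > 0" for p using H(1) that by (rule unit_multiplicative_norm)
  have pos: "p > 0" if "p \<in> P" for p using that by (auto simp: P_def prime_gt_0_nat)
  have Rec: "Re (H p) \<le> 1" if "p > 0" for p
    using complex_Re_le_cmod[of "H p"] Hn[OF that] by linarith
  have pf: "prime_factors n \<inter> {y<..} = {p\<in>P. p dvd n}" if "1 \<le> n" "n \<le> N" for n
  proof -
    have "p \<le> N" if "p dvd n" for p using dvd_imp_le[OF that] \<open>1 \<le> n\<close> \<open>n \<le> N\<close> by simp
    then show ?thesis using that by (auto simp: P_def prime_factors_dvd)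
  qed
  have pw: "norm (H (prime_part {y<..} n) - exp (\<Sum>p\<in>P. (H p - 1) / of_nat p)) \<le>
      (\<Sum>p\<in>P. of_bool (p dvd n) * (18 * (1 - Re (H p))) + of_bool (p\<^sup>2 dvd n) * 2)
      + norm (\<Sum>p\<in>P. c p * (of_bool (p dvd n) - 1 / of_nat p))"
    if n: "1 \<le> n" "n \<le> N" for n
  proof -
    define F where "F = {p\<in>P. p dvd n}"
    have Fp: "p > 0" "prime p" "p dvd n" if "p \<in> F" for p using that pos by (auto simp: F_def P_def)
    have e1: "H (prime_part {y<..} n) = (\<Prod>p\<in>F. H (p ^ multiplicity p n))"
      unfolding unit_multiplicative_prime_part[OF H] pf[OF n] F_def ..
    have e2: "exp (\<Sum>p\<in>F. c p) = (\<Prod>p\<in>F. exp (c p))"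
      using finP by (intro exp_sum) (auto simp: F_def)
    have Re_c: "Re (c p) \<le> 0" if "p > 0" for p using Rec[OF that] by (simp add: c_def)
    \<comment> \<open>Both products have factors in the closed unit disc, so they differ by at most
      the sum of the differences of the factors.\<close>
    have "norm ((\<Prod>p\<in>F. H (p ^ multiplicity p n)) - (\<Prod>p\<in>F. exp (c p)))
        \<le> (\<Sum>p\<in>F. norm (H (p ^ multiplicity p n) - exp (c p)))"
      using Fp Re_c by (intro norm_prod_diff Hn) auto
    also have "\<dots> \<le> (\<Sum>p\<in>F. 18 * (1 - Re (H p)) + of_bool (p\<^sup>2 dvd n) * 2)"
    proof (intro sum_mono)
      fix p assume p: "p \<in> F"
      show "norm (H (p ^ multiplicity p n) - exp (c p)) \<le> 18 * (1 - Re (H p)) + of_bool (p\<^sup>2 dvd n) * 2"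
      proof (cases "multiplicity p n \<ge> 2")
        case True
        then have "p\<^sup>2 dvd n" using multiplicity_dvd'[of 2 p n] by simp
        moreover have "norm (H (p ^ multiplicity p n) - exp (c p)) \<le> 1 + 1"
          using Fp[OF p] Hn[of "p ^ multiplicity p n"] Re_c[of p]
          by (intro order_trans[OF norm_triangle_ineq4] add_mono) auto
        ultimately show ?thesis using Rec[of p] Fp[OF p] by simp
      next
        case False
        moreover have "multiplicity p n \<ge> 1"
          using Fp[OF p] n by (intro multiplicity_geI) (auto simp: prime_gt_1_nat)
        ultimately have "multiplicity p n = 1" by simp
        then have "norm (H (p ^ multiplicity p n) - exp (c p)) \<le> 18 * (1 - Re (H p))"
          using norm_sub_exp_le[of "H p"] Hn[of p] Fp[OF p] by (simp add: c_def)
        then show ?thesis by (simp add: add_increasing2)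
      qed
    qed
    also have "\<dots> = (\<Sum>p\<in>P. of_bool (p dvd n) * (18 * (1 - Re (H p)) + of_bool (p\<^sup>2 dvd n) * 2))"
      unfolding F_def using finP by (subst sum.inter_filter) (auto simp: of_bool_def intro!: sum.cong)
    also have "\<dots> \<le> (\<Sum>p\<in>P. of_bool (p dvd n) * (18 * (1 - Re (H p))) + of_bool (p\<^sup>2 dvd n) * 2)"
      by (intro sum_mono) (auto simp: of_bool_def)
    finally have A: "norm (H (prime_part {y<..} n) - exp (\<Sum>p\<in>F. c p)) \<le>
       (\<Sum>p\<in>P. of_bool (p dvd n) * (18 * (1 - Re (H p))) + of_bool (p\<^sup>2 dvd n) * 2)"
      unfolding e1 e2 .
    \<comment> \<open>Both exponents have nonpositive real part, so \<open>exp\<close> does not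
      expand distances here.\<close>
    have "norm (exp (\<Sum>p\<in>F. c p) - exp (\<Sum>p\<in>P. c p / of_nat p)) \<le> norm ((\<Sum>p\<in>F. c p) - (\<Sum>p\<in>P. c p / of_nat p))"
      using Fp Re_c pos by (intro norm_exp_diff_le) (auto intro!: sum_nonpos divide_nonpos_nonneg)
    also have "(\<Sum>p\<in>F. c p) - (\<Sum>p\<in>P. c p / of_nat p) = (\<Sum>p\<in>P. c p * (of_bool (p dvd n) - 1 / of_nat p))"
      unfolding F_def using finP
      by (subst sum.inter_filter) (auto simp: sum_subtractf[symmetric] algebra_simps intro!: sum.cong)
    finally have B: "norm (exp (\<Sum>p\<in>F. c p) - exp (\<Sum>p\<in>P. (H p - 1) / of_nat p))
       \<le> norm (\<Sum>p\<in>P. c p * (of_bool (p dvd n) - 1 / of_nat p))"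
      by (simp add: c_def)
    show ?thesis using norm_triangle_le[OF add_mono[OF A B]] by simp
  qed
  have S0: "S \<ge> 0" unfolding S_def using Rec pos by (intro sum_nonneg divide_nonneg_nonneg) auto
  have "avg (\<lambda>n. norm (H (prime_part {y<..} n) - exp (\<Sum>p\<in>P. (H p - 1) / of_nat p))) N \<le>
     avg (\<lambda>n. (\<Sum>p\<in>P. of_bool (p dvd n) * (18 * (1 - Re (H p))) + of_bool (p\<^sup>2 dvd n) * 2)
      + norm (\<Sum>p\<in>P. c p * (of_bool (p dvd n) - 1 / of_nat p))) N"
    by (intro avg_mono pw)
  also have "\<dots> = (\<Sum>p\<in>P. avg (\<lambda>n. of_bool (p dvd n)) N * (18 * (1 - Re (H p))) + avg (\<lambda>n. of_bool (p\<^sup>2 dvd n)) N * 2)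
      + avg (\<lambda>n. norm (\<Sum>p\<in>P. c p * (of_bool (p dvd n) - 1 / of_nat p))) N"
    by (simp add: avg_add avg_sum avg_mult_right)
  also have "\<dots> \<le> (\<Sum>p\<in>P. 1 / real p * (18 * (1 - Re (H p))) + 1 / real (p\<^sup>2) * 2)
      + 3 * sqrt (2 * (\<Sum>p\<in>P. (norm (c p))\<^sup>2 / real p))"
    using pos Rec
    by (intro add_mono sum_mono mult_right_mono avg_dvd_le additive_concentration N) (auto simp: P_def)
  also have "(\<Sum>p\<in>P. 1 / real p * (18 * (1 - Re (H p))) + 1 / real (p\<^sup>2) * 2) = 18 * S + 2 * (\<Sum>p\<in>P. 1 / (real p)\<^sup>2)"
    unfolding S_def by (simp add: sum.distrib sum_distrib_left)
  \<comment> \<open>The square of \<open>norm (c p)\<close> is at most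
    \<open>2 * (1 - Re (H p))\<close>, so the radicand is at most \<open>4 * S\<close>; with the
    factor 3 this gives 6.\<close>
  also have "sqrt (2 * (\<Sum>p\<in>P. (norm (c p))\<^sup>2 / real p)) \<le> sqrt (2\<^sup>2 * S)"
  proof (intro real_sqrt_le_mono)
    have "(\<Sum>p\<in>P. (norm (c p))\<^sup>2 / real p) \<le> (\<Sum>p\<in>P. 2 * (1 - Re (H p)) / real p)"
      unfolding c_def using Hn pos by (intro sum_mono divide_right_mono norm_sub_one_sq_le) auto
    also have "\<dots> = 2 * S" unfolding S_def by (simp add: sum_distrib_left)
    finally show "2 * (\<Sum>p\<in>P. (norm (c p))\<^sup>2 / real p) \<le> 2\<^sup>2 * S" by simp
  qed
  also have "\<dots> = 2 * sqrt S" unfolding real_sqrt_mult by simp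
  finally show ?thesis by (simp add: S_def)
qed

section \<open>Pretentious functions in the mean\<close>

lemma dirichlet_character_one:
  assumes "dirichlet_character q chi"
  shows "chi 1 = 1"
proof -
  have "chi 1 = chi 1 * chi 1"
    using assms unfolding dirichlet_character_def by (metis mult_1)
  moreover have "chi 1 \<noteq> 0"
    using assms unfolding dirichlet_character_def by (metis coprime_1_left)
  ultimately show ?thesis by simp
qed

text \<open>By Euler's theorem the nonzero values are roots of unity.\<close>

lemma dirichlet_character_norm:
  assumes chi: "dirichlet_character q chi"
  shows "norm (chi n) = (if coprime n q then 1 else 0)"
proof (cases "coprime n q")
  case True
  have q: "q > 0" using chi by (simp add: dirichlet_character_def)
  have per: "chi (n mod q) = chi n" for n
    by (rule periodic_mod) (use chi in \<open>auto simp: dirichlet_character_def\<close>)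
  have pow: "chi (n ^ k) = chi n ^ k" for k
    using chi dirichlet_character_one[OF chi] by (induction k) (auto simp: dirichlet_character_def)
  have "[n ^ totient q = 1] (mod q)" by (rule euler_theorem[OF True])
  then have "chi (n ^ totient q) = chi 1" using per by (metis cong_def)
  then have "chi n ^ totient q = 1" by (simp add: pow dirichlet_character_one[OF chi, simplified])
  then have "norm (chi n) = 1 \<or> totient q = 0" by (rule power_eq_1_iff)
  then show ?thesis using True q by simp
qed (use chi in \<open>auto simp: dirichlet_character_def\<close>)

definition twist :: "real \<Rightarrow> nat \<Rightarrow> complex" where
  "twist t n = of_nat n powr (\<i> * of_real t)"

lemma twist_eq_cis: "n > 0 \<Longrightarrow> twist t n = cis (t * ln (real n))"
  by (simp add: twist_def powr_def cis_conv_exp Ln_of_nat mult_ac)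

lemma norm_twist: "n > 0 \<Longrightarrow> norm (twist t n) = 1"
  by (simp add: twist_eq_cis)

lemma twist_mult: "m > 0 \<Longrightarrow> n > 0 \<Longrightarrow> twist t (m * n) = twist t m * twist t n"
  by (simp add: twist_eq_cis cis_mult ln_mult algebra_simps)

lemma twist_0: "n > 0 \<Longrightarrow> twist 0 n = 1"
  by (simp add: twist_eq_cis)

text \<open>Arbitrary finite sets beyond \<open>y\<close> are allowed, because the lemma is applied
  to sets of primes whose upper end varies with \<open>N\<close>.\<close>

lemma tail_le:
  fixes u :: "nat \<Rightarrow> real"
  assumes u: "summable u" "\<And>n. u n \<ge> 0" and e: "e > 0"
  shows "\<exists>y0. \<forall>y\<ge>y0. \<forall>A. finite A \<and> A \<subseteq> {y<..} \<longrightarrow> sum u A \<le> e"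
proof -
  obtain y0 where y0: "\<And>m n. m \<ge> y0 \<Longrightarrow> norm (sum u {m..<n}) < e"
    using u(1) e unfolding summable_Cauchy by metis
  show ?thesis
  proof (intro exI[of _ y0] allI impI)
    fix y A assume y: "y0 \<le> y" and A: "finite A \<and> A \<subseteq> {y<..}"
    have "sum u A \<le> sum u {y..<Suc (Max (insert 0 A))}"
      by (intro sum_mono2 u(2)) (use A in \<open>auto simp: less_Suc_eq_le\<close>)
    also have "\<dots> < e" using y0[OF y, of "Suc (Max (insert 0 A))"] by simp
    finally show "sum u A \<le> e" by simp
  qed
qed

lemma smooth_part_eq:
  assumes "n > 0"
  shows "prime_part {..y} n = (\<Prod>p | prime p \<and> p \<le> y. p ^ multiplicity p n)"
proof -
  have "finite {p. prime p \<and> p \<le> y}" by (rule finite_subset[of _ "{..y}"]) auto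
  then show ?thesis unfolding prime_part_def
    by (rule prod.mono_neutral_left) (use assms in \<open>auto simp: prime_factors_multiplicity\<close>)
qed

lemma coprime_rough_part:
  assumes "q > 0" "q \<le> y"
  shows "coprime (prime_part {y<..} n) q"
  unfolding prime_part_def
proof (intro prod_coprime_left)
  fix p assume p: "p \<in> prime_factors n \<inter> {y<..}"
  then have "prime p" "\<not> p dvd q" using assms dvd_imp_le[of p q] by auto
  then have "coprime p q" by (rule prime_imp_coprime)
  then show "coprime (p ^ multiplicity p n) q" by simp
qed

text \<open>The period is \<open>q\<close> times the product of the \<open>p ^ k\<close> with \<open>p \<le> y\<close>.\<close>

lemma periodic_smooth_truncation:
  fixes F chi :: "nat \<Rightarrow> complex"
  assumes chi: "dirichlet_character q chi" and y: "y \<ge> 2"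
  shows "periodic_seq (\<lambda>n. if \<forall>p. prime p \<and> p \<le> y \<longrightarrow> \<not> p ^ k dvd n
     then F (prime_part {..y} n) * chi (prime_part {y<..} n) else 0)"
proof -
  define R where "R = (\<Prod>p | prime p \<and> p \<le> y. p ^ k)"
  have fin: "finite {p. prime p \<and> p \<le> y}" by (rule finite_subset[of _ "{..y}"]) auto
  have R0: "R > 0" unfolding R_def by (intro prod_pos) (auto simp: prime_gt_0_nat)
  have q: "q > 0" using chi by (simp add: dirichlet_character_def)
  have pkR: "p ^ k dvd q * R" if "prime p" "p \<le> y" for p
    unfolding R_def using fin that by (intro dvd_mult dvd_prodI) auto
  have iff: "p ^ j dvd n + q * R \<longleftrightarrow> p ^ j dvd n" if "prime p" "p \<le> y" "j \<le> k" for p j n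
    using dvd_trans[OF le_imp_power_dvd[OF that(3)] pkR[OF that(1,2)]] by (simp add: dvd_add_left_iff)
  have main: "prime_part {..y} (n + q * R) = prime_part {..y} n \<and>
        chi (prime_part {y<..} (n + q * R)) = chi (prime_part {y<..} n)"
    if n: "\<forall>p. prime p \<and> p \<le> y \<longrightarrow> \<not> p ^ k dvd n" for n
  proof -
    \<comment> \<open>Every prime power divides 0, and 2 is among the primes considered.\<close>
    have n0: "n > 0" using n y by (metis dvd_0_right gr_zeroI two_is_prime_nat)
    have mult: "multiplicity p (n + q * R) = multiplicity p n" "multiplicity p n \<le> k"
      if p: "prime p" "p \<le> y" for p
    proof -
      have "\<not> is_unit p" using p by auto
      moreover have "\<not> p ^ k dvd n" using n p by auto
      ultimately have lt: "multiplicity p n < k" using n0 by (metis multiplicity_dvd' not_less)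
      then show "multiplicity p n \<le> k" by simp
      have "p ^ multiplicity p n dvd n + q * R"
        using iff[OF p, of "multiplicity p n" n] lt by (simp add: multiplicity_dvd)
      moreover have "\<not> p ^ Suc (multiplicity p n) dvd n + q * R"
        using iff[OF p, of "Suc (multiplicity p n)" n] lt n0 \<open>\<not> is_unit p\<close>
        by (simp add: power_dvd_iff_le_multiplicity del: power_Suc)
      ultimately show "multiplicity p (n + q * R) = multiplicity p n" by (rule multiplicity_eqI)
    qed
    define a where "a = prime_part {..y} n"
    have a: "prime_part {..y} (n + q * R) = a"
      using n0 by (simp add: a_def smooth_part_eq mult)
    \<comment> \<open>The exponents in the smooth part are at most \<open>k\<close>, so it divides
      \<open>R\<close>. Dividing the shift \<open>q * R\<close> by it leaves a multiple of
      \<open>q\<close>, which does not change \<open>chi\<close> of the rough part.\<close>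
    have "a dvd R" unfolding a_def smooth_part_eq[OF n0] R_def
      by (intro prod_dvd_prod le_imp_power_dvd mult) auto
    then obtain c where c: "R = a * c" by auto
    have comp: "- {..y} = {y<..}" by auto
    have "a * prime_part {y<..} (n + q * R) = n + q * R"
      using prime_part_mult[of "n + q * R" "{..y}"] n0 a comp by simp
    also have "\<dots> = a * prime_part {y<..} n + a * (c * q)"
      using prime_part_mult[of n "{..y}"] n0 comp c by (simp add: a_def)
    finally have "a * prime_part {y<..} (n + q * R) = a * (prime_part {y<..} n + c * q)"
      by (simp add: algebra_simps)
    then have "prime_part {y<..} (n + q * R) = prime_part {y<..} n + c * q"
      using prime_part_pos[of "{..y}" n] by (simp add: a_def)
    moreover have "chi (prime_part {y<..} n + c * q) = chi (prime_part {y<..} n)"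
      by (rule periodic_add_mult) (use chi in \<open>auto simp: dirichlet_character_def\<close>)
    ultimately show ?thesis using a by (simp add: a_def)
  qed
  show ?thesis unfolding periodic_seq_def
  proof (intro exI[of _ "q * R"] conjI allI)
    show "q * R > 0" using q R0 by simp
    fix n
    define T where "T n \<longleftrightarrow> (\<forall>p. prime p \<and> p \<le> y \<longrightarrow> \<not> p ^ k dvd n)" for n
    have eq: "T (n + q * R) \<longleftrightarrow> T n"
      unfolding T_def using iff[of _ k n] by blast
    show "(if \<forall>p. prime p \<and> p \<le> y \<longrightarrow> \<not> p ^ k dvd n + q * R
       then F (prime_part {..y} (n + q * R)) * chi (prime_part {y<..} (n + q * R)) else 0) =
      (if \<forall>p. prime p \<and> p \<le> y \<longrightarrow> \<not> p ^ k dvd n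
       then F (prime_part {..y} n) * chi (prime_part {y<..} n) else 0)"
      unfolding T_def[symmetric] eq using main[of n, folded T_def] by simp
  qed
qed

text \<open>Union bound over at most \<open>y\<close> primes; the multiples of each
  \<open>p ^ k\<close> have density at most \<open>1 / 2 ^ k\<close>.\<close>

lemma avg_smooth_truncation_error:
  assumes y: "y \<ge> 2"
  shows "avg (\<lambda>n. of_bool (\<exists>p. prime p \<and> p \<le> y \<and> p ^ k dvd n) :: real) N \<le> real y / 2 ^ k"
proof -
  let ?P = "{p. prime p \<and> p \<le> y}"
  have fin: "finite ?P" by (rule finite_subset[of _ "{..y}"]) auto
  have "avg (\<lambda>n. of_bool (\<exists>p. prime p \<and> p \<le> y \<and> p ^ k dvd n) :: real) N \<le>
     avg (\<lambda>n. \<Sum>p\<in>?P. of_bool (p ^ k dvd n)) N"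
  proof (intro avg_mono)
    fix n
    show "of_bool (\<exists>p. prime p \<and> p \<le> y \<and> p ^ k dvd n) \<le> (\<Sum>p\<in>?P. of_bool (p ^ k dvd n) :: real)"
    proof (cases "\<exists>p. prime p \<and> p \<le> y \<and> p ^ k dvd n")
      case True
      then obtain r where r: "r \<in> ?P" "r ^ k dvd n" by auto
      have "(1::real) = of_bool (r ^ k dvd n)" using r by simp
      also have "\<dots> \<le> (\<Sum>p\<in>?P. of_bool (p ^ k dvd n))" using fin r by (intro member_le_sum) auto
      finally show ?thesis by simp
    qed (auto intro: sum_nonneg)
  qed
  also have "\<dots> = (\<Sum>p\<in>?P. avg (\<lambda>n. of_bool (p ^ k dvd n)) N)" by (rule avg_sum)
  also have "\<dots> \<le> (\<Sum>p\<in>?P. 1 / 2 ^ k :: real)"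
  proof (intro sum_mono)
    fix p assume "p \<in> ?P"
    then have p: "p \<ge> 2" by (auto simp: prime_ge_2_nat)
    then have "avg (\<lambda>n. of_bool (p ^ k dvd n)) N \<le> 1 / real (p ^ k)" by (intro avg_dvd_le) auto
    also have "\<dots> \<le> 1 / 2 ^ k" using p by (simp add: divide_simps power_mono)
    finally show "avg (\<lambda>n. of_bool (p ^ k dvd n)) N \<le> 1 / (2 ^ k :: real)" .
  qed
  also have "\<dots> = real (card ?P) / 2 ^ k" by simp
  also have "\<dots> \<le> real y / 2 ^ k"
  proof -
    have "?P \<subseteq> {1..y}" using prime_gt_0_nat by (auto simp: Suc_le_eq)
    then have "card ?P \<le> y" using card_mono[of "{1..y}" ?P] by simp
    then show ?thesis by (simp add: divide_right_mono)
  qed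
  finally show ?thesis .
qed

text \<open>Finiteness of the distance enters as summability of a real series over
  \<open>nat\<close>. By multiplicativity \<open>f 1\<close> is 0 or 1, and \<open>f 1 = 1\<close>
  excludes only the function that vanishes at all positive integers.\<close>

locale pretentious =
  fixes f :: "nat \<Rightarrow> complex" and q :: nat and chi :: "nat \<Rightarrow> complex" and t :: real
  assumes f_mult: "unit_multiplicative f" and f1: "f 1 = 1"
    and chi: "dirichlet_character q chi"
    and summ: "summable (\<lambda>p. if prime p then (1 - Re (f p * cnj (chi p * twist t p))) / real p else 0)"
begin

definition h :: "nat \<Rightarrow> complex" where "h n = f n * cnj (chi n * twist t n)"

definition G :: "nat \<Rightarrow> complex" where "G N = (\<Sum>p | prime p \<and> p \<le> N. (h p - 1) / of_nat p)"

lemma finite_primes_le: "finite {p. prime p \<and> p \<le> (N::nat)}"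
  by (rule finite_subset[of _ "{..N}"]) auto

lemma norm_f: "n > 0 \<Longrightarrow> norm (f n) \<le> 1"
  using f_mult by (rule unit_multiplicative_norm)

lemma q_pos: "q > 0" using chi by (simp add: dirichlet_character_def)

lemma norm_chi_le: "norm (chi n) \<le> 1"
  by (simp add: dirichlet_character_norm[OF chi])

lemma h_mult: "unit_multiplicative h"
  unfolding unit_multiplicative_def
proof (intro conjI allI impI)
  fix m n :: nat assume "m > 0" "n > 0" "coprime m n"
  then show "h (m * n) = h m * h n"
    using f_mult chi by (simp add: h_def twist_mult unit_multiplicative_def dirichlet_character_def)
next
  fix n :: nat assume n: "n > 0"
  have "norm (f n) * (norm (chi n) * norm (twist t n)) \<le> 1 * (1 * 1)"
    using n norm_f[OF n] norm_chi_le[of n] norm_twist[OF n] by (intro mult_mono) auto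
  then show "norm (h n) \<le> 1" by (simp add: h_def norm_mult)
qed

lemma h1: "h 1 = 1"
  by (simp add: h_def f1[simplified] dirichlet_character_one[OF chi, simplified] twist_eq_cis)

lemma norm_h: "n > 0 \<Longrightarrow> norm (h n) \<le> 1"
  using h_mult by (rule unit_multiplicative_norm)

lemma Re_h: "n > 0 \<Longrightarrow> Re (h n) \<le> 1"
  using complex_Re_le_cmod[of "h n"] norm_h[of n] by linarith

definition wt :: "nat \<Rightarrow> real" where "wt p = (if prime p then (1 - Re (h p)) / real p else 0)"

text \<open>This is the square of the distance.\<close>

definition Dist :: real where "Dist = suminf wt"

lemma wt_nonneg: "wt p \<ge> 0"
  unfolding wt_def using Re_h[of p] by (auto simp: prime_gt_0_nat)

lemma wt_summable: "summable wt"
  using summ unfolding wt_def[abs_def] h_def by simp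

lemma sum_wt_le: "finite A \<Longrightarrow> sum wt A \<le> Dist"
  unfolding Dist_def by (rule sum_le_suminf[OF wt_summable]) (auto simp: wt_nonneg)

lemma Re_G: "Re (G N) = - (\<Sum>p | prime p \<and> p \<le> N. wt p)"
  unfolding G_def Re_sum sum_negf[symmetric]
  by (intro sum.cong) (auto simp: wt_def Re_divide_of_nat diff_divide_distrib)

text \<open>Minus the real part of \<open>G\<close> is a partial sum of the squared distance. Hence
  \<open>exp (G N)\<close> and its inverse stay bounded, although the imaginary part of
  \<open>G\<close> may diverge.\<close>

lemma Re_G_bounds: "Re (G N) \<le> 0" "Re (G N) \<ge> - Dist"
  unfolding Re_G using sum_wt_le[OF finite_primes_le, of N] by (auto intro: sum_nonneg wt_nonneg)

lemma norm_exp_G: "norm (exp (G N)) \<le> 1" "norm (exp (- G N)) \<le> exp Dist"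
  using Re_G_bounds[of N] by auto

lemma G_diff:
  assumes "y \<le> N"
  shows "G N - G y = (\<Sum>p | prime p \<and> y < p \<and> p \<le> N. (h p - 1) / of_nat p)"
proof -
  have "{p. prime p \<and> p \<le> N} = {p. prime p \<and> p \<le> y} \<union> {p. prime p \<and> y < p \<and> p \<le> N}"
    using assms by auto
  moreover have "finite {p. prime p \<and> y < p \<and> p \<le> N}" by (rule finite_subset[of _ "{..N}"]) auto
  ultimately show ?thesis
    unfolding G_def using finite_primes_le[of y] by (simp add: sum.union_disjoint disjoint_iff)
qed

text \<open>Write \<open>n = a * b\<close> with \<open>a\<close> smooth and \<open>b\<close> rough.
  Since \<open>q \<le> y\<close>, the value \<open>chi b\<close> is unimodular, so
  \<open>f b = chi b * twist t b * h b\<close>. Only the replacement of \<open>h b\<close> by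
  \<open>exp (G N - G y)\<close> costs anything.\<close>

lemma approx_smooth_part:
  assumes n: "n > 0" and N: "y \<le> N" and y: "q \<le> y"
  shows "norm (f n * cnj (twist t n) - f (prime_part {..y} n) * cnj (twist t (prime_part {..y} n)) *
            exp (- G y) * chi (prime_part {y<..} n) * exp (G N))
     \<le> norm (h (prime_part {y<..} n) - exp (\<Sum>p | prime p \<and> y < p \<and> p \<le> N. (h p - 1) / of_nat p))"
proof -
  define a b where "a = prime_part {..y} n" and "b = prime_part {y<..} n"
  have comp: "- {..y} = {y<..}" by auto
  have ab: "a * b = n" using prime_part_mult[OF n, of "{..y}"] by (simp add: a_def b_def comp)
  have pos: "a > 0" "b > 0" by (auto simp: a_def b_def prime_part_pos)
  have "coprime a b" unfolding a_def b_def by (rule coprime_prime_part) auto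
  then have fab: "f n = f a * f b" using f_mult pos ab by (auto simp: unit_multiplicative_def)
  have wab: "twist t n = twist t a * twist t b" using twist_mult[OF pos] ab by simp
  have "norm (chi b) = 1"
    using coprime_rough_part[OF q_pos y, of n] by (simp add: dirichlet_character_norm[OF chi] b_def)
  then have chib: "chi b * cnj (chi b) = 1" by (simp add: complex_norm_square[symmetric])
  have "f n * cnj (twist t n) - f a * cnj (twist t a) * exp (- G y) * chi b * exp (G N)
      = f a * cnj (twist t a) * chi b * (h b - exp (G N - G y))"
  proof -
    have "f n * cnj (twist t n) = f a * cnj (twist t a) * (chi b * cnj (chi b)) * (f b * cnj (twist t b))"
      by (simp add: fab wab chib)
    then show ?thesis by (simp add: h_def algebra_simps exp_diff exp_minus divide_inverse)
  qed
  then have "norm (f n * cnj (twist t n) - f a * cnj (twist t a) * exp (- G y) * chi b * exp (G N))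
      = norm (f a) * norm (twist t a) * norm (chi b) * norm (h b - exp (G N - G y))"
    by (simp add: norm_mult)
  also have "\<dots> \<le> 1 * 1 * 1 * norm (h b - exp (G N - G y))"
    using norm_f[OF pos(1)] norm_twist[OF pos(1)] norm_chi_le[of b]
    by (intro mult_right_mono mult_mono) auto
  finally show ?thesis unfolding a_def b_def G_diff[OF N] by simp
qed

text \<open>The threshold \<open>y\<close> is fixed before \<open>N\<close>, so
  \<open>exp (- G y)\<close> is a constant that goes into \<open>g\<close>, and all dependence on
  \<open>N\<close> sits in \<open>exp (G N)\<close>. Integers divisible by a high power of a small
  prime are cut off to make the smooth part periodic.\<close>

lemma asymptotically_RAP:
  assumes e: "\<epsilon> > 0"
  shows "\<exists>g. periodic_seq g \<and> (\<forall>n. norm (g n) \<le> exp Dist) \<and>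
     (\<forall>\<^sub>F N in sequentially. avg (\<lambda>n. norm (f n * cnj (twist t n) - g n * exp (G N))) N < \<epsilon>)"
proof -
  \<comment> \<open>Since \<open>d \<le> 1\<close>, the bound
    \<open>18 * d + 2 * d + 6 * sqrt d\<close> is at most \<open>26 * sqrt d\<close>, hence at most
    \<open>\<epsilon> / 2\<close>. The cut-off gets the other half.\<close>
  define d where "d = min 1 ((\<epsilon> / 60)\<^sup>2)"
  have d: "d > 0" "d \<le> 1" using e by (auto simp: d_def)
  have "sqrt d \<le> sqrt ((\<epsilon> / 60)\<^sup>2)" unfolding d_def by (intro real_sqrt_le_mono) simp
  then have sd: "sqrt d \<le> \<epsilon> / 60" using e by simp
  have dsq: "d \<le> sqrt d" using d by (intro real_le_rsqrt) (auto simp: power2_eq_square mult_left_le)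
  obtain y1 where y1: "\<And>y A. y \<ge> y1 \<Longrightarrow> finite A \<Longrightarrow> A \<subseteq> {y<..} \<Longrightarrow> sum wt A \<le> d"
    using tail_le[OF wt_summable wt_nonneg d(1)] by blast
  have "summable (\<lambda>n. 1 / (real n)\<^sup>2)" using inverse_power_summable[of 2, where 'a=real] by (simp add: field_simps)
  then obtain y2 where y2: "\<And>y A. y \<ge> y2 \<Longrightarrow> finite A \<Longrightarrow> A \<subseteq> {y<..} \<Longrightarrow> (\<Sum>n\<in>A. 1 / (real n)\<^sup>2) \<le> d"
    using tail_le[of "\<lambda>n. 1 / (real n)\<^sup>2" d] d(1) by auto
  define y where "y = Max {y1, y2, q, 2}"
  have y: "y \<ge> y1" "y \<ge> y2" "y \<ge> q" "y \<ge> 2" by (auto simp: y_def)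
  define C where "C = exp Dist"
  obtain k :: nat where k: "C * real y / (\<epsilon> / 2) < 2 ^ k" using real_arch_pow[of 2] by auto
  define g0 where "g0 n = f (prime_part {..y} n) * cnj (twist t (prime_part {..y} n)) *
            exp (- G y) * chi (prime_part {y<..} n)" for n
  define g where "g n = (if \<forall>p. prime p \<and> p \<le> y \<longrightarrow> \<not> p ^ k dvd n then g0 n else 0)" for n
  have per: "periodic_seq g"
    unfolding g_def[abs_def] g0_def
    by (rule periodic_smooth_truncation[OF chi y(4), where F = "\<lambda>a. f a * cnj (twist t a) * exp (- G y)"])
  have g0: "norm (g0 n) \<le> C" for n
  proof -
    have "norm (g0 n) \<le> 1 * 1 * C * 1"
      unfolding g0_def norm_mult C_def
      using norm_f[OF prime_part_pos] norm_twist[OF prime_part_pos] norm_chi_le norm_exp_G(2)[of y]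
      by (intro mult_mono) auto
    then show ?thesis by simp
  qed
  have C: "C > 0" by (simp add: C_def)
  have gC: "norm (g n) \<le> C" for n using g0[of n] C by (auto simp: g_def)
  have "avg (\<lambda>n. norm (f n * cnj (twist t n) - g n * exp (G N))) N < \<epsilon>" if N: "N \<ge> y" for N
  proof -
    let ?P = "{p. prime p \<and> y < p \<and> p \<le> N}"
    have N0: "N > 0" using N y by simp
    have finP: "finite ?P" by (rule finite_subset[of _ "{..N}"]) auto
    have S: "(\<Sum>p\<in>?P. (1 - Re (h p)) / real p) \<le> d" "(\<Sum>p\<in>?P. (1 - Re (h p)) / real p) \<ge> 0"
    proof -
      have eq: "(\<Sum>p\<in>?P. (1 - Re (h p)) / real p) = sum wt ?P" by (intro sum.cong) (auto simp: wt_def)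
      show "(\<Sum>p\<in>?P. (1 - Re (h p)) / real p) \<le> d" "(\<Sum>p\<in>?P. (1 - Re (h p)) / real p) \<ge> 0"
        unfolding eq using y1[OF y(1) finP] by (auto intro: sum_nonneg wt_nonneg)
    qed
    have S2: "(\<Sum>p\<in>?P. 1 / (real p)\<^sup>2) \<le> d" using y2[OF y(2) finP] by auto
    have A: "avg (\<lambda>n. norm (f n * cnj (twist t n) - g0 n * exp (G N))) N \<le> 18 * d + 2 * d + 6 * sqrt d"
    proof -
      have "avg (\<lambda>n. norm (f n * cnj (twist t n) - g0 n * exp (G N))) N
         \<le> avg (\<lambda>n. norm (h (prime_part {y<..} n) - exp (\<Sum>p\<in>?P. (h p - 1) / of_nat p))) N"
        unfolding g0_def by (intro avg_mono approx_smooth_part N y) auto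
      also have "\<dots> \<le> 18 * (\<Sum>p\<in>?P. (1 - Re (h p)) / real p) + 2 * (\<Sum>p\<in>?P. 1 / (real p)\<^sup>2)
         + 6 * sqrt (\<Sum>p\<in>?P. (1 - Re (h p)) / real p)"
        by (rule multiplicative_concentration[OF h_mult h1 N0])
      also have "\<dots> \<le> 18 * d + 2 * d + 6 * sqrt d"
        using S S2 by (intro add_mono mult_left_mono real_sqrt_le_mono) auto
      finally show ?thesis .
    qed
    have "avg (\<lambda>n. norm (f n * cnj (twist t n) - g n * exp (G N))) N \<le>
      avg (\<lambda>n. norm (f n * cnj (twist t n) - g0 n * exp (G N)) +
          C * of_bool (\<exists>p. prime p \<and> p \<le> y \<and> p ^ k dvd n)) N"
    proof (intro avg_mono)
      fix n
      show "norm (f n * cnj (twist t n) - g n * exp (G N)) \<le> norm (f n * cnj (twist t n) - g0 n * exp (G N)) +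
          C * of_bool (\<exists>p. prime p \<and> p \<le> y \<and> p ^ k dvd n)"
      proof (cases "\<exists>p. prime p \<and> p \<le> y \<and> p ^ k dvd n")
        case True
        then have g: "g n = 0" by (auto simp: g_def)
        have "norm (g0 n * exp (G N)) \<le> C * 1"
          unfolding norm_mult using g0[of n] norm_exp_G(1)[of N] C by (intro mult_mono) auto
        then show ?thesis
          using True norm_triangle_sub[of "f n * cnj (twist t n)" "g0 n * exp (G N)"] by (simp add: g)
      qed (auto simp: g_def)
    qed
    also have "\<dots> \<le> (18 * d + 2 * d + 6 * sqrt d) + C * (real y / 2 ^ k)"
      unfolding avg_add avg_mult_left using A C
      by (intro add_mono mult_left_mono avg_smooth_truncation_error y) auto
    also have "C * (real y / 2 ^ k) < \<epsilon> / 2" using k e by (simp add: field_simps)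
    also have "18 * d + 2 * d + 6 * sqrt d \<le> \<epsilon> / 2" using dsq sd e by linarith
    finally show ?thesis by simp
  qed
  then show ?thesis using per gC unfolding C_def eventually_sequentially by blast
qed

end

section \<open>A positive lower bound for the mean of the modulus of \<open>f\<close>\<close>

lemma card_progression_dvd:
  fixes P d M :: nat
  assumes "coprime P d" "d > 0"
  shows "card {m\<in>{1..M}. d dvd P * m + 1} \<le> M div d + 1"
proof -
  let ?S = "{m\<in>{1..M}. d dvd P * m + 1}"
  \<comment> \<open>The solutions are congruent modulo \<open>d\<close>, so distinct ones have
    distinct quotients.\<close>
  have "inj_on (\<lambda>m. m div d) ?S"
  proof (rule inj_onI)
    fix m m' assume m: "m \<in> ?S" "m' \<in> ?S" and eq: "m div d = m' div d"
    have "[P * m + 1 = P * m' + 1] (mod d)"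
      using m by (auto simp: cong_def dvd_eq_mod_eq_0)
    then have "[P * m = P * m'] (mod d)" by (rule cong_add_rcancel_nat[THEN iffD1])
    then have "[m = m'] (mod d)" using assms(1) by (simp add: cong_mult_lcancel_nat)
    then show "m = m'" using eq by (metis cong_def div_mult_mod_eq)
  qed
  then have "card ?S = card ((\<lambda>m. m div d) ` ?S)" by (simp add: card_image)
  also have "\<dots> \<le> card {0..M div d}"
    by (intro card_mono) (auto intro: div_le_mono)
  finally show ?thesis by simp
qed

context pretentious
begin

text \<open>A product of numbers in [0, 1] is at least 1 minus the sum of their defects. A prime
  dividing \<open>n\<close> more than once is charged a full unit, as nothing is known about
  \<open>f\<close> at higher prime powers.\<close>

lemma norm_f_lower:
  assumes n: "n > 0"
  shows "norm (f n) \<ge> 1 - (\<Sum>p\<in>prime_factors n. (1 - norm (f p)) + of_bool (p\<^sup>2 dvd n))"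
proof -
  have "f n = f (prime_part UNIV n)" using prime_part_mult[OF n, of UNIV] by (simp add: prime_part_def)
  also have "\<dots> = (\<Prod>p\<in>prime_factors n. f (p ^ multiplicity p n))"
    unfolding unit_multiplicative_prime_part[OF f_mult f1] by simp
  finally have e: "norm (f n) = (\<Prod>p\<in>prime_factors n. norm (f (p ^ multiplicity p n)))"
    by (simp add: prod_norm)
  have pos: "p > 0" if "p \<in> prime_factors n" for p
    using that by (auto dest: in_prime_factors_imp_prime simp: prime_gt_0_nat)
  have "norm ((\<Prod>p\<in>prime_factors n. 1) - (\<Prod>p\<in>prime_factors n. norm (f (p ^ multiplicity p n))))
     \<le> (\<Sum>p\<in>prime_factors n. norm (1 - norm (f (p ^ multiplicity p n))))"
    by (rule norm_prod_diff) (use norm_f pos in auto)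
  also have "\<dots> \<le> (\<Sum>p\<in>prime_factors n. (1 - norm (f p)) + of_bool (p\<^sup>2 dvd n))"
  proof (intro sum_mono)
    fix p assume p: "p \<in> prime_factors n"
    have le: "norm (f (p ^ multiplicity p n)) \<le> 1" using norm_f pos[OF p] by simp
    show "norm (1 - norm (f (p ^ multiplicity p n))) \<le> (1 - norm (f p)) + of_bool (p\<^sup>2 dvd n)"
    proof (cases "multiplicity p n \<ge> 2")
      case True
      then have "p\<^sup>2 dvd n" using multiplicity_dvd'[of 2 p n] by simp
      moreover have "\<bar>1 - norm (f (p ^ multiplicity p n))\<bar> \<le> 1"
        using le norm_ge_zero[of "f (p ^ multiplicity p n)"] by linarith
      ultimately show ?thesis using norm_f[OF pos[OF p]] by simp
    next
      case False
      moreover have "multiplicity p n > 0" using p n by (simp add: prime_factors_multiplicity)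
      ultimately have "multiplicity p n = 1" by simp
      then show ?thesis using le by simp
    qed
  qed
  finally show ?thesis using e by simp
qed

text \<open>As \<open>f\<close> may vanish on all powers of small primes, only the \<open>n\<close>
  congruent to 1 modulo \<open>P = y!\<close> are used; they have no prime factor up to
  \<open>y\<close>. Averaged over them, the defect in \<open>norm_f_lower\<close> stays below a
  fixed fraction of 1.\<close>

lemma avg_norm_f_lower: "\<exists>\<kappa>>0. \<forall>\<^sub>F N in sequentially. avg (\<lambda>n. norm (f n)) N \<ge> \<kappa>"
proof -
  define w where "w p = 1 - norm (f p)" for p
  have w: "0 \<le> w p" "w p \<le> 1" if "p > 0" for p using norm_f[OF that] by (auto simp: w_def)
  have w_wt: "w p / real p \<le> wt p" if "prime p" for p
  proof -
    have p0: "p > 0" using that by (simp add: prime_gt_0_nat)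
    have "Re (h p) \<le> norm (h p)" by (rule complex_Re_le_cmod)
    also have "\<dots> = norm (f p) * (norm (chi p) * norm (twist t p))" by (simp add: h_def norm_mult)
    also have "\<dots> \<le> norm (f p) * (1 * 1)"
      using norm_chi_le[of p] norm_twist[OF p0] by (intro mult_left_mono mult_mono) auto
    finally show ?thesis using that by (simp add: w_def wt_def divide_right_mono)
  qed
  obtain y1 where y1: "\<And>y A. y \<ge> y1 \<Longrightarrow> finite A \<Longrightarrow> A \<subseteq> {y<..} \<Longrightarrow> sum wt A \<le> 1 / 16"
    using tail_le[OF wt_summable wt_nonneg, of "1 / 16"] by auto
  have "summable (\<lambda>n. 1 / (real n)\<^sup>2)" using inverse_power_summable[of 2, where 'a=real] by (simp add: field_simps)
  then obtain y2 where y2: "\<And>y A. y \<ge> y2 \<Longrightarrow> finite A \<Longrightarrow> A \<subseteq> {y<..} \<Longrightarrow> (\<Sum>n\<in>A. 1 / (real n)\<^sup>2) \<le> 1 / 16"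
    using tail_le[of "\<lambda>n. 1 / (real n)\<^sup>2" "1 / 16"] by auto
  define y where "y = max y1 y2"
  define P :: nat where "P = fact y"
  have P: "P \<ge> 1" by (simp add: P_def Suc_le_eq)
  \<comment> \<open>For primes beyond \<open>M\<close> the bound for the number of multiples no
    longer decays like \<open>M / p\<close>, which costs a factor of order \<open>P\<close>; hence a
    tail bound depending on \<open>P\<close>.\<close>
  obtain y3 where y3: "\<And>y A. y \<ge> y3 \<Longrightarrow> finite A \<Longrightarrow> A \<subseteq> {y<..} \<Longrightarrow> sum wt A \<le> 1 / (32 * real P)"
    using tail_le[OF wt_summable wt_nonneg, of "1 / (32 * real P)"] P by auto
  \<comment> \<open>The losses below are at most \<open>M / 8\<close>, \<open>M / 4\<close> and
    \<open>3 * M / 16\<close>, which leaves more than \<open>M / 4\<close>. The condition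
    \<open>M \<ge> 128 * P\<close> keeps the number of primes in \<open>B\<close>, those with square
    at most \<open>P * M + 1\<close>, at most \<open>M / 8\<close>.\<close>
  have sumM: "(\<Sum>m\<in>{1..M}. norm (f (P * m + 1))) \<ge> real M / 4" if M: "M \<ge> y3" "M \<ge> 128 * P" for M
  proof -
    have M0: "M > 0" using M(2) P by linarith
    define A where "A = {p. prime p \<and> y < p \<and> p \<le> P * M + 1}"
    define A1 A2 B where "A1 = {p\<in>A. p \<le> M}" and "A2 = {p\<in>A. M < p}" and "B = {p\<in>A. p\<^sup>2 \<le> P * M + 1}"
    have finA: "finite A" by (rule finite_subset[of _ "{..P * M + 1}"]) (auto simp: A_def)
    have fin: "finite A1" "finite A2" "finite B" using finA by (auto simp: A1_def A2_def B_def)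
    have pos: "p > 0" "prime p" if "p \<in> A" for p using that by (auto simp: A_def prime_gt_0_nat)
    have cop: "coprime P p" if "p \<in> A" for p
    proof -
      have "\<not> p dvd P" using that by (auto simp: A_def P_def prime_dvd_fact_iff)
      then show ?thesis using pos(2)[OF that] prime_imp_coprime coprime_commute by blast
    qed
    define c where "c d = real (card {m\<in>{1..M}. d dvd P * m + 1})" for d
    have c_eq: "(\<Sum>m\<in>{1..M}. of_bool (d dvd P * m + 1)) = c d" for d
      by (simp add: c_def Int_def Collect_conj_eq[symmetric])
    have c_le: "c d \<le> real M / real d + 1" if "coprime P d" "d > 0" for d
    proof -
      have "c d \<le> real (M div d) + 1" unfolding c_def using card_progression_dvd[OF that, of M] by linarith
      then show ?thesis using real_div_nat_bounds(1)[OF that(2), of M] by linarith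
    qed
    have pf: "prime_factors (P * m + 1) = {p\<in>A. p dvd P * m + 1}" if m: "m \<in> {1..M}" for m
    proof -
      have le: "P * m + 1 \<le> P * M + 1" using m by simp
      have "p > y" if "prime p" "p dvd P * m + 1" for p
      proof (rule ccontr)
        assume "\<not> p > y"
        then have "p dvd P" using that(1) by (simp add: P_def prime_dvd_fact_iff)
        then have "p dvd 1" using that(2) by (metis dvd_add_right_iff dvd_mult2)
        then show False using that(1) by simp
      qed
      moreover have "p \<le> P * M + 1" if "p dvd P * m + 1" for p
        using dvd_imp_le[OF that] le by linarith
      ultimately show ?thesis by (auto simp: A_def prime_factors_dvd)
    qed
    have "real M - (\<Sum>m\<in>{1..M}. norm (f (P * m + 1))) = (\<Sum>m\<in>{1..M}. 1 - norm (f (P * m + 1)))"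
      by (simp add: sum_subtractf)
    also have "\<dots> \<le> (\<Sum>m\<in>{1..M}. \<Sum>p\<in>A. w p * of_bool (p dvd P * m + 1) + of_bool (p\<^sup>2 dvd P * m + 1))"
    proof (intro sum_mono)
      fix m assume m: "m \<in> {1..M}"
      have "1 - norm (f (P * m + 1)) \<le> (\<Sum>p\<in>prime_factors (P * m + 1). w p + of_bool (p\<^sup>2 dvd P * m + 1))"
        using norm_f_lower[of "P * m + 1"] by (simp add: w_def)
      also have "\<dots> = (\<Sum>p\<in>A. if p dvd P * m + 1 then w p + of_bool (p\<^sup>2 dvd P * m + 1) else 0)"
        unfolding pf[OF m] by (rule sum.inter_filter[OF finA])
      also have "\<dots> \<le> (\<Sum>p\<in>A. w p * of_bool (p dvd P * m + 1) + of_bool (p\<^sup>2 dvd P * m + 1))"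
        by (intro sum_mono) auto
      finally show "1 - norm (f (P * m + 1)) \<le> (\<Sum>p\<in>A. w p * of_bool (p dvd P * m + 1) + of_bool (p\<^sup>2 dvd P * m + 1))" .
    qed
    also have "\<dots> = (\<Sum>p\<in>A. w p * c p + c (p\<^sup>2))"
      by (subst sum.swap) (simp only: sum.distrib sum_distrib_left[symmetric] c_eq)
    also have "\<dots> = (\<Sum>p\<in>A. w p * c p) + (\<Sum>p\<in>A. c (p\<^sup>2))" by (rule sum.distrib)
    also have "(\<Sum>p\<in>A. w p * c p) = (\<Sum>p\<in>A1. w p * c p) + (\<Sum>p\<in>A2. w p * c p)"
      using finA by (subst sum.union_disjoint[symmetric]) (auto simp: A1_def A2_def intro!: sum.cong)
    also have "(\<Sum>p\<in>A1. w p * c p) \<le> real M / 8"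
    proof -
      have "(\<Sum>p\<in>A1. w p * c p) \<le> (\<Sum>p\<in>A1. 2 * real M * wt p)"
      proof (intro sum_mono)
        fix p assume p: "p \<in> A1"
        then have pA: "p \<in> A" "p \<le> M" by (auto simp: A1_def)
        have "c p \<le> real M / real p + 1" using c_le cop pos pA by simp
        also have "1 \<le> real M / real p" using pA pos[OF pA(1)] by simp
        finally have "w p * c p \<le> w p * (2 * real M / real p)"
          using w[OF pos(1)[OF pA(1)]] by (intro mult_left_mono) auto
        also have "\<dots> = 2 * real M * (w p / real p)" by simp
        also have "\<dots> \<le> 2 * real M * wt p" using w_wt pos pA by (intro mult_left_mono) auto
        finally show "w p * c p \<le> 2 * real M * wt p" .
      qed
      also have "\<dots> = 2 * real M * sum wt A1" by (rule sum_distrib_left[symmetric])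
      also have "\<dots> \<le> 2 * real M * (1 / 16)"
        by (intro mult_left_mono y1[of y]) (use fin in \<open>auto simp: y_def A1_def A_def\<close>)
      finally show ?thesis by simp
    qed
    also have "(\<Sum>p\<in>A2. w p * c p) \<le> real M / 4"
    proof -
      have "(\<Sum>p\<in>A2. w p * c p) \<le> (\<Sum>p\<in>A2. 4 * real P * real M * wt p)"
      proof (intro sum_mono)
        fix p assume p: "p \<in> A2"
        then have pA: "p \<in> A" "p > M" by (auto simp: A2_def)
        have pX: "real p \<le> real P * real M + 1"
          using pA(1) unfolding A_def by (simp flip: of_nat_mult of_nat_Suc)
        have "c p \<le> real M / real p + 1" using c_le cop pos pA by simp
        also have "real M / real p \<le> 1" using pA by simp
        finally have "w p * c p \<le> w p * 2"
          using w[OF pos(1)[OF pA(1)]] by (intro mult_left_mono) auto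
        also have "\<dots> = 2 * real p * (w p / real p)" using pos[OF pA(1)] by simp
        also have "\<dots> \<le> 2 * (real P * real M + 1) * wt p"
          using w_wt pos[OF pA(1)] pX w[OF pos(1)[OF pA(1)]] by (intro mult_mono mult_left_mono) auto
        also have "\<dots> \<le> 2 * (real P * real M + real P * real M) * wt p"
        proof -
          have "1 * 1 \<le> real P * real M" using P M0 by (intro mult_mono) auto
          then show ?thesis by (intro mult_right_mono mult_left_mono add_left_mono wt_nonneg) auto
        qed
        finally show "w p * c p \<le> 4 * real P * real M * wt p" by (simp add: mult_ac)
      qed
      also have "\<dots> = 4 * real P * real M * sum wt A2" by (rule sum_distrib_left[symmetric])
      also have "\<dots> \<le> 4 * real P * real M * (1 / (32 * real P))"
        by (intro mult_left_mono y3[OF M(1)]) (use fin in \<open>auto simp: A2_def\<close>)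
      also have "\<dots> = real M / 8" using P by (simp add: field_simps)
      finally show ?thesis by simp
    qed
    also have "(\<Sum>p\<in>A. c (p\<^sup>2)) \<le> real M / 16 + real M / 16 + real M / 16"
    proof -
      have "(\<Sum>p\<in>A. c (p\<^sup>2)) = (\<Sum>p\<in>B. c (p\<^sup>2))"
      proof (rule sum.mono_neutral_right)
        show "\<forall>p\<in>A - B. c (p\<^sup>2) = 0"
        proof
          fix p assume p: "p \<in> A - B"
          have "\<not> p\<^sup>2 dvd P * m + 1" if "m \<in> {1..M}" for m
          proof
            assume "p\<^sup>2 dvd P * m + 1"
            then have "p\<^sup>2 \<le> P * m + 1" by (rule dvd_imp_le) simp
            also have "\<dots> \<le> P * M + 1" using that by simp
            finally show False using p by (simp add: B_def)
          qed
          then have "{m\<in>{1..M}. p\<^sup>2 dvd P * m + 1} = {}" by auto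
          then show "c (p\<^sup>2) = 0" unfolding c_def by simp
        qed
      qed (auto simp: finA B_def)
      also have "\<dots> \<le> (\<Sum>p\<in>B. real M * (1 / (real p)\<^sup>2) + 1)"
        using c_le[of "_\<^sup>2"] cop pos by (intro sum_mono) (auto simp: B_def)
      also have "\<dots> = real M * (\<Sum>p\<in>B. 1 / (real p)\<^sup>2) + real (card B)"
        by (simp add: sum.distrib sum_distrib_left)
      also have "real M * (\<Sum>p\<in>B. 1 / (real p)\<^sup>2) \<le> real M * (1 / 16)"
        by (intro mult_left_mono y2[of y]) (use fin in \<open>auto simp: y_def B_def A_def\<close>)
      also have "real (card B) \<le> real M / 8"
      proof (cases "B = {}")
        case False
        define s where "s = Max B"
        have s: "s \<in> B" using False fin by (simp add: s_def)
        have "B \<subseteq> {1..s}" using fin pos by (auto simp: s_def B_def Suc_le_eq)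
        then have cs: "card B \<le> s" using card_mono[of "{1..s}" B] by simp
        have "64 * s\<^sup>2 \<le> 64 * (P * M + 1)" using s by (simp add: B_def)
        also have "\<dots> \<le> 64 * (P * M + P * M)" using P M0 by (intro mult_le_mono) auto
        also have "\<dots> = 128 * P * M" by simp
        also have "\<dots> \<le> M * M" using M(2) by (intro mult_le_mono) auto
        finally have "(8 * s)\<^sup>2 \<le> M\<^sup>2" by (simp add: power2_eq_square)
        then have "8 * s \<le> M" by (rule power2_le_imp_le) simp
        then have "8 * card B \<le> M" using cs by linarith
        then show ?thesis by linarith
      qed simp
      finally show ?thesis by simp
    qed
    finally show ?thesis by simp
  qed
  \<comment> \<open>The progression has \<open>M\<close> terms up to \<open>N\<close>, and
    \<open>N \<le> 2 * P * M\<close>; a sum of \<open>M / 4\<close> over them is a density of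
    \<open>1 / (8 * P)\<close>.\<close>
  have "avg (\<lambda>n. norm (f n)) N \<ge> 1 / (8 * real P)" if N: "N \<ge> P * (y3 + 128 * P) + 2 * P + 2" for N
  proof -
    define M where "M = (N - 1) div P"
    have "P * M \<le> N - 1" unfolding M_def by (rule times_div_less_eq_dividend)
    then have PM: "P * M + 1 \<le> N" using N by linarith
    have "P * (y3 + 128 * P) \<le> N - 1" using N by linarith
    then have "y3 + 128 * P \<le> M" using P by (simp add: M_def less_eq_div_iff_mult_less_eq mult.commute)
    then have M: "M \<ge> y3" "M \<ge> 128 * P" by auto
    have "N - 1 < P + P * M" unfolding M_def using P by (intro dividend_less_times_div) simp
    then have "N \<le> P * (M + 1)" by simp
    then have "real N \<le> real (P * (M + 1))" by (rule of_nat_mono)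
    also have "\<dots> \<le> real (P * (2 * M))" using M(2) P by (intro of_nat_mono mult_le_mono) auto
    finally have NM: "real N \<le> 2 * real P * real M" by simp
    have "real M / 4 \<le> (\<Sum>m\<in>{1..M}. norm (f (P * m + 1)))" by (rule sumM[OF M])
    also have "\<dots> = (\<Sum>n\<in>(\<lambda>m. P * m + 1) ` {1..M}. norm (f n))"
      using P by (subst sum.reindex) (auto simp: inj_on_def)
    also have "\<dots> \<le> (\<Sum>n\<in>{1..N}. norm (f n))"
    proof (rule sum_mono2)
      have "P * m + 1 \<le> N" if "m \<le> M" for m using PM mult_le_mono2[OF that, of P] by linarith
      then show "(\<lambda>m. P * m + 1) ` {1..M} \<subseteq> {1..N}" by auto
    qed auto
    finally have "real M / 4 / real N \<le> avg (\<lambda>n. norm (f n)) N"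
      unfolding avg_real by (intro divide_right_mono) auto
    moreover have "1 / (8 * real P) \<le> real M / 4 / real N"
    proof -
      have "real N > 0" using N by simp
      then show ?thesis using NM P by (simp add: field_simps)
    qed
    ultimately show ?thesis by linarith
  qed
  moreover have "1 / (8 * real P) > 0" using P by simp
  ultimately show ?thesis unfolding eventually_sequentially by blast
qed

text \<open>All primes beyond \<open>N\<close> exceed the square root of \<open>N'\<close> when
  \<open>N' \<le> N^2\<close>. So \<open>sum_large_primes_le\<close> bounds the increment by the
  square root of a tail of the squared distance.\<close>

lemma G_slow:
  assumes e: "\<epsilon> > 0"
  shows "\<exists>N0. \<forall>N\<ge>N0. \<forall>N'. N \<le> N' \<and> N' \<le> N\<^sup>2 \<longrightarrow> norm (G N' - G N) < \<epsilon>"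
proof -
  obtain y0 where y0: "\<And>y A. y \<ge> y0 \<Longrightarrow> finite A \<Longrightarrow> A \<subseteq> {y<..} \<Longrightarrow> sum wt A \<le> (\<epsilon> / 4)\<^sup>2"
    using tail_le[OF wt_summable wt_nonneg, of "(\<epsilon> / 4)\<^sup>2"] e by auto
  show ?thesis
  proof (intro exI[of _ "max y0 1"] allI impI)
    fix N N' assume N: "max y0 1 \<le> N" and NN: "N \<le> N' \<and> N' \<le> N\<^sup>2"
    define A where "A = {p. prime p \<and> N < p \<and> p \<le> N'}"
    have finA: "finite A" by (rule finite_subset[of _ "{..N'}"]) (auto simp: A_def)
    have pos: "p > 0" if "p \<in> A" for p using that by (auto simp: A_def)
    have sq: "N' < p\<^sup>2" if "N < p" for p
    proof -
      have "N\<^sup>2 < p\<^sup>2" using that by (intro power_strict_mono) auto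
      then show ?thesis using NN by linarith
    qed
    have "norm (G N' - G N) \<le> (\<Sum>p\<in>A. norm ((h p - 1) / of_nat p))"
      unfolding G_diff[OF conjunct1[OF NN]] A_def[symmetric] by (rule norm_sum)
    also have "\<dots> = (\<Sum>p\<in>A. \<bar>norm (h p - 1)\<bar> / real p)" by (simp add: norm_divide)
    also have "\<dots> \<le> sqrt (2 * (\<Sum>p\<in>A. (norm (h p - 1))\<^sup>2 / real p))"
      by (rule sum_large_primes_le[of N']) (use N NN sq in \<open>auto simp: A_def\<close>)
    also have "\<dots> \<le> sqrt (2\<^sup>2 * sum wt A)"
    proof (intro real_sqrt_le_mono)
      have "(\<Sum>p\<in>A. (norm (h p - 1))\<^sup>2 / real p) \<le> (\<Sum>p\<in>A. 2 * (1 - Re (h p)) / real p)"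
        using pos by (intro sum_mono divide_right_mono norm_sub_one_sq_le norm_h) auto
      also have "\<dots> = 2 * sum wt A"
        unfolding sum_distrib_left by (intro sum.cong) (auto simp: wt_def A_def)
      finally show "2 * (\<Sum>p\<in>A. (norm (h p - 1))\<^sup>2 / real p) \<le> 2\<^sup>2 * sum wt A" by simp
    qed
    also have "\<dots> \<le> sqrt (2\<^sup>2 * (\<epsilon> / 4)\<^sup>2)"
      using y0[of N A] finA N by (intro real_sqrt_le_mono mult_left_mono) (auto simp: A_def)
    also have "\<dots> = \<epsilon> / 2" using e by (simp add: real_sqrt_mult)
    finally show "norm (G N' - G N) < \<epsilon>" using e by simp
  qed
qed

end

section \<open>Generic pretentious functions\<close>

text \<open>The limits of the approximants need not be known: eventual closeness to convergent
  sequences makes \<open>X\<close> a Cauchy sequence.\<close>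

lemma convergent_if_approx:
  fixes X :: "nat \<Rightarrow> 'a::banach"
  assumes "\<And>e. e > 0 \<Longrightarrow> \<exists>Y. convergent Y \<and> (\<forall>\<^sub>F N in sequentially. norm (X N - Y N) < e)"
  shows "convergent X"
proof -
  have "Cauchy X"
  proof (rule metric_CauchyI)
    fix e :: real assume e: "e > 0"
    then obtain Y where Y: "convergent Y" and ev: "\<forall>\<^sub>F N in sequentially. norm (X N - Y N) < e / 3"
      using assms[of "e / 3"] by auto
    obtain n1 where n1: "\<And>m n. m \<ge> n1 \<Longrightarrow> n \<ge> n1 \<Longrightarrow> dist (Y m) (Y n) < e / 3"
      using metric_CauchyD[OF convergent_Cauchy[OF Y], of "e / 3"] e by auto
    obtain n2 where n2: "\<And>n. n \<ge> n2 \<Longrightarrow> dist (X n) (Y n) < e / 3"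
      using ev unfolding eventually_sequentially dist_norm by auto
    show "\<exists>M. \<forall>m\<ge>M. \<forall>n\<ge>M. dist (X m) (X n) < e"
    proof (intro exI[of _ "max n1 n2"] allI impI)
      fix m n assume "max n1 n2 \<le> m" "max n1 n2 \<le> n"
      then show "dist (X m) (X n) < e"
        using n1[of m n] n2[of m] n2[of n] dist_triangle_third[of "X m" "Y m" e "Y n" "X n"]
        by (simp add: dist_commute)
    qed
  qed
  then show ?thesis by (simp add: Cauchy_convergent_iff)
qed

text \<open>Orthogonality of the additive characters modulo \<open>R\<close>.\<close>

lemma sum_roots_of_unity_powers:
  fixes R :: nat and n a :: nat
  assumes R: "R > 0" and a: "a < R"
  shows "(\<Sum>r<R. cis (2 * pi * real r / real R) ^ n * cnj (cis (2 * pi * real r / real R)) ^ a) =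
     of_nat R * of_bool (n mod R = a)"
proof -
  define w where "w = cis (2 * pi * (real n - real a) / real R)"
  have trm: "cis (2 * pi * real r / real R) ^ n * cnj (cis (2 * pi * real r / real R)) ^ a = w ^ r" for r
    unfolding w_def cis_cnj Complex.DeMoivre cis_mult
    by (rule arg_cong[of _ _ cis]) (simp add: algebra_simps diff_divide_distrib)
  have wR: "w ^ R = 1"
  proof -
    have "w ^ R = cis (2 * pi * of_int (int n - int a))"
      unfolding w_def Complex.DeMoivre using R by (intro arg_cong[of _ _ cis]) simp
    then show ?thesis by simp
  qed
  have w1: "w = 1 \<longleftrightarrow> n mod R = a"
  proof
    assume "w = 1"
    then have "cos (2 * pi * (real n - real a) / real R) = 1"
      unfolding w_def by (metis cis.sel(1) one_complex.sel(1))
    then obtain k :: int where k: "2 * pi * (real n - real a) / real R = of_int k * 2 * pi"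
      using cos_one_2pi_int by blast
    then have "2 * pi * ((real n - real a) / real R) = 2 * pi * of_int k" by simp
    then have "(real n - real a) / real R = of_int k" by (subst (asm) mult_left_cancel) auto
    then have "real n - real a = real R * of_int k" using R by (simp add: field_simps)
    then have "of_int (int n - int a) = (of_int (int R * k) :: real)" by simp
    then have "int n - int a = int R * k" by (simp only: of_int_eq_iff)
    then have "int n mod int R = int a mod int R" by (metis mod_mult_self2 diff_add_cancel add.commute)
    then have "n mod R = a mod R" by (metis of_nat_eq_iff zmod_int)
    then show "n mod R = a" using a by simp
  next
    assume "n mod R = a"
    then have "real n - real a = real R * real (n div R)"
      by (metis add_diff_cancel_right' div_mult_mod_eq mult.commute of_nat_add of_nat_mult)
    then have "2 * pi * (real n - real a) / real R = 2 * pi * of_int (int (n div R))" using R by simp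
    then show "w = 1" unfolding w_def by (metis cis_multiple_2pi Ints_of_int)
  qed
  show ?thesis
  proof (cases "w = 1")
    case True
    then show ?thesis using w1 by (simp add: trm)
  next
    case False
    then have "(\<Sum>r<R. w ^ r) = 0" using wR by (simp add: geometric_sum)
    then show ?thesis using False w1 by (simp add: trm)
  qed
qed

text \<open>Rescaling by \<open>K\<close> moves both points into the unit disc, where the power map
  has Lipschitz constant \<open>Q\<close>.\<close>

lemma norm_power_diff_le:
  fixes a b :: complex
  assumes "norm a \<le> K" "norm b \<le> K" "K \<ge> 1"
  shows "norm (a ^ Q - b ^ Q) \<le> real Q * K ^ Q * norm (a - b)"
proof -
  have K: "K > 0" using assms by simp
  have "norm ((a / of_real K) ^ Q - (b / of_real K) ^ Q) \<le> real Q * norm (a / of_real K - b / of_real K)"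
    using assms K by (intro norm_power_diff) (auto simp: norm_divide)
  also have "(a / of_real K) ^ Q - (b / of_real K) ^ Q = (a ^ Q - b ^ Q) / of_real (K ^ Q)"
    by (simp add: power_divide diff_divide_distrib)
  also have "a / of_real K - b / of_real K = (a - b) / of_real K" by (simp add: diff_divide_distrib)
  finally have "norm (a ^ Q - b ^ Q) / K ^ Q \<le> real Q * (norm (a - b) / K)"
    using K by (simp add: norm_divide norm_power)
  then have "norm (a ^ Q - b ^ Q) \<le> K ^ Q * (real Q * (norm (a - b) / K))"
    using K by (simp add: field_simps)
  also have "\<dots> \<le> K ^ Q * (real Q * norm (a - b))"
    using assms K mult_left_mono[of 1 K "norm (a - b)"] by (intro mult_left_mono) (auto simp: divide_le_eq)
  finally show ?thesis by (simp add: mult_ac)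
qed

text \<open>Telescoping takes the place of an integral: the differences of
  \<open>n * twist \<tau> n\<close> sum to \<open>N * twist \<tau> N\<close>, and each of them is
  asymptotically \<open>(1 + i \<tau>) * twist \<tau> n\<close>.\<close>

lemma avg_twist:
  "(\<lambda>N. (1 + \<i> * of_real \<tau>) * avg (twist \<tau>) N - twist \<tau> N) \<longlonglongrightarrow> 0"
proof -
  define D where "D n = of_nat n * twist \<tau> n - of_nat (n - 1) * twist \<tau> (n - 1)" for n
  have sumD: "(\<Sum>n\<in>{1..N}. D n) = of_nat N * twist \<tau> N" for N
    by (induction N) (auto simp: D_def)
  have avgD: "avg D N = twist \<tau> N" if "N > 0" for N
    using that sumD[of N] by (simp add: avg_complex)
  \<comment> \<open>The angle is close to \<open>- \<tau> / n\<close>, and \<open>cis\<close>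
    differs from its first order expansion by a quadratic term.\<close>
  have lim: "(\<lambda>n. of_nat (n - 1) * (1 - cis (\<tau> * ln (1 - 1 / real n)))) \<longlonglongrightarrow> \<i> * of_real \<tau>"
  proof -
    define \<theta> where "\<theta> n = \<tau> * ln (1 - 1 / real n)" for n
    have 1: "(\<lambda>n. (real n - 1) * ln (1 - 1 / real n)) \<longlonglongrightarrow> -1" by real_asymp
    have 2: "(\<lambda>n. (real n - 1) * (ln (1 - 1 / real n))\<^sup>2) \<longlonglongrightarrow> 0" by real_asymp
    have "(\<lambda>n. of_nat (n - 1) * (1 + \<i> * of_real (\<theta> n) - cis (\<theta> n))) \<longlonglongrightarrow> 0"
    proof (rule Lim_null_comparison)
      show "(\<lambda>n. \<tau>\<^sup>2 * ((real n - 1) * (ln (1 - 1 / real n))\<^sup>2)) \<longlonglongrightarrow> 0"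
        using tendsto_mult_right_zero[OF 2] .
      show "\<forall>\<^sub>F n in sequentially. norm (of_nat (n - 1) * (1 + \<i> * of_real (\<theta> n) - cis (\<theta> n)))
          \<le> \<tau>\<^sup>2 * ((real n - 1) * (ln (1 - 1 / real n))\<^sup>2)"
        using eventually_ge_at_top[of 1]
      proof eventually_elim
        case (elim n)
        have "norm (exp (\<i> * of_real (\<theta> n)) - (\<Sum>k\<le>1. (\<i> * of_real (\<theta> n)) ^ k / (fact k)))
           \<le> exp \<bar>Re (\<i> * of_real (\<theta> n))\<bar> * (norm (\<i> * of_real (\<theta> n))) ^ (Suc 1) / (fact 1)"
          by (rule Taylor_exp)
        then have "norm (1 + \<i> * of_real (\<theta> n) - cis (\<theta> n)) \<le> (\<theta> n)\<^sup>2"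
          by (simp add: cis_conv_exp norm_mult norm_minus_commute power2_eq_square)
        then have "real (n - 1) * norm (1 + \<i> * of_real (\<theta> n) - cis (\<theta> n)) \<le> real (n - 1) * (\<theta> n)\<^sup>2"
          by (intro mult_left_mono) auto
        also have "real (n - 1) * (\<theta> n)\<^sup>2 = \<tau>\<^sup>2 * ((real n - 1) * (ln (1 - 1 / real n))\<^sup>2)"
          using elim by (simp add: \<theta>_def of_nat_diff power_mult_distrib mult_ac)
        finally show ?case unfolding norm_mult norm_of_nat .
      qed
    qed
    moreover have "(\<lambda>n. \<i> * of_real (- \<tau> * ((real n - 1) * ln (1 - 1 / real n)))) \<longlonglongrightarrow> \<i> * of_real (- \<tau> * (-1))"
      by (intro tendsto_intros 1)
    ultimately have "(\<lambda>n. of_nat (n - 1) * (1 + \<i> * of_real (\<theta> n) - cis (\<theta> n)) +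
        \<i> * of_real (- \<tau> * ((real n - 1) * ln (1 - 1 / real n)))) \<longlonglongrightarrow> 0 + \<i> * of_real (- \<tau> * (-1))"
      by (rule tendsto_add)
    moreover have "\<forall>\<^sub>F n in sequentially. of_nat (n - 1) * (1 + \<i> * of_real (\<theta> n) - cis (\<theta> n)) +
        \<i> * of_real (- \<tau> * ((real n - 1) * ln (1 - 1 / real n))) = of_nat (n - 1) * (1 - cis (\<tau> * ln (1 - 1 / real n)))"
      using eventually_ge_at_top[of 1]
      by eventually_elim (simp add: \<theta>_def of_nat_diff algebra_simps)
    ultimately show ?thesis by (simp add: tendsto_cong)
  qed
  have Dlim: "(\<lambda>n. D n - (1 + \<i> * of_real \<tau>) * twist \<tau> n) \<longlonglongrightarrow> 0"
  proof (rule Lim_null_comparison)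
    show "(\<lambda>n. norm (of_nat (n - 1) * (1 - cis (\<tau> * ln (1 - 1 / real n))) - \<i> * of_real \<tau>)) \<longlonglongrightarrow> 0"
      using tendsto_norm[OF LIM_zero[OF lim]] by simp
    show "\<forall>\<^sub>F n in sequentially. norm (D n - (1 + \<i> * of_real \<tau>) * twist \<tau> n)
        \<le> norm (of_nat (n - 1) * (1 - cis (\<tau> * ln (1 - 1 / real n))) - \<i> * of_real \<tau>)"
      using eventually_ge_at_top[of 2]
    proof eventually_elim
      case (elim n)
      have "twist \<tau> (n - 1) = twist \<tau> n * cis (\<tau> * ln (1 - 1 / real n))"
      proof -
        have "ln (real (n - 1)) = ln (real n * (1 - 1 / real n))"
          using elim by (intro arg_cong[of _ _ ln]) (simp add: of_nat_diff field_simps)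
        also have "\<dots> = ln (real n) + ln (1 - 1 / real n)" using elim by (intro ln_mult_pos) auto
        finally show ?thesis using elim by (simp add: twist_eq_cis cis_mult algebra_simps)
      qed
      then have "D n - (1 + \<i> * of_real \<tau>) * twist \<tau> n =
         twist \<tau> n * (of_nat (n - 1) * (1 - cis (\<tau> * ln (1 - 1 / real n))) - \<i> * of_real \<tau>)"
        using elim by (simp add: D_def of_nat_diff algebra_simps)
      then show ?case using elim by (simp add: norm_mult norm_twist)
    qed
  qed
  have "(\<lambda>N. - avg (\<lambda>n. D n - (1 + \<i> * of_real \<tau>) * twist \<tau> n) N) \<longlonglongrightarrow> - 0"
    by (intro tendsto_minus avg_tendsto_0 Dlim)
  moreover have "\<forall>\<^sub>F N in sequentially. - avg (\<lambda>n. D n - (1 + \<i> * of_real \<tau>) * twist \<tau> n) N =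
      (1 + \<i> * of_real \<tau>) * avg (twist \<tau>) N - twist \<tau> N"
    using eventually_gt_at_top[of 0] by eventually_elim (simp add: avg_diff avg_mult_left avgD)
  ultimately show ?thesis by (simp add: tendsto_cong)
qed

text \<open>Comparing \<open>k\<close> and \<open>k + 1\<close> gives
  \<open>cis (\<tau> * ln (1 + 1 / k)) = 1\<close>. If \<open>\<tau> \<noteq> 0\<close> and
  \<open>k > \<bar>\<tau>\<bar>\<close>, this angle is nonzero and smaller than 1 in absolute value,
  so it is not a multiple of \<open>2 * pi\<close>.\<close>

lemma twist_eq_1D:
  assumes "\<And>k. k > 0 \<Longrightarrow> twist \<tau> k = 1"
  shows "\<tau> = 0"
proof (rule ccontr)
  assume t: "\<tau> \<noteq> 0"
  obtain k :: nat where k: "real k > \<bar>\<tau>\<bar>" using reals_Archimedean2 by blast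
  have k0: "k > 0" using k by (auto intro: gr0I)
  define x where "x = \<tau> * ln (1 + 1 / real k)"
  have "ln (real (Suc k)) = ln (real k * (1 + 1 / real k))"
    using k0 by (intro arg_cong[of _ _ ln]) (simp add: field_simps)
  also have "\<dots> = ln (real k) + ln (1 + 1 / real k)" using k0 by (intro ln_mult_pos) (auto intro: add_pos_nonneg)
  finally have "cis x * twist \<tau> k = twist \<tau> (Suc k)"
    using k0 by (simp add: twist_eq_cis x_def cis_mult algebra_simps del: of_nat_Suc)
  then have "cis x = 1" using assms k0 by simp
  then have cx: "cos x = 1" by (metis cis.sel(1) one_complex.sel(1))
  have "0 < ln (1 + 1 / real k)" using k0 by (intro ln_gt_zero) simp
  then have "x \<noteq> 0" using t by (simp add: x_def)
  have "ln (1 + 1 / real k) \<le> 1 / real k" by (rule ln_add_one_self_le_self) auto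
  then have "\<bar>x\<bar> \<le> \<bar>\<tau>\<bar> * (1 / real k)"
    unfolding x_def abs_mult using \<open>0 < ln (1 + 1 / real k)\<close> by (intro mult_left_mono) auto
  also have "\<dots> < 1" using k k0 by simp
  finally have "\<bar>x\<bar> < 2 * pi" using pi_gt3 by linarith
  moreover obtain j :: int where j: "x = of_int j * 2 * pi" using cx cos_one_2pi_int by blast
  ultimately have "\<bar>of_int j\<bar> < (1::real)" by (simp add: abs_mult)
  then have "j = 0" by linarith
  with j \<open>x \<noteq> 0\<close> show False by simp
qed

text \<open>A branch of the logarithm can be chosen along the sequence because its steps tend to 0.\<close>

lemma convergent_if_exp_convergent:
  fixes g :: "nat \<Rightarrow> complex"
  assumes lim: "(\<lambda>N. exp (g N)) \<longlonglongrightarrow> l" and l: "l \<noteq> 0" and slow: "(\<lambda>N. g (Suc N) - g N) \<longlonglongrightarrow> 0"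
  shows "convergent g"
proof -
  define r where "r N = Ln (exp (g N) / l)" for N
  have "(\<lambda>N. exp (g N) / l) \<longlonglongrightarrow> l / l" using l by (intro tendsto_intros lim) auto
  then have r: "r \<longlonglongrightarrow> 0"
    unfolding r_def using l tendsto_Ln[of "\<lambda>N. exp (g N) / l" 1] by simp
  define \<beta> where "\<beta> = Ln l"
  have "\<exists>k::int. g N = \<beta> + r N + (of_int (2 * k) * pi) * \<i>" for N
  proof -
    have "exp (g N) = exp (\<beta> + r N)" using l by (simp add: exp_add \<beta>_def r_def)
    then show ?thesis by (simp add: exp_eq)
  qed
  then obtain k :: "nat \<Rightarrow> int" where k: "\<And>N. g N = \<beta> + r N + (of_int (2 * k N) * pi) * \<i>" by metis
  have "(\<lambda>N. (g (Suc N) - g N) - (r (Suc N) - r N)) \<longlonglongrightarrow> 0 - (0 - 0)"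
    by (intro tendsto_intros slow LIMSEQ_Suc r)
  moreover have "(g (Suc N) - g N) - (r (Suc N) - r N) = of_int (2 * (k (Suc N) - k N)) * pi * \<i>" for N
    by (simp add: k algebra_simps)
  ultimately have "(\<lambda>N. of_int (2 * (k (Suc N) - k N)) * complex_of_real pi * \<i>) \<longlonglongrightarrow> 0" by simp
  then obtain N0 where N0: "\<And>N. N \<ge> N0 \<Longrightarrow> norm (of_int (2 * (k (Suc N) - k N)) * complex_of_real pi * \<i>) < 1"
    using LIMSEQ_D[of _ 0 1] by fastforce
  \<comment> \<open>The branch part of a step has modulus \<open>2 * pi\<close> times an integer, so
    it vanishes once it is below 1.\<close>
  have step: "k (Suc N) = k N" if "N \<ge> N0" for N
  proof (rule ccontr)
    assume "k (Suc N) \<noteq> k N"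
    then have "\<bar>k (Suc N) - k N\<bar> \<ge> 1" by linarith
    then have "2 * \<bar>of_int (k (Suc N) - k N)\<bar> * pi \<ge> 2 * 1 * (pi::real)"
      by (intro mult_right_mono mult_left_mono) (simp_all flip: of_int_abs)
    moreover have eq: "norm (of_int (2 * d) * complex_of_real pi * \<i>) = 2 * \<bar>of_int d\<bar> * pi" for d :: int
      by (simp add: norm_mult)
    have "2 * \<bar>of_int (k (Suc N) - k N)\<bar> * pi < 1" using N0[OF that] unfolding eq .
    ultimately show False using pi_gt3 by linarith
  qed
  have "k N = k N0" if "N \<ge> N0" for N
    using that by (induction N rule: dec_induct) (auto simp: step)
  then have ev: "\<forall>\<^sub>F N in sequentially. \<beta> + r N + (of_int (2 * k N0) * pi) * \<i> = g N"
    unfolding eventually_sequentially by (metis k)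
  have "(\<lambda>N. \<beta> + r N + (of_int (2 * k N0) * pi) * \<i>) \<longlonglongrightarrow> \<beta> + 0 + (of_int (2 * k N0) * pi) * \<i>"
    by (intro tendsto_intros r)
  then have "g \<longlonglongrightarrow> \<beta> + 0 + (of_int (2 * k N0) * pi) * \<i>" using ev by (rule Lim_transform_eventually)
  then show ?thesis by (rule convergentI)
qed

lemma avg_inverse_tendsto_0: "(\<lambda>N. avg (\<lambda>n. of_bool (n > 0) * (c / real n)) N) \<longlonglongrightarrow> 0"
proof (rule avg_tendsto_0)
  have "(\<lambda>n. c / real n) \<longlonglongrightarrow> 0" by (rule lim_const_over_n)
  moreover have "(\<lambda>n. of_bool (n > 0) * (c / real n)) = (\<lambda>n. c / real n)"
    by (rule ext) (auto simp: of_bool_def)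
  ultimately show "(\<lambda>n. of_bool (n > 0) * (c / real n)) \<longlonglongrightarrow> 0" by simp
qed

text \<open>\<open>ln (1 + x) \<le> x\<close> bounds the change of the phase, and \<open>cis\<close>
  is 1-Lipschitz. Across a window of fixed length \<open>twist\<close> is therefore nearly
  constant.\<close>

lemma norm_twist_shift_le:
  assumes "n > 0"
  shows "norm (twist \<tau> (n + m) - twist \<tau> n) \<le> \<bar>\<tau>\<bar> * real m / real n"
proof -
  have "ln (real (n + m)) = ln (real n * (1 + real m / real n))"
    using assms by (intro arg_cong[of _ _ ln]) (simp add: field_simps)
  also have "\<dots> = ln (real n) + ln (1 + real m / real n)"
    using assms by (intro ln_mult_pos) (auto intro: add_pos_nonneg)
  finally have ln_eq: "ln (real (n + m)) - ln (real n) = ln (1 + real m / real n)" by simp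
  have "norm (exp (\<i> * of_real (\<tau> * ln (real (n + m)))) - exp (\<i> * of_real (\<tau> * ln (real n))))
     \<le> norm (\<i> * of_real (\<tau> * ln (real (n + m))) - \<i> * of_real (\<tau> * ln (real n)))"
    by (rule norm_exp_diff_le) auto
  also have "\<dots> = \<bar>\<tau>\<bar> * \<bar>ln (real (n + m)) - ln (real n)\<bar>"
    by (simp add: right_diff_distrib[symmetric] norm_mult abs_mult flip: of_real_diff)
  also have "ln (real (n + m)) - ln (real n) = ln (1 + real m / real n)" by (rule ln_eq)
  also have "\<bar>ln (1 + real m / real n)\<bar> \<le> real m / real n"
    using ln_add_one_self_le_self[of "real m / real n"] by (simp add: ln_ge_zero)
  finally show ?thesis using assms by (simp add: twist_eq_cis cis_conv_exp mult_left_mono)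
qed

section \<open>Means against roots of unity, and windows\<close>

context pretentious
begin

text \<open>Dividing by \<open>exp (G N)\<close> enlarges errors by at most
  \<open>C = exp Dist\<close>. Asking for \<open>\<epsilon> / C\<close> at the start gives both
  forms of the estimate with one and the same \<open>g\<close>.\<close>

lemma normalized_approx:
  assumes e: "\<epsilon> > 0"
  shows "\<exists>g. periodic_seq g \<and> (\<forall>n. norm (g n) \<le> exp Dist) \<and>
     (\<forall>\<^sub>F N in sequentially. avg (\<lambda>n. norm (f n * cnj (twist t n) - g n * exp (G N))) N < \<epsilon>) \<and>
     (\<forall>\<^sub>F N in sequentially. avg (\<lambda>n. norm (f n * cnj (twist t n) * exp (- G N) - g n)) N < \<epsilon>)"
proof -
  have D: "Dist \<ge> 0" using sum_wt_le[of "{}"] by simp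
  define C where "C = exp Dist"
  have C: "C \<ge> 1" using D by (simp add: C_def)
  have "\<epsilon> / C > 0" using e C by simp
  from asymptotically_RAP[OF this] obtain g where g: "periodic_seq g" "\<And>n. norm (g n) \<le> C"
    and ev: "\<forall>\<^sub>F N in sequentially. avg (\<lambda>n. norm (f n * cnj (twist t n) - g n * exp (G N))) N < \<epsilon> / C"
    unfolding C_def by blast
  have le: "\<epsilon> / C \<le> \<epsilon>" using e C by (simp add: divide_le_eq)
  show ?thesis
  proof (intro exI[of _ g] conjI allI)
    show "norm (g n) \<le> exp Dist" for n using g(2) by (simp add: C_def)
    show "\<forall>\<^sub>F N in sequentially. avg (\<lambda>n. norm (f n * cnj (twist t n) - g n * exp (G N))) N < \<epsilon>"
      using ev by eventually_elim (use le in simp)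
    show "\<forall>\<^sub>F N in sequentially. avg (\<lambda>n. norm (f n * cnj (twist t n) * exp (- G N) - g n)) N < \<epsilon>"
      using ev
    proof eventually_elim
      case (elim N)
      have "avg (\<lambda>n. norm (f n * cnj (twist t n) * exp (- G N) - g n)) N =
          avg (\<lambda>n. norm (exp (- G N)) * norm (f n * cnj (twist t n) - g n * exp (G N))) N"
      proof (rule avg_cong)
        fix n
        have "f n * cnj (twist t n) * exp (- G N) - g n = exp (- G N) * (f n * cnj (twist t n) - g n * exp (G N))"
          by (simp add: algebra_simps exp_minus)
        then show "norm (f n * cnj (twist t n) * exp (- G N) - g n) =
            norm (exp (- G N)) * norm (f n * cnj (twist t n) - g n * exp (G N))"
          by (simp only: norm_mult)
      qed
      also have "\<dots> \<le> C * avg (\<lambda>n. norm (f n * cnj (twist t n) - g n * exp (G N))) N"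
        unfolding avg_mult_left C_def using norm_exp_G(2)[of N] by (intro mult_right_mono avg_nonneg) auto
      also have "\<dots> < C * (\<epsilon> / C)" using elim C by (intro mult_strict_left_mono) auto
      finally show ?case using C by simp
    qed
  qed (use g in auto)
qed

text \<open>A periodic sequence times \<open>z ^ n\<close> is again periodic, so the approximants
  from \<open>normalized_approx\<close> have convergent means.\<close>

lemma coefficient_convergent:
  assumes z: "z ^ Q = 1" "Q > 0" and nz: "norm z = 1"
  shows "convergent (\<lambda>N. avg (\<lambda>n. f n * cnj (twist t n) * exp (- G N) * z ^ n) N)"
proof (rule convergent_if_approx)
  fix e :: real assume "e > 0"
  from normalized_approx[OF this] obtain g where g: "periodic_seq g"
    and ev: "\<forall>\<^sub>F N in sequentially. avg (\<lambda>n. norm (f n * cnj (twist t n) * exp (- G N) - g n)) N < e"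
    by blast
  from g obtain R where R: "R > 0" "\<And>n. g (n + R) = g n" by (auto simp: periodic_seq_def)
  have conv: "convergent (avg (\<lambda>n. g n * z ^ n))"
  proof (rule convergentI, rule avg_periodic_tendsto)
    show "Q * R > 0" using R z by simp
    show "g (n + Q * R) * z ^ (n + Q * R) = g n * z ^ n" for n
      using periodic_add_mult[of g R n Q] R z by (simp add: power_add power_mult)
  qed
  have "\<forall>\<^sub>F N in sequentially. norm (avg (\<lambda>n. f n * cnj (twist t n) * exp (- G N) * z ^ n) N - avg (\<lambda>n. g n * z ^ n) N) < e"
    using ev
  proof eventually_elim
    case (elim N)
    have "norm (avg (\<lambda>n. f n * cnj (twist t n) * exp (- G N) * z ^ n) N - avg (\<lambda>n. g n * z ^ n) N)
       \<le> avg (\<lambda>n. norm (f n * cnj (twist t n) * exp (- G N) * z ^ n - g n * z ^ n)) N"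
      unfolding avg_diff[symmetric] by (rule norm_avg_le)
    also have "\<dots> = avg (\<lambda>n. norm (f n * cnj (twist t n) * exp (- G N) - g n)) N"
      by (intro avg_cong) (simp add: left_diff_distrib[symmetric] norm_mult norm_power nz)
    finally show ?case using elim by simp
  qed
  with conv show "\<exists>Y. convergent Y \<and> (\<forall>\<^sub>F N in sequentially.
      norm (avg (\<lambda>n. f n * cnj (twist t n) * exp (- G N) * z ^ n) N - Y N) < e)" by blast
qed

text \<open>If all these means were 0, the finite Fourier expansion of a periodic approximant
  \<open>g\<close> would give mean 0 for the normalised function times \<open>cnj g\<close>. But
  this product is close in mean to the squared modulus of \<open>g\<close>, and \<open>g\<close> is
  not small in mean by \<open>avg_norm_f_lower\<close>.\<close>

lemma nonzero_coefficient:
  "\<exists>Q z c. Q > 0 \<and> z ^ Q = 1 \<and> norm z = 1 \<and> c \<noteq> 0 \<and>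
     (\<lambda>N. avg (\<lambda>n. f n * cnj (twist t n) * exp (- G N) * z ^ n) N) \<longlonglongrightarrow> c"
proof (rule ccontr)
  assume contra: "\<not> ?thesis"
  let ?u = "\<lambda>N n. f n * cnj (twist t n) * exp (- G N)"
  have zero: "(\<lambda>N. avg (\<lambda>n. ?u N n * z ^ n) N) \<longlonglongrightarrow> 0" if z: "Q > 0" "z ^ Q = 1" "norm z = 1" for Q z
  proof -
    obtain c where c: "(\<lambda>N. avg (\<lambda>n. ?u N n * z ^ n) N) \<longlonglongrightarrow> c"
      using coefficient_convergent[OF z(2,1,3)] unfolding convergent_def by blast
    then have "c = 0" using contra z by blast
    then show ?thesis using c by simp
  qed
  obtain \<kappa> where kap: "\<kappa> > 0" "\<forall>\<^sub>F N in sequentially. avg (\<lambda>n. norm (f n)) N \<ge> \<kappa>"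
    using avg_norm_f_lower by blast
  define C where "C = exp Dist"
  have C: "C > 0" by (simp add: C_def)
  \<comment> \<open>\<open>e \<le> \<kappa> / 2\<close> leaves \<open>g\<close> a mean modulus of at
    least \<open>\<kappa> / 2\<close>, hence a mean square of at least
    \<open>\<kappa>^2 / 4\<close>. With \<open>C * e \<le> \<kappa>^2 / 8\<close> the two error
    terms below add up to less.\<close>
  define e where "e = min (\<kappa> / 2) (\<kappa>\<^sup>2 / (8 * C))"
  have e: "e > 0" "e \<le> \<kappa> / 2" "C * e \<le> \<kappa>\<^sup>2 / 8"
  proof -
    show "e > 0" using kap C by (simp add: e_def)
    show "e \<le> \<kappa> / 2" by (simp add: e_def)
    have "C * e \<le> C * (\<kappa>\<^sup>2 / (8 * C))" using C by (intro mult_left_mono) (auto simp: e_def)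
    then show "C * e \<le> \<kappa>\<^sup>2 / 8" using C by simp
  qed
  from normalized_approx[OF e(1)] obtain g where g: "periodic_seq g" "\<And>n. norm (g n) \<le> C"
    and ev: "\<forall>\<^sub>F N in sequentially. avg (\<lambda>n. norm (?u N n - g n)) N < e"
    unfolding C_def by blast
  from g obtain R where R: "R > 0" "\<And>n. g (n + R) = g n" by (auto simp: periodic_seq_def)
  define w where "w r = cis (2 * pi * real r / real R)" for r
  have w: "w r ^ R = 1" "norm (w r) = 1" for r
  proof -
    have "w r ^ R = cis (2 * pi * of_int (int r))"
      unfolding w_def Complex.DeMoivre using R by (intro arg_cong[of _ _ cis]) simp
    then show "w r ^ R = 1" by simp
  qed (simp add: w_def)
  have cg: "cnj (g n) = (\<Sum>a<R. cnj (g a) / of_nat R * (\<Sum>r<R. w r ^ n * cnj (w r) ^ a))" for n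
  proof -
    have "(\<Sum>a<R. cnj (g a) / of_nat R * (\<Sum>r<R. w r ^ n * cnj (w r) ^ a)) = (\<Sum>a<R. cnj (g a) * of_bool (n mod R = a))"
      unfolding w_def by (intro sum.cong refl) (subst sum_roots_of_unity_powers, use R in auto)
    also have "\<dots> = (\<Sum>a<R. if n mod R = a then cnj (g a) else 0)"
      by (intro sum.cong) auto
    also have "\<dots> = cnj (g (n mod R))" using R by simp
    finally show ?thesis using periodic_mod[of g R n] R by simp
  qed
  have "(\<lambda>N. \<Sum>a<R. cnj (g a) / of_nat R * (\<Sum>r<R. avg (\<lambda>n. ?u N n * w r ^ n) N * cnj (w r) ^ a))
     \<longlonglongrightarrow> (\<Sum>a<R. cnj (g a) / of_nat R * (\<Sum>r<R. 0 * cnj (w r) ^ a))"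
    by (intro tendsto_intros zero[OF R(1) w])
  moreover have "(\<Sum>a<R. cnj (g a) / of_nat R * (\<Sum>r<R. avg (\<lambda>n. ?u N n * w r ^ n) N * cnj (w r) ^ a))
      = avg (\<lambda>n. ?u N n * cnj (g n)) N" for N
  proof -
    have "?u N n * cnj (g n) = (\<Sum>a<R. cnj (g a) / of_nat R * (\<Sum>r<R. (?u N n * w r ^ n) * cnj (w r) ^ a))" for n
      unfolding cg[of n] by (simp add: sum_distrib_left mult_ac)
    then show ?thesis by (simp only: avg_sum avg_mult_left avg_mult_right)
  qed
  ultimately have "(\<lambda>N. avg (\<lambda>n. ?u N n * cnj (g n)) N) \<longlonglongrightarrow> 0" by simp
  then have "\<forall>\<^sub>F N in sequentially. norm (avg (\<lambda>n. ?u N n * cnj (g n)) N) < \<kappa>\<^sup>2 / 8"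
    by (rule order_tendstoD(2)[OF tendsto_norm_zero]) (use kap in simp)
  then have "\<forall>\<^sub>F N in sequentially. False"
    using ev kap(2) eventually_gt_at_top[of 0]
  proof eventually_elim
    case (elim N)
    have "\<kappa> \<le> avg (\<lambda>n. norm (f n)) N" by (rule elim)
    also have "\<dots> \<le> avg (\<lambda>n. norm (?u N n - g n) + norm (g n)) N"
    proof (rule avg_mono)
      fix n :: nat assume n: "1 \<le> n"
      \<comment> \<open>The real part of \<open>G N\<close> is nonpositive, so dividing by
        \<open>exp (G N)\<close> can only enlarge the modulus.\<close>
      have "norm (exp (G N)) * norm (exp (- G N)) = 1" by (simp flip: norm_mult exp_add)
      then have "1 \<le> norm (exp (- G N))"
        using norm_exp_G(1)[of N] mult_right_mono[of "norm (exp (G N))" 1 "norm (exp (- G N))"] by simp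
      then have "norm (f n) * 1 \<le> norm (f n) * norm (exp (- G N))" by (intro mult_left_mono) auto
      also have "\<dots> = norm (?u N n)" using n by (simp add: norm_mult norm_twist)
      finally show "norm (f n) \<le> norm (?u N n - g n) + norm (g n)"
        using norm_triangle_sub[of "?u N n" "g n"] by simp
    qed
    also have "\<dots> \<le> \<kappa> / 2 + avg (\<lambda>n. norm (g n)) N" unfolding avg_add using elim e by simp
    finally have "\<kappa> / 2 \<le> avg (\<lambda>n. norm (g n)) N" by simp
    also have "\<dots> \<le> sqrt (avg (\<lambda>n. (norm (g n))\<^sup>2) N)" by (rule avg_le_sqrt_avg_sq)
    finally have "(\<kappa> / 2)\<^sup>2 \<le> avg (\<lambda>n. (norm (g n))\<^sup>2) N"
      using kap by (intro sqrt_ge_absD) simp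
    also have "\<dots> = norm (avg (\<lambda>n. complex_of_real ((norm (g n))\<^sup>2)) N)"
      by (simp add: avg_complex avg_real norm_divide sum_nonneg flip: of_real_sum of_real_power)
    also have "\<dots> = norm (avg (\<lambda>n. ?u N n * cnj (g n) - (?u N n - g n) * cnj (g n)) N)"
      unfolding complex_norm_square by (simp add: algebra_simps)
    also have "\<dots> \<le> norm (avg (\<lambda>n. ?u N n * cnj (g n)) N) + norm (avg (\<lambda>n. (?u N n - g n) * cnj (g n)) N)"
      unfolding avg_diff by (rule norm_triangle_ineq4)
    also have "norm (avg (\<lambda>n. (?u N n - g n) * cnj (g n)) N) \<le> avg (\<lambda>n. norm ((?u N n - g n) * cnj (g n))) N"
      by (rule norm_avg_le)
    also have "\<dots> \<le> avg (\<lambda>n. norm (?u N n - g n) * C) N"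
      unfolding norm_mult[of _ "cnj _"] using g(2) by (intro avg_mono mult_left_mono) auto
    also have "\<dots> = C * avg (\<lambda>n. norm (?u N n - g n)) N" by (simp add: avg_mult_right)
    also have "\<dots> \<le> C * e" using elim C by (intro mult_left_mono) auto
    finally show False using elim(1) e(3) kap(1) by (simp add: power2_eq_square)
  qed
  then show False by simp
qed

text \<open>For \<open>n > 0\<close> this is a continuous function of the shifted sequence. The
  exponent of \<open>z\<close> counts from the start of the window because an observable cannot know
  the position; this is why \<open>cnj z ^ n\<close> appears below.\<close>

definition window :: "complex \<Rightarrow> nat \<Rightarrow> nat \<Rightarrow> complex" where
  "window z L n = (\<Sum>m<L. f (n + m) * z ^ m) / of_nat L"

text \<open>On a window of fixed length \<open>f (n + m)\<close> is close in mean to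
  \<open>twist t n * g (n + m) * exp (G N)\<close>. The sum of \<open>g k * z ^ k\<close> over any
  \<open>L\<close> consecutive \<open>k\<close> is nearly \<open>L\<close> times its mean, uniformly
  in the position, and this mean is close to \<open>c\<close>.\<close>

lemma window_approx:
  assumes z: "z ^ Q = 1" "Q > 0" and nz: "norm z = 1"
    and c: "(\<lambda>N. avg (\<lambda>n. f n * cnj (twist t n) * exp (- G N) * z ^ n) N) \<longlonglongrightarrow> c"
    and eta: "\<eta> > 0"
  shows "\<exists>L>0. \<forall>\<^sub>F N in sequentially.
     avg (\<lambda>n. norm (window z L n - twist t n * exp (G N) * c * cnj z ^ n)) N < \<eta>"
proof -
  define C where "C = exp Dist"
  have C: "C > 0" by (simp add: C_def)
  \<comment> \<open>The errors collected below add up to at most \<open>5 * e\<close>.\<close>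
  define e where "e = \<eta> / 8"
  have e: "e > 0" using eta by (simp add: e_def)
  have zz: "z ^ n * cnj z ^ n = 1" for n
    using nz by (simp add: power_mult_distrib[symmetric] complex_norm_square[symmetric])
  from normalized_approx[OF e] obtain g where g: "periodic_seq g" "\<And>n. norm (g n) \<le> C"
    and ev1: "\<forall>\<^sub>F N in sequentially. avg (\<lambda>n. norm (f n * cnj (twist t n) - g n * exp (G N))) N < e"
    and ev2: "\<forall>\<^sub>F N in sequentially. avg (\<lambda>n. norm (f n * cnj (twist t n) * exp (- G N) - g n)) N < e"
    unfolding C_def by blast
  from g obtain R0 where R0: "R0 > 0" "\<And>n. g (n + R0) = g n" by (auto simp: periodic_seq_def)
  define R where "R = Q * R0"
  have R: "R > 0" using R0 z by (simp add: R_def)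
  have per: "g (n + R) * z ^ (n + R) = g n * z ^ n" for n
    using periodic_add_mult[of g R0 n Q] R0 z by (simp add: R_def power_add power_mult)
  define cg where "cg = (\<Sum>n<R. g n * z ^ n) /\<^sub>R real R"
  have cglim: "avg (\<lambda>n. g n * z ^ n) \<longlonglongrightarrow> cg"
    unfolding cg_def by (rule avg_periodic_tendsto[of "\<lambda>n. g n * z ^ n" R, OF per R])
  have cgc: "norm (c - cg) \<le> e"
  proof (rule tendsto_upperbound)
    show "(\<lambda>N. norm (avg (\<lambda>n. f n * cnj (twist t n) * exp (- G N) * z ^ n) N - avg (\<lambda>n. g n * z ^ n) N)) \<longlonglongrightarrow> norm (c - cg)"
      by (intro tendsto_intros c cglim)
    show "\<forall>\<^sub>F N in sequentially. norm (avg (\<lambda>n. f n * cnj (twist t n) * exp (- G N) * z ^ n) N - avg (\<lambda>n. g n * z ^ n) N) \<le> e"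
      using ev2
    proof eventually_elim
      case (elim N)
      have "norm (avg (\<lambda>n. f n * cnj (twist t n) * exp (- G N) * z ^ n) N - avg (\<lambda>n. g n * z ^ n) N)
         \<le> avg (\<lambda>n. norm (f n * cnj (twist t n) * exp (- G N) * z ^ n - g n * z ^ n)) N"
        unfolding avg_diff[symmetric] by (rule norm_avg_le)
      also have "\<dots> = avg (\<lambda>n. norm (f n * cnj (twist t n) * exp (- G N) - g n)) N"
        by (intro avg_cong) (simp add: left_diff_distrib[symmetric] norm_mult norm_power nz)
      finally show ?case using elim by simp
    qed
  qed simp
  obtain L :: nat where L: "real L > 2 * real R * C / e" using reals_Archimedean2 by blast
  have "2 * real R * C / e \<ge> 0" using C e by simp
  then have "real L > 0" using L by linarith
  then have L0: "L > 0" by simp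
  have Le: "2 * real R * C / real L \<le> e" using L L0 e by (simp add: field_simps)
  define v where "v N n = norm (f n * cnj (twist t n) - g n * exp (G N))" for N n
  have v: "0 \<le> v N n" "n > 0 \<Longrightarrow> v N n \<le> 1 + C" for N n
  proof -
    show "0 \<le> v N n" by (simp add: v_def)
    assume n: "n > 0"
    have "norm (g n) * norm (exp (G N)) \<le> C * 1" using g(2)[of n] norm_exp_G(1)[of N] C by (intro mult_mono) auto
    moreover have "norm (f n) * norm (cnj (twist t n)) \<le> 1" using n norm_f[OF n] by (simp add: norm_twist)
    ultimately show "v N n \<le> 1 + C"
      unfolding v_def using norm_triangle_ineq4[of "f n * cnj (twist t n)" "g n * exp (G N)"] by (simp add: norm_mult)
  qed
  define b where "b = C * (\<bar>t\<bar> * real L)"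
  have pw: "norm (window z L n - twist t n * exp (G N) * c * cnj z ^ n) \<le>
      (\<Sum>m<L. v N (n + m)) / real L + of_bool (n > 0) * (b / real n) + e + e"
    if n: "1 \<le> n" for n N
  proof -
    have n0: "n > 0" using n by simp
    have f_eq: "f k = twist t k * (f k * cnj (twist t k))" if "k > 0" for k
    proof -
      have "twist t k * cnj (twist t k) = 1" using norm_twist[OF that, of t] by (simp add: complex_norm_square[symmetric])
      then show ?thesis by (simp add: mult.left_commute)
    qed
    have t1: "norm (f (n + m) * z ^ m - twist t n * (g (n + m) * exp (G N)) * z ^ m) \<le> v N (n + m) + b / real n"
      if m: "m < L" for m
    proof -
      have "f (n + m) * z ^ m - twist t n * (g (n + m) * exp (G N)) * z ^ m =
         z ^ m * (twist t (n + m) * (f (n + m) * cnj (twist t (n + m)) - g (n + m) * exp (G N)) +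
           (twist t (n + m) - twist t n) * (g (n + m) * exp (G N)))"
        using f_eq[of "n + m"] n0 by (simp add: algebra_simps)
      also have "norm \<dots> \<le> norm (twist t (n + m)) * v N (n + m) + norm (twist t (n + m) - twist t n) * (norm (g (n + m)) * norm (exp (G N)))"
        unfolding norm_mult norm_power nz v_def power_one mult_1_left
        by (rule order_trans[OF norm_triangle_ineq]) (simp add: norm_mult)
      also have "\<dots> \<le> 1 * v N (n + m) + (\<bar>t\<bar> * real m / real n) * (C * 1)"
        using norm_twist[of "n + m" t] n0 v g(2)[of "n + m"] norm_exp_G(1)[of N] C
        by (intro add_mono mult_mono norm_twist_shift_le) auto
      also have "(\<bar>t\<bar> * real m / real n) * (C * 1) \<le> (\<bar>t\<bar> * real L / real n) * (C * 1)"
        using m C by (intro mult_right_mono divide_right_mono mult_left_mono) auto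
      also have "\<dots> = b / real n" by (simp add: b_def)
      finally show ?thesis by simp
    qed
    have "norm (window z L n - (\<Sum>m<L. twist t n * (g (n + m) * exp (G N)) * z ^ m) / of_nat L)
       = norm (\<Sum>m<L. f (n + m) * z ^ m - twist t n * (g (n + m) * exp (G N)) * z ^ m) / real L"
      unfolding window_def diff_divide_distrib[symmetric] sum_subtractf[symmetric] by (simp add: norm_divide)
    also have "\<dots> \<le> (\<Sum>m<L. v N (n + m) + b / real n) / real L"
      by (intro divide_right_mono sum_norm_le t1) auto
    also have "\<dots> = (\<Sum>m<L. v N (n + m)) / real L + b / real n"
      using L0 by (simp add: sum.distrib add_divide_distrib)
    finally have A: "norm (window z L n - (\<Sum>m<L. twist t n * (g (n + m) * exp (G N)) * z ^ m) / of_nat L) \<le>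
       (\<Sum>m<L. v N (n + m)) / real L + of_bool (n > 0) * (b / real n)" using n0 by simp
    define s where "s = (\<Sum>k\<in>{n..<n + L}. g k * z ^ k)"
    have "norm (s - real L *\<^sub>R cg) \<le> 2 * real R * C"
      unfolding s_def cg_def
      by (rule periodic_sum_bound[of "\<lambda>n. g n * z ^ n" R C n L, OF per R]) (use g(2) in \<open>simp add: norm_mult norm_power nz\<close>)
    then have "norm (s / of_nat L - cg) \<le> 2 * real R * C / real L"
    proof -
      have "s / of_nat L - cg = (s - real L *\<^sub>R cg) / of_nat L"
        using L0 by (simp add: scaleR_conv_of_real diff_divide_distrib)
      then have "norm (s / of_nat L - cg) = norm (s - real L *\<^sub>R cg) / real L" by (simp add: norm_divide)
      then show ?thesis
        using divide_right_mono[OF \<open>norm (s - real L *\<^sub>R cg) \<le> 2 * real R * C\<close>, of "real L"] by simp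
    qed
    then have s: "norm (s / of_nat L - cg) \<le> e" using Le by linarith
    have "s = (\<Sum>m<L. g (n + m) * z ^ (n + m))"
      unfolding s_def using sum.shift_bounds_nat_ivl[of "\<lambda>k. g k * z ^ k" 0 n L]
      by (simp add: atLeast0LessThan add.commute)
    then have "cnj z ^ n * s = (\<Sum>m<L. g (n + m) * z ^ m)"
    proof -
      have tm: "cnj z ^ n * (g (n + m) * z ^ (n + m)) = g (n + m) * z ^ m" for m
      proof -
        have "cnj z ^ n * (g (n + m) * z ^ (n + m)) = g (n + m) * z ^ m * (z ^ n * cnj z ^ n)"
          by (simp add: power_add)
        then show ?thesis by (simp add: zz)
      qed
      show ?thesis unfolding \<open>s = (\<Sum>m<L. g (n + m) * z ^ (n + m))\<close> sum_distrib_left by (simp only: tm)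
    qed
    moreover have "(\<Sum>m<L. twist t n * (g (n + m) * exp (G N)) * z ^ m) = twist t n * exp (G N) * (\<Sum>m<L. g (n + m) * z ^ m)"
      unfolding sum_distrib_left by (intro sum.cong refl) (simp add: mult_ac)
    ultimately have "(\<Sum>m<L. twist t n * (g (n + m) * exp (G N)) * z ^ m) = twist t n * exp (G N) * cnj z ^ n * s"
      by (simp only: mult.assoc)
    then have "(\<Sum>m<L. twist t n * (g (n + m) * exp (G N)) * z ^ m) / of_nat L - twist t n * exp (G N) * c * cnj z ^ n
       = twist t n * exp (G N) * cnj z ^ n * ((s / of_nat L - cg) - (c - cg))"
      by (simp add: algebra_simps)
    also have "norm \<dots> = norm (exp (G N)) * norm ((s / of_nat L - cg) - (c - cg))"
      using n0 nz by (simp add: norm_mult norm_power norm_twist)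
    also have "\<dots> \<le> 1 * (e + e)"
      using norm_exp_G(1)[of N] order_trans[OF norm_triangle_ineq4 add_mono[OF s cgc]]
      by (intro mult_mono) auto
    finally have B: "norm ((\<Sum>m<L. twist t n * (g (n + m) * exp (G N)) * z ^ m) / of_nat L - twist t n * exp (G N) * c * cnj z ^ n) \<le> e + e" by simp
    show ?thesis using norm_triangle_le[OF add_mono[OF A B]] by simp
  qed
  have ev3: "\<forall>\<^sub>F N in sequentially. avg (\<lambda>n. of_bool (n > 0) * (b / real n)) N < e"
    using order_tendstoD(2)[OF avg_inverse_tendsto_0 e] .
  have ev4: "\<forall>\<^sub>F N in sequentially. real L * (1 + C) / real N < e"
    using order_tendstoD(2)[OF lim_const_over_n e] .
  have "\<forall>\<^sub>F N in sequentially. avg (\<lambda>n. norm (window z L n - twist t n * exp (G N) * c * cnj z ^ n)) N < \<eta>"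
    using ev1 ev3 ev4 eventually_gt_at_top[of 0]
  proof eventually_elim
    case (elim N)
    have "avg (\<lambda>n. norm (window z L n - twist t n * exp (G N) * c * cnj z ^ n)) N \<le>
      avg (\<lambda>n. (\<Sum>m<L. v N (n + m)) * (1 / real L) + of_bool (n > 0) * (b / real n) + e + e) N"
      using pw by (intro avg_mono) auto
    also have "\<dots> = (\<Sum>m<L. avg (\<lambda>n. v N (n + m)) N) * (1 / real L) + avg (\<lambda>n. of_bool (n > 0) * (b / real n)) N + e + e"
      unfolding avg_add avg_mult_right avg_sum using elim by (simp add: avg_const)
    finally have *: "avg (\<lambda>n. norm (window z L n - twist t n * exp (G N) * c * cnj z ^ n)) N \<le>
      (\<Sum>m<L. avg (\<lambda>n. v N (n + m)) N) * (1 / real L) + avg (\<lambda>n. of_bool (n > 0) * (b / real n)) N + e + e" .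
    \<comment> \<open>A shifted average exceeds the unshifted one by a boundary term at most, which
      is below \<open>e\<close> for large \<open>N\<close>.\<close>
    have "(\<Sum>m<L. avg (\<lambda>n. v N (n + m)) N) \<le> (\<Sum>m<L. 2 * e)"
    proof (intro sum_mono)
      fix m assume m: "m \<in> {..<L}"
      have "avg (\<lambda>n. v N (n + m)) N \<le> avg (v N) N + real m * (1 + C) / real N"
        by (rule avg_shift) (use v in auto)
      also have "real m * (1 + C) / real N \<le> real L * (1 + C) / real N"
        using m C by (intro divide_right_mono mult_right_mono) auto
      also have "avg (v N) N < e" using elim(1) unfolding v_def[abs_def] .
      finally show "avg (\<lambda>n. v N (n + m)) N \<le> 2 * e" using elim(3) by simp
    qed
    then have "(\<Sum>m<L. avg (\<lambda>n. v N (n + m)) N) * (1 / real L) \<le> (\<Sum>m<L. 2 * e) * (1 / real L)"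
      by (rule mult_right_mono) simp
    also have "\<dots> = 2 * e" using L0 by simp
    finally show ?case using * elim(2) e unfolding e_def by linarith
  qed
  then show ?thesis using L0 by blast
qed

text \<open>For \<open>N \<ge> k\<close> the number \<open>k * N\<close> lies between
  \<open>N\<close> and its square, where \<open>G_slow\<close> applies.\<close>

lemma slow_ratio:
  assumes "k > 0"
  shows "(\<lambda>N. exp (of_nat Q * (G (k * N) - G N))) \<longlonglongrightarrow> 1"
proof -
  have "(\<lambda>N. G (k * N) - G N) \<longlonglongrightarrow> 0"
  proof (rule LIMSEQ_I)
    fix r :: real assume "r > 0"
    then obtain N0 where N0: "\<And>N N'. N \<ge> N0 \<Longrightarrow> N \<le> N' \<Longrightarrow> N' \<le> N\<^sup>2 \<Longrightarrow> norm (G N' - G N) < r"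
      using G_slow by blast
    show "\<exists>no. \<forall>n\<ge>no. norm (G (k * n) - G n - 0) < r"
      using assms by (intro exI[of _ "max N0 k"]) (auto intro!: N0 simp: power2_eq_square)
  qed
  then have "(\<lambda>N. exp (of_nat Q * (G (k * N) - G N))) \<longlonglongrightarrow> exp (of_nat Q * 0)"
    by (intro tendsto_intros)
  then show ?thesis by simp
qed

text \<open>Because \<open>z ^ Q = 1\<close>, the \<open>Q\<close>-th power of the window
  approximation is free of \<open>cnj z ^ n\<close>, and the averages of \<open>window ^ Q\<close>
  come close to \<open>c ^ Q * X N\<close>. The hypothesis isolates what genericity supplies, so
  that no measures occur in this argument.\<close>

lemma convergence_criterion:
  assumes conv: "\<And>z L Q. norm z = 1 \<Longrightarrow> convergent (avg (\<lambda>n. (window z L n) ^ Q))"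
  shows "t = 0 \<and> convergent G"
proof -
  obtain Q z c where Q: "Q > 0" and z: "z ^ Q = 1" "norm z = 1" and c: "c \<noteq> 0"
    and lim: "(\<lambda>N. avg (\<lambda>n. f n * cnj (twist t n) * exp (- G N) * z ^ n) N) \<longlonglongrightarrow> c"
    using nonzero_coefficient by blast
  define \<tau> where "\<tau> = real Q * t"
  define K where "K = max 1 (norm c)"
  define X where "X N = exp (of_nat Q * G N) * avg (twist \<tau>) N" for N
  have "convergent X"
  proof (rule convergent_if_approx)
    fix e :: real assume e: "e > 0"
    \<comment> \<open>Compensates the Lipschitz constant \<open>Q * K ^ Q\<close> of the power map
      and the division by \<open>c ^ Q\<close>.\<close>
    define \<eta> where "\<eta> = e * norm (c ^ Q) / (real Q * K ^ Q)"
    have K: "K \<ge> 1" "norm c \<le> K" by (auto simp: K_def)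
    have eta: "\<eta> > 0" using e c Q K unfolding \<eta>_def by (intro divide_pos_pos mult_pos_pos) auto
    obtain L where L: "L > 0" and ev: "\<forall>\<^sub>F N in sequentially.
        avg (\<lambda>n. norm (window z L n - twist t n * exp (G N) * c * cnj z ^ n)) N < \<eta>"
      using window_approx[OF z(1) Q z(2) lim eta] by blast
    have wb: "norm (window z L n) \<le> 1" if "n > 0" for n
    proof -
      have "norm (\<Sum>m<L. f (n + m) * z ^ m) \<le> (\<Sum>m<L. 1)"
        using norm_f[of "n + _"] that z by (intro sum_norm_le) (auto simp: norm_mult norm_power)
      then show ?thesis using L by (simp add: window_def norm_divide)
    qed
    have "\<forall>\<^sub>F N in sequentially. norm (X N - avg (\<lambda>n. (window z L n) ^ Q) N / c ^ Q) < e"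
      using ev
    proof eventually_elim
      case (elim N)
      have pq: "(twist t n * exp (G N) * c * cnj z ^ n) ^ Q = c ^ Q * exp (of_nat Q * G N) * twist \<tau> n"
        if "n > 0" for n
      proof -
        have "(cnj z ^ n) ^ Q = cnj ((z ^ Q) ^ n)" by (simp add: mult.commute flip: power_mult)
        also have "\<dots> = 1" using z by simp
        finally have 1: "(cnj z ^ n) ^ Q = 1" .
        have 2: "twist t n ^ Q = twist \<tau> n"
          using that by (simp add: twist_eq_cis \<tau>_def Complex.DeMoivre mult_ac)
        show ?thesis unfolding power_mult_distrib 1 2 exp_of_nat_mult by simp
      qed
      have "norm (avg (\<lambda>n. (window z L n) ^ Q) N - avg (\<lambda>n. c ^ Q * exp (of_nat Q * G N) * twist \<tau> n) N)
         \<le> avg (\<lambda>n. norm ((window z L n) ^ Q - c ^ Q * exp (of_nat Q * G N) * twist \<tau> n)) N"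
        unfolding avg_diff[symmetric] by (rule norm_avg_le)
      also have "\<dots> \<le> avg (\<lambda>n. real Q * K ^ Q * norm (window z L n - twist t n * exp (G N) * c * cnj z ^ n)) N"
      proof (rule avg_mono)
        fix n :: nat assume n: "1 \<le> n"
        have "norm (exp (G N)) * norm c \<le> 1 * K" using norm_exp_G(1)[of N] K by (intro mult_mono) auto
        then have "norm (twist t n * exp (G N) * c * cnj z ^ n) \<le> K"
          using n z by (simp add: norm_mult norm_power norm_twist)
        then have "norm ((window z L n) ^ Q - (twist t n * exp (G N) * c * cnj z ^ n) ^ Q)
          \<le> real Q * K ^ Q * norm (window z L n - twist t n * exp (G N) * c * cnj z ^ n)"
          using wb[of n] n K by (intro norm_power_diff_le) auto
        then show "norm ((window z L n) ^ Q - c ^ Q * exp (of_nat Q * G N) * twist \<tau> n)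
          \<le> real Q * K ^ Q * norm (window z L n - twist t n * exp (G N) * c * cnj z ^ n)"
          using pq[of n] n by simp
      qed
      also have "\<dots> < real Q * K ^ Q * \<eta>"
        unfolding avg_mult_left using elim Q K by (intro mult_strict_left_mono) auto
      also have "\<dots> = e * norm (c ^ Q)" using Q K by (simp add: \<eta>_def)
      finally have *: "norm (avg (\<lambda>n. (window z L n) ^ Q) N - c ^ Q * X N) < e * norm (c ^ Q)"
        unfolding avg_mult_left X_def by (simp add: mult.assoc)
      have "X N - avg (\<lambda>n. (window z L n) ^ Q) N / c ^ Q = - (avg (\<lambda>n. (window z L n) ^ Q) N - c ^ Q * X N) / c ^ Q"
        using c by (simp add: field_simps)
      then have "norm (X N - avg (\<lambda>n. (window z L n) ^ Q) N / c ^ Q) =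
          norm (avg (\<lambda>n. (window z L n) ^ Q) N - c ^ Q * X N) / norm (c ^ Q)"
        by (simp only: norm_divide norm_minus_cancel)
      also have "\<dots> < e" using * c by (simp add: divide_less_eq)
      finally show ?case .
    qed
    moreover have "convergent (\<lambda>N. avg (\<lambda>n. (window z L n) ^ Q) N / c ^ Q)"
    proof -
      obtain l where "avg (\<lambda>n. (window z L n) ^ Q) \<longlonglongrightarrow> l" using conv[OF z(2)] convergent_def by blast
      then have "(\<lambda>N. avg (\<lambda>n. (window z L n) ^ Q) N / c ^ Q) \<longlonglongrightarrow> l / c ^ Q"
        using c by (intro tendsto_intros) auto
      then show ?thesis by (rule convergentI)
    qed
    ultimately show "\<exists>Y. convergent Y \<and> (\<forall>\<^sub>F N in sequentially. norm (X N - Y N) < e)" by blast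
  qed
  then obtain x where x: "X \<longlonglongrightarrow> x" by (auto simp: convergent_def)
  \<comment> \<open>\<open>avg_twist\<close> trades the mean in \<open>X\<close> for its last term.
    The modulus of \<open>B\<close> is explicit and bounded away from 0.\<close>
  define B where "B N = exp (of_nat Q * G N) * twist \<tau> N" for N
  define b where "b = (1 + \<i> * of_real \<tau>) * x"
  have eQ: "norm (exp (of_nat Q * G N)) \<le> 1" "norm (exp (of_nat Q * G N)) \<ge> exp (- real Q * Dist)" for N
    using Re_G_bounds[of N] mult_left_mono[of "- Dist" "Re (G N)" "real Q"] by (auto simp: mult_nonneg_nonpos)
  have Blim: "B \<longlonglongrightarrow> b"
  proof -
    have "(\<lambda>N. exp (of_nat Q * G N) * ((1 + \<i> * of_real \<tau>) * avg (twist \<tau>) N - twist \<tau> N)) \<longlonglongrightarrow> 0"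
    proof (rule Lim_null_comparison)
      show "(\<lambda>N. norm ((1 + \<i> * of_real \<tau>) * avg (twist \<tau>) N - twist \<tau> N)) \<longlonglongrightarrow> 0"
        using tendsto_norm[OF avg_twist] by simp
      show "\<forall>\<^sub>F N in sequentially. norm (exp (of_nat Q * G N) * ((1 + \<i> * of_real \<tau>) * avg (twist \<tau>) N - twist \<tau> N))
         \<le> norm ((1 + \<i> * of_real \<tau>) * avg (twist \<tau>) N - twist \<tau> N)"
        unfolding norm_mult[of "exp _"] using eQ(1) by (intro always_eventually allI mult_left_le_one_le) auto
    qed
    then have "(\<lambda>N. (1 + \<i> * of_real \<tau>) * X N - exp (of_nat Q * G N) * ((1 + \<i> * of_real \<tau>) * avg (twist \<tau>) N - twist \<tau> N)) \<longlonglongrightarrow> (1 + \<i> * of_real \<tau>) * x - 0"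
      by (intro tendsto_intros x)
    then show ?thesis unfolding B_def[abs_def] b_def X_def by (simp add: algebra_simps)
  qed
  have b0: "b \<noteq> 0"
  proof
    assume "b = 0"
    then have "(\<lambda>N. norm (B N)) \<longlonglongrightarrow> 0" using tendsto_norm[OF Blim] by simp
    moreover have "\<forall>\<^sub>F N in sequentially. exp (- real Q * Dist) \<le> norm (B N)"
      using eventually_gt_at_top[of 0]
      by eventually_elim (use eQ(2) in \<open>simp add: B_def norm_mult norm_twist\<close>)
    ultimately have "exp (- real Q * Dist) \<le> 0" by (intro tendsto_lowerbound) auto
    then show False by simp
  qed
  have "twist \<tau> k = 1" if k: "k > 0" for k
  proof -
    have sub: "(\<lambda>N. B (k * N)) \<longlonglongrightarrow> b"
      using LIMSEQ_subseq_LIMSEQ[OF Blim, of "\<lambda>N. k * N"] k by (auto simp: strict_mono_def comp_def)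
    \<comment> \<open>Passing from \<open>N\<close> to \<open>k * N\<close> multiplies
      \<open>B\<close> by nearly \<open>twist \<tau> k\<close>, yet both sequences have the nonzero
      limit \<open>b\<close>.\<close>
    have "(\<lambda>N. exp (of_nat Q * (G (k * N) - G N)) * twist \<tau> k * B N) \<longlonglongrightarrow> 1 * twist \<tau> k * b"
      by (intro tendsto_intros slow_ratio k Blim)
    moreover have "\<forall>\<^sub>F N in sequentially. exp (of_nat Q * (G (k * N) - G N)) * twist \<tau> k * B N = B (k * N)"
      using eventually_gt_at_top[of 0]
    proof eventually_elim
      case (elim N)
      have ex: "exp (of_nat Q * G (k * N)) = exp (of_nat Q * (G (k * N) - G N)) * exp (of_nat Q * G N)"
        by (simp add: algebra_simps flip: exp_add)
      show ?case unfolding B_def twist_mult[OF k elim] ex by (simp only: mult_ac)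
    qed
    ultimately have "(\<lambda>N. B (k * N)) \<longlonglongrightarrow> 1 * twist \<tau> k * b" by (rule Lim_transform_eventually)
    then have "b = 1 * twist \<tau> k * b" using sub LIMSEQ_unique by blast
    then show ?thesis using b0 by simp
  qed
  then have "\<tau> = 0" by (rule twist_eq_1D)
  then have t0: "t = 0" using Q by (simp add: \<tau>_def)
  have "(\<lambda>N. exp (of_nat Q * G N)) \<longlonglongrightarrow> b"
    using Blim eventually_gt_at_top[of 0]
    by (rule Lim_transform_eventually[OF _ eventually_mono]) (simp add: B_def \<open>\<tau> = 0\<close> twist_0)
  moreover have "(\<lambda>N. of_nat Q * G (Suc N) - of_nat Q * G N) \<longlonglongrightarrow> 0"
  proof -
    have "(\<lambda>N. G (Suc N) - G N) \<longlonglongrightarrow> 0"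
    proof (rule LIMSEQ_I)
      fix r :: real assume "r > 0"
      then obtain N0 where N0: "\<And>N N'. N \<ge> N0 \<Longrightarrow> N \<le> N' \<Longrightarrow> N' \<le> N\<^sup>2 \<Longrightarrow> norm (G N' - G N) < r"
        using G_slow by blast
      have sq: "Suc n \<le> n\<^sup>2" if "n \<ge> 2" for n
        unfolding power2_eq_square using that mult_le_mono1[OF that, of n] by linarith
      show "\<exists>no. \<forall>n\<ge>no. norm (G (Suc n) - G n - 0) < r"
        by (intro exI[of _ "max N0 2"]) (auto intro!: N0 sq)
    qed
    then have "(\<lambda>N. of_nat Q * (G (Suc N) - G N)) \<longlonglongrightarrow> of_nat Q * 0" by (intro tendsto_intros)
    then show ?thesis by (simp add: algebra_simps)
  qed
  ultimately have "convergent (\<lambda>N. of_nat Q * G N)" by (rule convergent_if_exp_convergent[OF _ b0])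
  then obtain l where "(\<lambda>N. of_nat Q * G N) \<longlonglongrightarrow> l" by (auto simp: convergent_def)
  then have "(\<lambda>N. of_nat Q * G N / of_nat Q) \<longlonglongrightarrow> l / of_nat Q" using Q by (intro tendsto_intros) auto
  then have "convergent G" using Q by (auto simp: convergent_def)
  with t0 show ?thesis by simp
qed

lemma RAP_if_convergent:
  assumes t: "t = 0" and G: "convergent G"
  shows "RAP f"
  unfolding RAP_iff
proof (intro allI impI)
  fix \<epsilon> :: real assume e: "\<epsilon> > 0"
  from asymptotically_RAP[of "\<epsilon> / 2"] e obtain g where g: "periodic_seq g" "\<And>n. norm (g n) \<le> exp Dist"
    and ev: "\<forall>\<^sub>F N in sequentially. avg (\<lambda>n. norm (f n * cnj (twist t n) - g n * exp (G N))) N < \<epsilon> / 2"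
    by auto
  obtain l where l: "G \<longlonglongrightarrow> l" using G by (auto simp: convergent_def)
  have "(\<lambda>N. exp Dist * norm (exp (G N) - exp l)) \<longlonglongrightarrow> exp Dist * norm (exp l - exp l)"
    by (intro tendsto_intros l)
  then have ev2: "\<forall>\<^sub>F N in sequentially. exp Dist * norm (exp (G N) - exp l) < \<epsilon> / 2"
    by (rule order_tendstoD(2)) (use e in simp)
  have "\<forall>\<^sub>F N in sequentially. avg (\<lambda>n. norm (f n - g n * exp l)) N < \<epsilon>"
    using ev ev2
  proof eventually_elim
    case (elim N)
    have "avg (\<lambda>n. norm (f n - g n * exp l)) N \<le>
        avg (\<lambda>n. norm (f n * cnj (twist t n) - g n * exp (G N)) + exp Dist * norm (exp (G N) - exp l)) N"
    proof (rule avg_mono)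
      fix n :: nat assume "1 \<le> n"
      then have "f n - g n * exp l = (f n * cnj (twist t n) - g n * exp (G N)) + g n * (exp (G N) - exp l)"
        by (simp add: t twist_0 algebra_simps)
      also have "norm \<dots> \<le> norm (f n * cnj (twist t n) - g n * exp (G N)) + norm (g n) * norm (exp (G N) - exp l)"
        by (rule order_trans[OF norm_triangle_ineq]) (simp add: norm_mult)
      also have "norm (g n) * norm (exp (G N) - exp l) \<le> exp Dist * norm (exp (G N) - exp l)"
        by (intro mult_right_mono g) auto
      finally show "norm (f n - g n * exp l) \<le>
          norm (f n * cnj (twist t n) - g n * exp (G N)) + exp Dist * norm (exp (G N) - exp l)" by simp
    qed
    also have "\<dots> \<le> avg (\<lambda>n. norm (f n * cnj (twist t n) - g n * exp (G N))) N + exp Dist * norm (exp (G N) - exp l)"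
      unfolding avg_add by (intro add_left_mono avg_le_bound) auto
    finally show ?case using elim by linarith
  qed
  moreover have "periodic_seq (\<lambda>n. g n * exp l)" using g(1) by (auto simp: periodic_seq_def)
  ultimately show "\<exists>g. periodic_seq g \<and> (\<forall>\<^sub>F N in sequentially. avg (\<lambda>n. norm (f n - g n)) N < \<epsilon>)" by blast
qed

end

section \<open>Averages of rationally almost periodic sequences along residue classes\<close>

text \<open>Each unit shift changes the sum by two boundary terms, which vanish after division by
  \<open>N\<close>.\<close>

lemma avg_shift_tendsto:
  fixes v :: "nat \<Rightarrow> 'a::real_normed_vector"
  assumes lim: "avg v \<longlonglongrightarrow> l" and b: "\<And>n. n > 0 \<Longrightarrow> norm (v n) \<le> 1"
  shows "avg (\<lambda>n. v (n + s)) \<longlonglongrightarrow> l"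
proof (induction s)
  case (Suc s)
  have "(\<lambda>N. (v (N + 1 + s) - v (1 + s)) /\<^sub>R real N) \<longlonglongrightarrow> 0"
  proof (rule Lim_null_comparison)
    show "\<forall>\<^sub>F N in sequentially. norm ((v (N + 1 + s) - v (1 + s)) /\<^sub>R real N) \<le> 2 / real N"
    proof (intro always_eventually allI)
      fix N
      have "norm (v (N + 1 + s) - v (1 + s)) \<le> 1 + 1"
        by (rule order_trans[OF norm_triangle_ineq4]) (intro add_mono b, auto)
      then have "norm (v (N + 1 + s) - v (1 + s)) / real N \<le> 2 / real N"
        by (intro divide_right_mono) auto
      then show "norm ((v (N + 1 + s) - v (1 + s)) /\<^sub>R real N) \<le> 2 / real N"
        by (simp add: divide_inverse mult.commute)
    qed
    show "(\<lambda>N. 2 / real N) \<longlonglongrightarrow> 0" by (rule lim_const_over_n)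
  qed
  from tendsto_add[OF Suc this] have "(\<lambda>N. avg (\<lambda>n. v (n + s)) N + (v (N + 1 + s) - v (1 + s)) /\<^sub>R real N) \<longlonglongrightarrow> l" by simp
  moreover have "avg (\<lambda>n. v (n + s)) N + (v (N + 1 + s) - v (1 + s)) /\<^sub>R real N = avg (\<lambda>n. v (n + Suc s)) N" for N
  proof -
    have "(\<Sum>n\<in>{1..N}. v (n + Suc s)) + v (1 + s) = (\<Sum>n\<in>{1..N}. v (n + s)) + v (N + 1 + s)"
      by (induction N) (auto simp: algebra_simps)
    then have "(\<Sum>n\<in>{1..N}. v (n + Suc s)) = (\<Sum>n\<in>{1..N}. v (n + s)) + (v (N + 1 + s) - v (1 + s))"
      by (simp add: algebra_simps)
    then show ?thesis unfolding avg_def scaleR_add_right[symmetric] by simp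
  qed
  ultimately show ?case by simp
qed (use lim in simp)

text \<open>The index \<open>k\<close> starts at 1 to match \<open>avg\<close>, so the union of the
  classes starts at \<open>d\<close> instead of 0.\<close>

lemma sum_residue_classes:
  fixes v :: "nat \<Rightarrow> 'a::comm_monoid_add"
  shows "(\<Sum>i<d. \<Sum>k\<in>{1..K}. v (i + k * d)) = (\<Sum>n\<in>{d..<d + K * d}. v n)"
proof (induction K)
  case (Suc K)
  have "(\<Sum>i<d. v (i + Suc K * d)) = (\<Sum>n\<in>{d + K * d..<d + K * d + d}. v n)"
    using sum.shift_bounds_nat_ivl[of v 0 "d + K * d" d] by (simp add: atLeast0LessThan algebra_simps)
  moreover have "(\<Sum>n\<in>{d..<d + Suc K * d}. v n) =
      (\<Sum>n\<in>{d..<d + K * d}. v n) + (\<Sum>n\<in>{d + K * d..<d + K * d + d}. v n)"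
    by (subst sum.atLeastLessThan_concat) (auto simp: algebra_simps)
  moreover have "(\<Sum>i<d. \<Sum>k\<in>{1..Suc K}. v (i + k * d)) =
      (\<Sum>i<d. \<Sum>k\<in>{1..K}. v (i + k * d)) + (\<Sum>i<d. v (i + Suc K * d))"
    by (simp add: sum.distrib)
  ultimately show ?case using Suc by simp
qed simp

text \<open>The terms of one class are some of the terms of the interval up to
  \<open>b + J * m\<close>. The loss depends on \<open>b\<close> and \<open>m\<close> but not on
  \<open>J\<close>, so approximation in mean passes to classes.\<close>

lemma avg_class_le:
  fixes u :: "nat \<Rightarrow> real"
  assumes u: "\<And>n. u n \<ge> 0" and m: "m > 0" and J: "J > 0"
  shows "avg (\<lambda>j. u (b + j * m)) J \<le> real (b + m) * avg u (b + J * m)"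
proof -
  have "(\<Sum>j\<in>{1..J}. u (b + j * m)) = (\<Sum>n\<in>(\<lambda>j. b + j * m) ` {1..J}. u n)"
    using m by (subst sum.reindex) (auto simp: inj_on_def)
  also have "\<dots> \<le> (\<Sum>n\<in>{1..b + J * m}. u n)"
    using m u by (intro sum_mono2) (auto simp: Suc_le_eq)
  also have "\<dots> = real (b + J * m) * avg u (b + J * m)"
  proof -
    have "b + J * m > 0" using J m by simp
    then show ?thesis by (simp add: avg_real del: of_nat_add of_nat_mult)
  qed
  finally have "avg (\<lambda>j. u (b + j * m)) J \<le> real (b + J * m) * avg u (b + J * m) / real J"
    unfolding avg_real[of _ J] by (rule divide_right_mono) simp
  also have "\<dots> = real (b + J * m) / real J * avg u (b + J * m)" by simp
  also have "\<dots> \<le> real (b + m) * avg u (b + J * m)"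
  proof (intro mult_right_mono avg_nonneg u)
    have "real b \<le> real b * real J" using J mult_left_mono[of 1 "real J" "real b"] by simp
    then show "real (b + J * m) / real J \<le> real (b + m)" using J by (simp add: field_simps)
  qed
  finally show ?thesis .
qed

text \<open>The average starts at \<open>j = 1\<close>, so for \<open>m > 0\<close> the
  unconstrained value \<open>f 0\<close> never enters.\<close>

definition class_mean :: "(nat \<Rightarrow> complex) \<Rightarrow> nat \<Rightarrow> nat \<Rightarrow> complex" where
  "class_mean f m b = lim (avg (\<lambda>j. f (b + j * m)))"

locale bounded_RAP =
  fixes f :: "nat \<Rightarrow> complex"
  assumes f_bound: "\<And>n. n > 0 \<Longrightarrow> norm (f n) \<le> 1" and f_RAP: "RAP f"
begin

text \<open>Averages of a periodic approximant along the class converge, and by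
  \<open>avg_class_le\<close> the approximation survives the restriction to the class.\<close>

lemma class_mean_tendsto:
  assumes m: "m > 0"
  shows "avg (\<lambda>j. f (b + j * m)) \<longlonglongrightarrow> class_mean f m b"
proof -
  have "convergent (avg (\<lambda>j. f (b + j * m)))"
  proof (rule convergent_if_approx)
    fix e :: real assume e: "e > 0"
    define e' where "e' = e / real (b + m)"
    have e': "e' > 0" using e m by (simp add: e'_def)
    obtain g where g: "periodic_seq g" and ev: "\<forall>\<^sub>F N in sequentially. avg (\<lambda>n. norm (f n - g n)) N < e'"
      using f_RAP e' unfolding RAP_iff by blast
    obtain Q where Q: "Q > 0" "\<And>n. g (n + Q) = g n" using g by (auto simp: periodic_seq_def)
    have "convergent (avg (\<lambda>j. g (b + j * m)))"
    proof (rule convergentI, rule avg_periodic_tendsto)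
      show "g (b + (n + Q) * m) = g (b + n * m)" for n
        using periodic_add_mult[of g Q "b + n * m" m] Q by (simp add: algebra_simps)
    qed (rule Q)
    moreover have "\<forall>\<^sub>F J in sequentially. norm (avg (\<lambda>j. f (b + j * m)) J - avg (\<lambda>j. g (b + j * m)) J) < e"
    proof -
      obtain n0 where n0: "\<And>N. N \<ge> n0 \<Longrightarrow> avg (\<lambda>n. norm (f n - g n)) N < e'"
        using ev unfolding eventually_sequentially by blast
      show ?thesis
      proof (rule eventually_sequentiallyI[of "max 1 n0"])
        fix J assume J: "max 1 n0 \<le> J"
        have "J * 1 \<le> J * m" using m by (intro mult_le_mono2) simp
        then have N: "b + J * m \<ge> n0" using J by linarith
        have "norm (avg (\<lambda>j. f (b + j * m)) J - avg (\<lambda>j. g (b + j * m)) J)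
           \<le> avg (\<lambda>j. norm (f (b + j * m) - g (b + j * m))) J"
          unfolding avg_diff[symmetric] by (rule norm_avg_le)
        also have "\<dots> \<le> real (b + m) * avg (\<lambda>n. norm (f n - g n)) (b + J * m)"
          by (rule avg_class_le) (use m J in auto)
        also have "\<dots> < real (b + m) * e'" using n0[OF N] m by (intro mult_strict_left_mono) auto
        also have "\<dots> = e" using m by (simp add: e'_def)
        finally show "norm (avg (\<lambda>j. f (b + j * m)) J - avg (\<lambda>j. g (b + j * m)) J) < e" .
      qed
    qed
    ultimately show "\<exists>Y. convergent Y \<and> (\<forall>\<^sub>F N in sequentially. norm (avg (\<lambda>j. f (b + j * m)) N - Y N) < e)"
      by blast
  qed
  then show ?thesis unfolding class_mean_def by (simp add: convergent_LIMSEQ_iff)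
qed

lemma class_mean_bound:
  assumes m: "m > 0"
  shows "norm (class_mean f m b) \<le> 1"
proof (rule tendsto_upperbound[OF tendsto_norm[OF class_mean_tendsto[OF m]]])
  show "\<forall>\<^sub>F J in sequentially. norm (avg (\<lambda>j. f (b + j * m)) J) \<le> 1"
  proof (intro always_eventually allI)
    fix J
    have "norm (avg (\<lambda>j. f (b + j * m)) J) \<le> avg (\<lambda>j. norm (f (b + j * m))) J" by (rule norm_avg_le)
    also have "\<dots> \<le> 1" using m by (intro avg_le_bound f_bound) auto
    finally show "norm (avg (\<lambda>j. f (b + j * m)) J) \<le> 1" .
  qed
qed simp

lemma class_mean_periodic:
  assumes m: "m > 0"
  shows "class_mean f m (b + m) = class_mean f m b"
proof -
  have "avg (\<lambda>j. f (b + (j + 1) * m)) \<longlonglongrightarrow> class_mean f m b"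
    by (rule avg_shift_tendsto[of "\<lambda>j. f (b + j * m)", OF class_mean_tendsto[OF m]]) (use f_bound m in auto)
  moreover have "avg (\<lambda>j. f (b + (j + 1) * m)) \<longlonglongrightarrow> class_mean f m (b + m)"
    using class_mean_tendsto[OF m, of "b + m"] by (simp add: algebra_simps)
  ultimately show ?thesis using LIMSEQ_unique by blast
qed

text \<open>A class modulo \<open>m\<close> is the disjoint union of \<open>d\<close> classes modulo
  \<open>d * m\<close>, all of the same density.\<close>

lemma class_mean_average:
  assumes m: "m > 0" and d: "d > 0"
  shows "class_mean f m b = (\<Sum>i<d. class_mean f (d * m) (b + i * m)) / of_nat d"
proof -
  define v where "v j = f (b + j * m)" for j
  \<comment> \<open>The shift by \<open>d - 1\<close> makes the summation start at \<open>d\<close>,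
    where \<open>sum_residue_classes\<close> begins.\<close>
  have "avg (\<lambda>j. v (j + (d - 1))) \<longlonglongrightarrow> class_mean f m b"
    unfolding v_def
    by (rule avg_shift_tendsto[of "\<lambda>j. f (b + j * m)", OF class_mean_tendsto[OF m]]) (use f_bound m in auto)
  then have "(\<lambda>K. avg (\<lambda>j. v (j + (d - 1))) (d * K)) \<longlonglongrightarrow> class_mean f m b"
    using LIMSEQ_subseq_LIMSEQ[of _ _ "\<lambda>K. d * K"] d by (fastforce simp: strict_mono_def comp_def)
  moreover have "\<forall>\<^sub>F K in sequentially. avg (\<lambda>j. v (j + (d - 1))) (d * K) =
      (\<Sum>i<d. avg (\<lambda>k. f ((b + i * m) + k * (d * m))) K) / of_nat d"
    using eventually_gt_at_top[of 0]
  proof eventually_elim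
    case (elim K)
    have "(\<Sum>j\<in>{1..d * K}. v (j + (d - 1))) = (\<Sum>n\<in>{1 + (d - 1)..d * K + (d - 1)}. v n)"
      by (rule sum.shift_bounds_cl_nat_ivl[symmetric])
    also have "{1 + (d - 1)..d * K + (d - 1)} = {d..<d + K * d}" using d by (auto simp: mult.commute[of K d])
    also have "(\<Sum>n\<in>{d..<d + K * d}. v n) = (\<Sum>i<d. \<Sum>k\<in>{1..K}. v (i + k * d))"
      by (rule sum_residue_classes[symmetric])
    also have "\<dots> = (\<Sum>i<d. \<Sum>k\<in>{1..K}. f ((b + i * m) + k * (d * m)))"
      by (simp add: v_def algebra_simps)
    finally show ?case using elim d
      by (simp add: avg_complex sum_divide_distrib[symmetric])
  qed
  ultimately have "(\<lambda>K. (\<Sum>i<d. avg (\<lambda>k. f ((b + i * m) + k * (d * m))) K) / of_nat d) \<longlonglongrightarrow> class_mean f m b"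
    by (rule Lim_transform_eventually)
  moreover have "(\<lambda>K. (\<Sum>i<d. avg (\<lambda>k. f ((b + i * m) + k * (d * m))) K) / of_nat d)
      \<longlonglongrightarrow> (\<Sum>i<d. class_mean f (d * m) (b + i * m)) / of_nat d"
    using m d by (intro tendsto_intros class_mean_tendsto) auto
  ultimately show ?thesis using LIMSEQ_unique by blast
qed

text \<open>Averaging over classes fixes \<open>g\<close> and does not increase errors in mean, so
  the class means are almost as good as \<open>g\<close>. The crude count
  \<open>m + J * m \<le> 2 * J * m\<close> gives \<open>2 * e\<close> between them and
  \<open>g\<close>; the rest of the 4 is the distance from \<open>f\<close> to \<open>g\<close> and
  a margin for passing to the limit.\<close>

lemma class_mean_approx:
  assumes m: "m > 0" and g: "\<And>n. g (n + m) = g n" and e: "e > 0"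
    and ev: "\<forall>\<^sub>F N in sequentially. avg (\<lambda>n. norm (f n - g n)) N < e"
  shows "\<forall>\<^sub>F N in sequentially. avg (\<lambda>n. norm (f n - class_mean f m n)) N < 4 * e"
proof -
  let ?A = "class_mean f m"
  obtain n0 where n0: "\<And>N. N \<ge> n0 \<Longrightarrow> avg (\<lambda>n. norm (f n - g n)) N < e"
    using ev unfolding eventually_sequentially by blast
  have "(\<Sum>b<m. norm (?A b - g b)) \<le> 2 * real m * e"
  proof (rule tendsto_upperbound)
    show "(\<lambda>J. \<Sum>b<m. norm (avg (\<lambda>j. f (b + j * m)) J - g b)) \<longlonglongrightarrow> (\<Sum>b<m. norm (?A b - g b))"
      by (intro tendsto_intros class_mean_tendsto m)
    show "\<forall>\<^sub>F J in sequentially. (\<Sum>b<m. norm (avg (\<lambda>j. f (b + j * m)) J - g b)) \<le> 2 * real m * e"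
    proof (rule eventually_sequentiallyI[of "max 1 n0"])
      fix J assume J: "max 1 n0 \<le> J"
      define N where "N = m + J * m"
      have "J * 1 \<le> J * m" using m by (intro mult_le_mono2) simp
      then have N: "N \<ge> n0" "N > 0" unfolding N_def using J m by linarith+
      have "(\<Sum>b<m. norm (avg (\<lambda>j. f (b + j * m)) J - g b)) \<le> (\<Sum>b<m. avg (\<lambda>j. norm (f (b + j * m) - g (b + j * m))) J)"
      proof (intro sum_mono)
        fix b
        have "avg (\<lambda>j. f (b + j * m)) J - g b = avg (\<lambda>j. f (b + j * m) - g (b + j * m)) J"
          using J periodic_add_mult[of g m b, OF g] by (simp add: avg_diff avg_const)
        then show "norm (avg (\<lambda>j. f (b + j * m)) J - g b) \<le> avg (\<lambda>j. norm (f (b + j * m) - g (b + j * m))) J"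
          by (simp add: norm_avg_le)
      qed
      also have "\<dots> = (\<Sum>n\<in>{m..<m + J * m}. norm (f n - g n)) / real J"
        unfolding avg_real sum_divide_distrib[symmetric]
        by (simp only: sum_residue_classes[where v = "\<lambda>n. norm (f n - g n)" and d = m and K = J])
      also have "\<dots> \<le> (\<Sum>n\<in>{1..N}. norm (f n - g n)) / real J"
        using m by (intro divide_right_mono sum_mono2) (auto simp: N_def)
      also have "\<dots> = real N / real J * avg (\<lambda>n. norm (f n - g n)) N"
        using N by (simp add: avg_real)
      also have "\<dots> \<le> (2 * real m) * e"
      proof (intro mult_mono)
        have "m + J * m \<le> J * m + J * m" using J by simp
        also have "\<dots> = 2 * m * J" by simp
        finally have "real N \<le> real (2 * m * J)" unfolding N_def by (rule of_nat_mono)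
        then have "real N \<le> 2 * real m * real J" by simp
        then show "real N / real J \<le> 2 * real m" using J by (simp add: divide_le_eq)
      qed (use n0[OF N(1)] in \<open>auto intro: avg_nonneg\<close>)
      finally show "(\<Sum>b<m. norm (avg (\<lambda>j. f (b + j * m)) J - g b)) \<le> 2 * real m * e" .
    qed
  qed simp
  then have mean: "(\<Sum>b<m. norm (?A b - g b)) /\<^sub>R real m \<le> 2 * e" using m by (simp add: field_simps)
  have "avg (\<lambda>n. norm (?A n - g n)) \<longlonglongrightarrow> (\<Sum>b<m. norm (?A b - g b)) /\<^sub>R real m"
    by (rule avg_periodic_tendsto[OF _ m]) (simp add: g class_mean_periodic[OF m])
  then have "\<forall>\<^sub>F N in sequentially. avg (\<lambda>n. norm (?A n - g n)) N < 3 * e"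
    by (rule order_tendstoD(2)) (use mean e in linarith)
  with ev show ?thesis
  proof eventually_elim
    case (elim N)
    have "avg (\<lambda>n. norm (f n - ?A n)) N \<le> avg (\<lambda>n. norm (f n - g n) + norm (?A n - g n)) N"
    proof (rule avg_mono)
      fix n
      show "norm (f n - ?A n) \<le> norm (f n - g n) + norm (?A n - g n)"
        using norm_triangle_ineq4[of "f n - g n" "?A n - g n"] by simp
    qed
    then show ?case using elim unfolding avg_add by linarith
  qed
qed

section \<open>Minimal periods and the coding of a RAP sequence\<close>

definition min_period :: "nat \<Rightarrow> nat" where
  "min_period m = (LEAST p. p > 0 \<and> (\<forall>b. class_mean f m (b + p) = class_mean f m b))"

text \<open>Divisibility is Euclidean division: the remainder of a period modulo the least one is
  again a period, and a smaller one.\<close>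

lemma min_period:
  assumes m: "m > 0"
  shows "min_period m > 0" "class_mean f m (b + min_period m) = class_mean f m b"
    and "(\<And>b. class_mean f m (b + s) = class_mean f m b) \<Longrightarrow> min_period m dvd s"
proof -
  have "min_period m > 0 \<and> (\<forall>b. class_mean f m (b + min_period m) = class_mean f m b)"
    unfolding min_period_def by (rule LeastI[of _ m]) (use m class_mean_periodic in auto)
  then show pos: "min_period m > 0" and per: "class_mean f m (b + min_period m) = class_mean f m b" for b by auto
  assume s: "\<And>b. class_mean f m (b + s) = class_mean f m b"
  define r where "r = s mod min_period m"
  have "class_mean f m (b + r) = class_mean f m b" for b
  proof -
    have "class_mean f m (b + r) = class_mean f m (b + r + (s div min_period m) * min_period m)"
      by (rule periodic_add_mult[of "class_mean f m" "min_period m", OF per, symmetric])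
    also have "b + r + (s div min_period m) * min_period m = b + s" by (simp add: r_def add.assoc mod_div_mult_eq)
    finally show ?thesis using s by simp
  qed
  moreover have "r < min_period m" using pos by (simp add: r_def)
  moreover have "min_period m \<le> r" if "r \<noteq> 0"
    unfolding min_period_def by (rule Least_le) (use that calculation(1) in simp)
  ultimately have "r = 0" by linarith
  then show "min_period m dvd s" by (simp add: r_def dvd_eq_mod_eq_0)
qed

lemma min_period_dvd: "m > 0 \<Longrightarrow> min_period m dvd m"
  by (rule min_period(3)) (auto simp: class_mean_periodic)

text \<open>The means modulo \<open>m\<close> do not change along a class modulo their minimal
  period, so averaging them over such a class changes nothing. Hence the modulus can be replaced by
  the minimal period.\<close>

lemma class_mean_min_period:
  assumes m: "m > 0"
  shows "class_mean f (min_period m) b = class_mean f m b"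
proof -
  obtain d where d: "m = d * min_period m" using min_period_dvd[OF m] by (auto simp: mult.commute)
  have "d > 0" using d m by (auto intro!: gr0I)
  have "class_mean f (min_period m) b = (\<Sum>i<d. class_mean f (d * min_period m) (b + i * min_period m)) / of_nat d"
    by (rule class_mean_average[OF min_period(1)[OF m] \<open>d > 0\<close>])
  also have "\<dots> = (\<Sum>i<d. class_mean f m b) / of_nat d"
    using periodic_add_mult[of "class_mean f m" "min_period m" b, OF min_period(2)[OF m]] d[symmetric] by simp
  finally show ?thesis using \<open>d > 0\<close> by simp
qed

text \<open>The means modulo \<open>m\<close> are averages of translates of the means modulo
  \<open>m'\<close>, so they inherit every period of the latter.\<close>

lemma min_period_mono:
  assumes m: "m > 0" "m' > 0" and dvd: "m dvd m'"
  shows "min_period m dvd min_period m'"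
proof (rule min_period(3)[OF m(1)])
  fix b
  obtain d where d: "m' = d * m" using dvd by (metis dvd_def mult.commute)
  then have d0: "d > 0" using m by (auto intro!: gr0I)
  have "class_mean f m' (b + min_period m' + i * m) = class_mean f m' (b + i * m)" for i
    using min_period(2)[OF m(2), of "b + i * m"] by (simp add: algebra_simps)
  then show "class_mean f m (b + min_period m') = class_mean f m b"
    unfolding class_mean_average[OF m(1) d0] d[symmetric] by simp
qed

end

text \<open>Minimality of the periods makes the odometer with moduli \<open>M\<close> isomorphic to the Furstenberg system
  and not merely an extension of it.\<close>

locale odometer_coding =
  fixes M :: "nat \<Rightarrow> nat" and a :: "nat \<Rightarrow> int \<Rightarrow> complex"
  assumes moduli: "odometer_moduli M"
    and per: "a k (j + int (M k)) = a k j"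
    and minimal: "(\<And>j. a k (j + s) = a k j) \<Longrightarrow> int (M k) dvd s"
    and consistent: "a k j = (\<Sum>i<M (Suc k) div M k. a (Suc k) (j + int (i * M k))) / of_nat (M (Suc k) div M k)"
    and bound: "norm (a k j) \<le> 1"
    and close: "(\<Sum>b<M (Suc k). norm (a (Suc k) (int b) - a k (int b))) / real (M (Suc k)) \<le> (1 / 2) ^ k"

lemma int_periodic_mod:
  fixes u :: "int \<Rightarrow> 'a"
  assumes u: "\<And>j. u (j + m) = u j"
  shows "u (j mod m) = u j"
proof -
  have nat: "u (j + int k * m) = u j" for j k
  proof (induction k)
    case (Suc k)
    have "u (j + int (Suc k) * m) = u (j + int k * m + m)" by (simp add: algebra_simps)
    then show ?case using u Suc by simp
  qed simp
  have "u (i + j * m) = u i" for i j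
  proof (cases "j \<ge> 0")
    case True
    then show ?thesis using nat[of i "nat j"] by simp
  next
    case False
    then show ?thesis using nat[of "i + j * m" "nat (- j)"] by (simp add: algebra_simps)
  qed
  from this[of "j mod m" "j div m"] show ?thesis by (simp add: mult.commute)
qed

context bounded_RAP
begin

text \<open>Products of the periods of the approximants form a divisibility chain, which passes to
  minimal periods by \<open>min_period_mono\<close>. Class means are used as approximants because
  they are consistent between levels.\<close>

lemma coding_exists:
  obtains M a where "odometer_coding M a"
    "\<And>k. \<forall>\<^sub>F N in sequentially. avg (\<lambda>n. norm (f n - a k (int n))) N < (1 / 2) ^ k"
proof -
  \<comment> \<open>\<open>class_mean_approx\<close> loses a factor 4; starting from 1/16, the
    errors of two consecutive levels add up to less than \<open>(1 / 2) ^ k\<close>.\<close>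
  have "\<forall>k. \<exists>m g. m > 0 \<and> (\<forall>n. g (n + m) = g n) \<and>
      (\<forall>\<^sub>F N in sequentially. avg (\<lambda>n. norm (f n - g n)) N < (1 / 2) ^ k / 16)"
  proof
    fix k :: nat
    have "(1 / 2) ^ k / 16 > (0::real)" by simp
    from f_RAP[unfolded RAP_iff, rule_format, OF this]
    obtain g where "periodic_seq g" "\<forall>\<^sub>F N in sequentially. avg (\<lambda>n. norm (f n - g n)) N < (1 / 2) ^ k / 16"
      by blast
    then show "\<exists>m g. m > 0 \<and> (\<forall>n. g (n + m) = g n) \<and>
      (\<forall>\<^sub>F N in sequentially. avg (\<lambda>n. norm (f n - g n)) N < (1 / 2) ^ k / 16)"
      unfolding periodic_seq_def by blast
  qed
  from choice[OF this] obtain m' where "\<forall>k. \<exists>g. m' k > 0 \<and> (\<forall>n. g (n + m' k) = g n) \<and>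
      (\<forall>\<^sub>F N in sequentially. avg (\<lambda>n. norm (f n - g n)) N < (1 / 2) ^ k / 16)" by blast
  from choice[OF this] obtain g where mg: "\<forall>k. m' k > 0 \<and> (\<forall>n. g k (n + m' k) = g k n) \<and>
      (\<forall>\<^sub>F N in sequentially. avg (\<lambda>n. norm (f n - g k n)) N < (1 / 2) ^ k / 16)" by blast
  then have m': "\<And>k. m' k > 0" "\<And>k n. g k (n + m' k) = g k n"
    and ev: "\<And>k. \<forall>\<^sub>F N in sequentially. avg (\<lambda>n. norm (f n - g k n)) N < (1 / 2) ^ k / 16"
    by auto
  define m where "m k = (\<Prod>i\<le>k. m' i)" for k :: nat
  have m0: "m k > 0" for k unfolding m_def using m' by (intro prod_pos) auto
  define M where "M k = min_period (m k)" for k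
  have M0: "M k > 0" for k unfolding M_def by (rule min_period(1)[OF m0])
  define A where "A k = class_mean f (M k)" for k
  have A_eq: "A k b = class_mean f (m k) b" for k b
    unfolding A_def M_def by (rule class_mean_min_period[OF m0])
  have perA: "A k (b + M k) = A k b" for k b
    unfolding A_def by (rule class_mean_periodic[OF M0])
  have Mdvd: "M k dvd M (Suc k)" for k
    unfolding M_def by (rule min_period_mono[OF m0 m0]) (simp add: m_def)
  have approx: "\<forall>\<^sub>F N in sequentially. avg (\<lambda>n. norm (f n - A k n)) N < 4 * ((1 / 2) ^ k / 16)" for k
    unfolding A_eq
  proof (rule class_mean_approx[OF m0 _ _ ev])
    have "m k = (\<Prod>i<k. m' i) * m' k" by (simp add: m_def lessThan_Suc_atMost[symmetric])
    then show "g k (n + m k) = g k n" for n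
      using periodic_add_mult[of "g k" "m' k" n "\<Prod>i<k. m' i", OF m'(2)] by simp
  qed simp
  \<comment> \<open>Extension to negative integers by periodicity, since points of the shift space
    are indexed by \<open>int\<close>.\<close>
  define a where "a k j = A k (nat (j mod int (M k)))" for k j
  have a_int: "a k (int n) = A k n" for k n
    unfolding a_def using periodic_mod[of "A k" "M k" n, OF perA] by (simp flip: zmod_int)
  have per_a: "a k (j + int (M k)) = a k j" for k j by (simp add: a_def)
  have "odometer_coding M a"
  proof
    show "odometer_moduli M" by (simp add: odometer_moduli_def M0 Mdvd)
    show "a k (j + int (M k)) = a k j" for k j by (rule per_a)
    show "norm (a k j) \<le> 1" for k j unfolding a_def A_def by (rule class_mean_bound[OF M0])
    show "int (M k) dvd s" if s: "\<And>j. a k (j + s) = a k j" for k s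
    proof -
      define s' where "s' = nat (s mod int (M k))"
      have "A k (b + s') = A k b" for b
      proof -
        have "A k (b + s') = a k (int b + s mod int (M k))" using M0[of k] by (simp add: s'_def flip: a_int)
        also have "\<dots> = a k (int b + s)" by (simp add: a_def mod_add_right_eq)
        finally show ?thesis using s[of "int b"] by (simp add: a_int)
      qed
      then have "M k dvd s'" using min_period(3)[OF m0, of k s'] unfolding A_eq M_def by blast
      moreover have "s' < M k" using M0[of k] by (simp add: s'_def nat_less_iff)
      ultimately have "s' = 0" using nat_dvd_not_less by blast
      then have "s mod int (M k) \<le> 0" by (simp add: s'_def)
      moreover have "s mod int (M k) \<ge> 0" using M0[of k] by simp
      ultimately show ?thesis by (simp add: dvd_eq_mod_eq_0)
    qed
    show "a k j = (\<Sum>i<M (Suc k) div M k. a (Suc k) (j + int (i * M k))) / of_nat (M (Suc k) div M k)" for k j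
    proof -
      define d where "d = M (Suc k) div M k"
      have d: "M (Suc k) = d * M k" using Mdvd[of k] by (simp add: d_def)
      have d0: "d > 0" using d M0[of "Suc k"] by (auto intro!: gr0I)
      define n where "n = nat (j mod int (M (Suc k)))"
      have n: "int n = j mod int (M (Suc k))" using M0[of "Suc k"] by (simp add: n_def)
      have 1: "a (Suc k) (j + int (i * M k)) = A (Suc k) (n + i * M k)" for i
      proof -
        have "A (Suc k) (n + i * M k) = a (Suc k) (int n + int (i * M k))" by (simp flip: a_int)
        also have "\<dots> = a (Suc k) (j + int (i * M k))" unfolding n a_def by (simp only: mod_add_left_eq)
        finally show ?thesis by simp
      qed
      have 2: "a k j = A k n"
      proof -
        have "A k n = a k (j mod int (M (Suc k)))" by (simp flip: a_int n)
        also have "\<dots> = a k j" unfolding a_def by (simp add: d mod_mod_cancel)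
        finally show ?thesis by simp
      qed
      show ?thesis unfolding 1 2 d_def[symmetric] unfolding A_def d
        by (rule class_mean_average[OF M0 d0])
    qed
    show "(\<Sum>b<M (Suc k). norm (a (Suc k) (int b) - a k (int b))) / real (M (Suc k)) \<le> (1 / 2) ^ k" for k
    proof -
      obtain d where d: "M (Suc k) = d * M k" using Mdvd[of k] by (metis dvd_def mult.commute)
      have "avg (\<lambda>n. norm (A (Suc k) n - A k n)) \<longlonglongrightarrow> (\<Sum>b<M (Suc k). norm (A (Suc k) b - A k b)) /\<^sub>R real (M (Suc k))"
      proof (rule avg_periodic_tendsto[OF _ M0])
        fix n
        have "A k (n + M (Suc k)) = A k n" unfolding d by (rule periodic_add_mult[of "A k" "M k", OF perA])
        then show "norm (A (Suc k) (n + M (Suc k)) - A k (n + M (Suc k))) = norm (A (Suc k) n - A k n)"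
          by (simp add: perA)
      qed
      then have "(\<Sum>b<M (Suc k). norm (A (Suc k) b - A k b)) /\<^sub>R real (M (Suc k)) \<le> (1 / 2) ^ k"
      proof (rule tendsto_upperbound)
        show "\<forall>\<^sub>F N in sequentially. avg (\<lambda>n. norm (A (Suc k) n - A k n)) N \<le> (1 / 2) ^ k"
          using approx[of k] approx[of "Suc k"]
        proof eventually_elim
          case (elim N)
          have "avg (\<lambda>n. norm (A (Suc k) n - A k n)) N \<le> avg (\<lambda>n. norm (f n - A k n) + norm (f n - A (Suc k) n)) N"
          proof (rule avg_mono)
            fix n
            show "norm (A (Suc k) n - A k n) \<le> norm (f n - A k n) + norm (f n - A (Suc k) n)"
              using norm_triangle_ineq4[of "f n - A k n" "f n - A (Suc k) n"] by simp
          qed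
          moreover have "(1 / 2) ^ k > (0::real)" by simp
          ultimately show ?case using elim unfolding avg_add power_Suc by linarith
        qed
      qed simp
      then show ?thesis unfolding a_int real_scaleR_def divide_inverse_commute .
    qed
  qed
  moreover have "\<forall>\<^sub>F N in sequentially. avg (\<lambda>n. norm (f n - a k (int n))) N < (1 / 2) ^ k" for k
    using approx[of k] unfolding a_int
  proof eventually_elim
    case (elim N)
    moreover have "(1 / 2) ^ k > (0::real)" by simp
    ultimately show ?case by linarith
  qed
  ultimately show ?thesis by (rule that)
qed

end

section \<open>Odometers\<close>

definition odo_cyl :: "(nat \<Rightarrow> nat) \<Rightarrow> nat \<Rightarrow> nat \<Rightarrow> (nat \<Rightarrow> nat) set" where
  "odo_cyl M k b = {z\<in>odometer_space M. z k = b}"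

abbreviation odo_borel :: "(nat \<Rightarrow> nat) \<Rightarrow> (nat \<Rightarrow> nat) measure" where
  "odo_borel M \<equiv> restrict_space borel (odometer_space M)"

lemma moduli_pos: "odometer_moduli M \<Longrightarrow> M k > 0"
  by (simp add: odometer_moduli_def)

lemma moduli_dvd:
  assumes "odometer_moduli M" "k \<le> l"
  shows "M k dvd M l"
  using assms(2) by (induction l rule: dec_induct) (use assms(1) in \<open>auto simp: odometer_moduli_def intro: dvd_trans\<close>)

lemma odometer_space_less: "z \<in> odometer_space M \<Longrightarrow> z k < M k"
  by (simp add: odometer_space_def)

lemma odometer_space_mod:
  assumes M: "odometer_moduli M" and z: "z \<in> odometer_space M" and kl: "k \<le> l"
  shows "z l mod M k = z k"
  using kl
proof (induction l rule: dec_induct)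
  case base
  then show ?case using odometer_space_less[OF z, of k] by simp
next
  case (step l)
  have "z (Suc l) mod M k = (z (Suc l) mod M l) mod M k"
    using moduli_dvd[OF M, of k l] step by (simp add: mod_mod_cancel)
  also have "z (Suc l) mod M l = z l" using z by (simp add: odometer_space_def)
  finally show ?case using step by simp
qed

lemma measurable_borel_nat: "measurable N (borel :: nat measure) = measurable N (count_space UNIV)"
  by (rule measurable_cong_sets[OF refl sets_borel_eq_count_space])

lemma measurable_nat_coordinate [measurable]: "(\<lambda>z::nat \<Rightarrow> nat. z k) \<in> measurable borel (count_space UNIV)"
proof -
  have "(\<lambda>z::nat \<Rightarrow> nat. z k) \<in> measurable borel borel" by measurable
  then show ?thesis unfolding measurable_borel_nat .
qed

lemma odometer_space_measurable [measurable]: "odometer_space M \<in> sets borel"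
proof -
  have "{z \<in> space borel. \<forall>k. z k < M k \<and> z (Suc k) mod M k = z k} \<in> sets borel" by measurable
  then show ?thesis by (simp add: odometer_space_def)
qed

lemma space_odo_borel [simp]: "space (odo_borel M) = odometer_space M"
  by (simp add: space_restrict_space)

lemma measurable_odo_coordinate [measurable]: "(\<lambda>z. z k) \<in> measurable (odo_borel M) (count_space UNIV)"
  by (rule measurable_restrict_space1) measurable

lemma odo_cyl_measurable [measurable]: "odo_cyl M k b \<in> sets (odo_borel M)"
proof -
  have "{z \<in> space (odo_borel M). z k = b} \<in> sets (odo_borel M)" by measurable
  then show ?thesis by (simp add: odo_cyl_def)
qed

text \<open>Cylinders are nested or disjoint, so adding the empty set makes the family stable under
  intersection. The whole space serves as the covering set of finite measure.\<close>

definition odo_gen :: "(nat \<Rightarrow> nat) \<Rightarrow> (nat \<Rightarrow> nat) set set" where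
  "odo_gen M = {{}, odometer_space M} \<union> range (\<lambda>(k, b). odo_cyl M k b)"

lemma odo_gen_cases:
  assumes "A \<in> odo_gen M"
  obtains "A = {}" | "A = odometer_space M" | k b where "A = odo_cyl M k b"
  using assms by (auto simp: odo_gen_def)

lemma odo_gen_subset: "odo_gen M \<subseteq> Pow (odometer_space M)"
  by (auto simp: odo_gen_def odo_cyl_def)

text \<open>The Borel structure of the product is that of the coordinates, and these take values in
  a discrete countable set, so cylinders generate it.\<close>

lemma sets_odo_borel: "sets (odo_borel M) = sigma_sets (odometer_space M) (odo_gen M)"
proof
  show "sigma_sets (odometer_space M) (odo_gen M) \<subseteq> sets (odo_borel M)"
  proof -
    have "odo_gen M \<subseteq> sets (odo_borel M)"
      using sets.top[of "odo_borel M"] by (auto simp: odo_gen_def)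
    from sets.sigma_sets_subset[OF this] show ?thesis by simp
  qed
  define S where "S = sigma (odometer_space M) (odo_gen M)"
  have S: "sets S = sigma_sets (odometer_space M) (odo_gen M)" "space S = odometer_space M"
    unfolding S_def using odo_gen_subset by (auto intro: sets_measure_of space_measure_of)
  have "(\<lambda>z. z) \<in> measurable S borel"
  proof (rule measurable_coordinatewise_then_product)
    fix k :: nat
    have "(\<lambda>z. z k) \<in> measurable S (count_space UNIV)"
    proof (rule measurable_count_space_eq2_countable[THEN iffD2], intro conjI ballI)
      fix b :: nat
      have "(\<lambda>z. z k) -` {b} \<inter> space S = odo_cyl M k b" by (auto simp: S odo_cyl_def)
      also have "odo_cyl M k b \<in> sets S" unfolding S by (rule sigma_sets.Basic) (auto simp: odo_gen_def)
      finally show "(\<lambda>z. z k) -` {b} \<inter> space S \<in> sets S" .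
    qed auto
    then show "(\<lambda>z. z k) \<in> borel_measurable S"
      unfolding measurable_borel_nat .
  qed
  then show "sets (odo_borel M) \<subseteq> sigma_sets (odometer_space M) (odo_gen M)"
    using measurable_sets[of "\<lambda>z. z" S borel] by (auto simp: sets_restrict_space S Int_commute)
qed

lemma Int_stable_odo_gen:
  assumes M: "odometer_moduli M"
  shows "Int_stable (odo_gen M)"
proof (rule Int_stableI)
  have le: "odo_cyl M k b \<inter> odo_cyl M l c \<in> odo_gen M" if kl: "k \<le> l" for k b l c
  proof (cases "c mod M k = b")
    case True
    then have "odo_cyl M k b \<inter> odo_cyl M l c = odo_cyl M l c"
      using odometer_space_mod[OF M _ kl] by (auto simp: odo_cyl_def)
    then show ?thesis by (auto simp: odo_gen_def)
  next
    case False
    then have "odo_cyl M k b \<inter> odo_cyl M l c = {}"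
      using odometer_space_mod[OF M _ kl] by (auto simp: odo_cyl_def)
    then show ?thesis by (auto simp: odo_gen_def)
  qed
  have cyl: "odo_cyl M k b \<inter> odo_cyl M l c \<in> odo_gen M" for k b l c
    using le[of k l b c] le[of l k c b] by (cases "k \<le> l") (auto simp: Int_commute)
  have sub: "odo_cyl M k b \<subseteq> odometer_space M" for k b by (auto simp: odo_cyl_def)
  have mem: "{} \<in> odo_gen M" "odometer_space M \<in> odo_gen M" "odo_cyl M k b \<in> odo_gen M" for k b
    by (auto simp: odo_gen_def)
  fix A B assume A: "A \<in> odo_gen M" and B: "B \<in> odo_gen M"
  show "A \<inter> B \<in> odo_gen M"
    by (rule odo_gen_cases[OF A]; rule odo_gen_cases[OF B])
      (use mem cyl in \<open>simp_all add: Int_absorb1 Int_absorb2 sub\<close>)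
qed

lemma odo_measure_eqI:
  assumes M: "odometer_moduli M"
    and \<mu>: "prob_space \<mu>" "sets \<mu> = sets (odo_borel M)"
    and \<nu>: "prob_space \<nu>" "sets \<nu> = sets (odo_borel M)"
    and eq: "\<And>k b. measure \<mu> (odo_cyl M k b) = measure \<nu> (odo_cyl M k b)"
  shows "\<mu> = \<nu>"
proof (rule measure_eqI_generator_eq[where E = "odo_gen M" and \<Omega> = "odometer_space M" and A = "\<lambda>_. odometer_space M"])
  interpret \<mu>: prob_space \<mu> by fact
  interpret \<nu>: prob_space \<nu> by fact
  have sp: "space \<mu> = odometer_space M" "space \<nu> = odometer_space M"
    using sets_eq_imp_space_eq[OF \<mu>(2)] sets_eq_imp_space_eq[OF \<nu>(2)] by auto
  show "Int_stable (odo_gen M)" by (rule Int_stable_odo_gen[OF M])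
  show "odo_gen M \<subseteq> Pow (odometer_space M)" by (rule odo_gen_subset)
  show "sets \<mu> = sigma_sets (odometer_space M) (odo_gen M)" "sets \<nu> = sigma_sets (odometer_space M) (odo_gen M)"
    using \<mu>(2) \<nu>(2) sets_odo_borel by auto
  show "emeasure \<mu> X = emeasure \<nu> X" if X: "X \<in> odo_gen M" for X
    by (rule odo_gen_cases[OF X])
      (use \<mu>.emeasure_space_1 \<nu>.emeasure_space_1 sp in \<open>auto simp: \<mu>.emeasure_eq_measure \<nu>.emeasure_eq_measure eq\<close>)
  show "emeasure \<mu> (odometer_space M) \<noteq> \<infinity>" by simp
qed (auto simp: odo_gen_def)

section \<open>Haar measure on the odometer\<close>

definition uniform_odo :: "(nat \<Rightarrow> nat) \<Rightarrow> (nat \<Rightarrow> nat) measure \<Rightarrow> bool" where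
  "uniform_odo M \<mu> \<longleftrightarrow> prob_space \<mu> \<and> sets \<mu> = sets (odo_borel M) \<and>
     (\<forall>k. \<forall>b<M k. measure \<mu> (odo_cyl M k b) = 1 / real (M k))"

lemma odo_cyl_empty: "b \<ge> M k \<Longrightarrow> odo_cyl M k b = {}"
  by (auto simp: odo_cyl_def dest: odometer_space_less[where k = k])

text \<open>These are the digit ranges of a mixed radix expansion. In digits the odometer is a
  product of finite sets, which reduces the construction of Haar measure to a product
  measure.\<close>

primrec digit_mod :: "(nat \<Rightarrow> nat) \<Rightarrow> nat \<Rightarrow> nat" where
  "digit_mod M 0 = M 0"
| "digit_mod M (Suc k) = M (Suc k) div M k"

text \<open>Digits are reduced on the fly, so every sequence of naturals is a legitimate
  input.\<close>

primrec from_digits :: "(nat \<Rightarrow> nat) \<Rightarrow> (nat \<Rightarrow> nat) \<Rightarrow> nat \<Rightarrow> nat" where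
  "from_digits M d 0 = d 0 mod M 0"
| "from_digits M d (Suc k) = from_digits M d k + (d (Suc k) mod digit_mod M (Suc k)) * M k"

primrec digit_of :: "(nat \<Rightarrow> nat) \<Rightarrow> nat \<Rightarrow> nat \<Rightarrow> nat" where
  "digit_of M b 0 = b mod M 0"
| "digit_of M b (Suc k) = (b mod M (Suc k)) div M k"

context
  fixes M :: "nat \<Rightarrow> nat"
  assumes M: "odometer_moduli M"
begin

lemma digit_mod_mult: "digit_mod M (Suc k) * M k = M (Suc k)"
  using M by (simp add: odometer_moduli_def)

lemma digit_mod_pos: "digit_mod M k > 0"
proof (cases k)
  case (Suc j)
  then show ?thesis using digit_mod_mult[of j] moduli_pos[OF M, of "Suc j"] by (auto intro: gr0I)
qed (simp add: moduli_pos[OF M])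

lemma prod_digit_mod: "(\<Prod>j\<le>k. digit_mod M j) = M k"
proof (induction k)
  case (Suc k)
  then show ?case using digit_mod_mult[of k] by (simp add: mult.commute del: digit_mod.simps)
qed simp

lemma from_digits_less: "from_digits M d k < M k"
proof (induction k)
  case (Suc k)
  let ?x = "d (Suc k) mod digit_mod M (Suc k)"
  have "?x + 1 \<le> digit_mod M (Suc k)" using digit_mod_pos[of "Suc k"] by (simp add: Suc_le_eq del: digit_mod.simps)
  then have "(?x + 1) * M k \<le> M (Suc k)" using mult_le_mono1 digit_mod_mult by metis
  then show ?case using Suc by simp
qed (simp add: moduli_pos[OF M])

lemma from_digits_in_odometer: "from_digits M d \<in> odometer_space M"
  using from_digits_less by (simp add: odometer_space_def)

lemma digit_of_mod: "j \<le> k \<Longrightarrow> digit_of M (b mod M k) j = digit_of M b j"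
  by (cases j) (simp_all add: mod_mod_cancel moduli_dvd[OF M])

text \<open>Uniqueness of the expansion: the top digit is the quotient by \<open>M k\<close>, and
  the lower digits determine the remainder.\<close>

lemma from_digits_eq_iff:
  "b < M k \<Longrightarrow> from_digits M d k = b \<longleftrightarrow> (\<forall>j\<le>k. d j mod digit_mod M j = digit_of M b j)"
proof (induction k arbitrary: b)
  case (Suc k)
  define x where "x = d (Suc k) mod digit_mod M (Suc k)"
  have Mk: "M k > 0" by (rule moduli_pos[OF M])
  have "from_digits M d (Suc k) = b \<longleftrightarrow> from_digits M d k = b mod M k \<and> x = b div M k"
  proof
    assume "from_digits M d (Suc k) = b"
    then have "b = from_digits M d k + x * M k" by (simp add: x_def)
    then show "from_digits M d k = b mod M k \<and> x = b div M k"
      using from_digits_less[of d k] Mk by simp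
  next
    assume "from_digits M d k = b mod M k \<and> x = b div M k"
    then show "from_digits M d (Suc k) = b" by (simp add: x_def[symmetric] del: digit_mod.simps)
  qed
  also have "from_digits M d k = b mod M k \<longleftrightarrow> (\<forall>j\<le>k. d j mod digit_mod M j = digit_of M (b mod M k) j)"
    by (rule Suc.IH) (use Mk in simp)
  also have "\<dots> \<longleftrightarrow> (\<forall>j\<le>k. d j mod digit_mod M j = digit_of M b j)"
    by (auto simp: digit_of_mod)
  also have "x = b div M k \<longleftrightarrow> d (Suc k) mod digit_mod M (Suc k) = digit_of M b (Suc k)"
    using Suc.prems by (simp add: x_def)
  finally show ?case by (auto simp: le_Suc_eq simp del: digit_mod.simps digit_of.simps)
qed simp

lemma digit_of_less: "b < M k \<Longrightarrow> j \<le> k \<Longrightarrow> digit_of M b j < digit_mod M j"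
proof (cases j)
  case (Suc i)
  have "b mod M (Suc i) < digit_mod M (Suc i) * M i"
    unfolding digit_mod_mult using moduli_pos[OF M] by simp
  then show ?thesis using Suc by (simp add: less_mult_imp_div_less del: digit_mod.simps)
qed (simp add: moduli_pos[OF M])

text \<open>Take the image of independent uniform digits. A cylinder of level \<open>k\<close>
  prescribes the digits up to index \<open>k\<close>, and the product of their ranges is
  \<open>M k\<close>.\<close>

lemma uniform_odo_exists: "\<exists>\<mu>. uniform_odo M \<mu>"
proof -
  define U where "U j = measure_pmf (pmf_of_set {..<digit_mod M j})" for j
  define P where "P = PiM UNIV U"
  have prob: "prob_space (U j)" for j unfolding U_def by (rule measure_pmf.prob_space_axioms)
  interpret P: prob_space P unfolding P_def by (rule prob_space_PiM) (rule prob)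
  have spP: "space P = UNIV" by (auto simp: P_def U_def space_PiM)
  have coord: "(\<lambda>d. d j) \<in> measurable P (count_space UNIV)" for j
  proof -
    have "(\<lambda>d. d j) \<in> measurable P (U j)" unfolding P_def by (rule measurable_component_singleton) simp
    then show ?thesis by (simp add: U_def)
  qed
  have fd: "(\<lambda>d. from_digits M d k) \<in> measurable P (count_space UNIV)" for k
  proof (induction k)
    case 0
    show ?case using measurable_compose[OF coord[of 0], of "\<lambda>x. x mod M 0" "count_space UNIV"] by simp
  next
    case (Suc k)
    have "(\<lambda>d. (from_digits M d k, d (Suc k))) \<in> measurable P (count_space UNIV \<Otimes>\<^sub>M count_space UNIV)"
      by (intro measurable_Pair Suc coord)
    then have "(\<lambda>d. (from_digits M d k, d (Suc k))) \<in> measurable P (count_space (UNIV :: (nat \<times> nat) set))"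
      by (simp add: pair_measure_countable)
    from measurable_compose[OF this, of "\<lambda>(x, y). x + (y mod digit_mod M (Suc k)) * M k" "count_space UNIV"]
    show ?case by simp
  qed
  have meas: "from_digits M \<in> measurable P (odo_borel M)"
  proof (rule measurable_restrict_space2)
    show "from_digits M \<in> space P \<rightarrow> odometer_space M" using from_digits_in_odometer by auto
    show "from_digits M \<in> measurable P borel"
    proof (rule measurable_coordinatewise_then_product)
      show "(\<lambda>d. from_digits M d k) \<in> borel_measurable P" for k
        using fd[of k] measurable_cong_sets[OF refl sets_borel_eq_count_space] by blast
    qed
  qed
  define \<mu> where "\<mu> = distr P (odo_borel M) (from_digits M)"
  have "measure \<mu> (odo_cyl M k b) = 1 / real (M k)" if b: "b < M k" for k b
  proof -
    define X where "X j = {x. x mod digit_mod M j = digit_of M b j}" for j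
    have "measure \<mu> (odo_cyl M k b) = measure P (from_digits M -` odo_cyl M k b \<inter> space P)"
      unfolding \<mu>_def by (rule measure_distr[OF meas]) measurable
    also have "from_digits M -` odo_cyl M k b \<inter> space P = {d. \<forall>j\<le>k. d j \<in> X j}"
      using from_digits_eq_iff[OF b] from_digits_in_odometer by (auto simp: odo_cyl_def spP X_def)
    also have "\<dots> = prod_emb UNIV U {..k} (Pi\<^sub>E {..k} X)"
      by (auto simp: prod_emb_def U_def PiE_iff space_PiM)
    also have "measure P \<dots> = (\<Prod>j\<le>k. measure (U j) (X j))"
    proof -
      have "emeasure P (prod_emb UNIV U {..k} (Pi\<^sub>E {..k} X)) = (\<Prod>j\<le>k. emeasure (U j) (X j))"
        unfolding P_def by (rule emeasure_PiM_emb) (auto simp: measure_pmf.prob_space_axioms U_def)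
      also have "\<dots> = (\<Prod>j\<le>k. ennreal (measure (U j) (X j)))"
        by (simp add: U_def measure_pmf.emeasure_eq_measure)
      also have "\<dots> = ennreal (\<Prod>j\<le>k. measure (U j) (X j))" by (rule prod_ennreal) simp
      finally show ?thesis by (simp add: P.emeasure_eq_measure prod_nonneg)
    qed
    also have "\<dots> = (\<Prod>j\<le>k. 1 / real (digit_mod M j))"
    proof (rule prod.cong)
      fix j assume j: "j \<in> {..k}"
      have "{..<digit_mod M j} \<inter> X j = {digit_of M b j}"
        using digit_of_less[OF b, of j] j by (auto simp: X_def)
      then show "measure (U j) (X j) = 1 / real (digit_mod M j)"
        using digit_mod_pos[of j] unfolding U_def by (subst measure_pmf_of_set) (auto simp: lessThan_empty_iff)
    qed simp
    also have "\<dots> = 1 / real (M k)" by (simp add: prod_dividef prod_digit_mod flip: of_nat_prod)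
    finally show ?thesis .
  qed
  moreover have "prob_space \<mu>" unfolding \<mu>_def by (rule P.prob_space_distr[OF meas])
  moreover have "sets \<mu> = sets (odo_borel M)" by (simp add: \<mu>_def)
  ultimately show ?thesis unfolding uniform_odo_def by blast
qed

lemma odometer_add_closed:
  assumes "y \<in> odometer_space M" "z \<in> odometer_space M"
  shows "odometer_add M y z \<in> odometer_space M"
proof -
  have "((y (Suc k) + z (Suc k)) mod M (Suc k)) mod M k = (y k + z k) mod M k" for k
  proof -
    have "((y (Suc k) + z (Suc k)) mod M (Suc k)) mod M k = (y (Suc k) mod M k + z (Suc k) mod M k) mod M k"
      using M by (simp add: mod_mod_cancel odometer_moduli_def mod_add_eq)
    then show ?thesis using assms by (simp add: odometer_space_def)
  qed
  then show ?thesis using moduli_pos[OF M] by (simp add: odometer_space_def odometer_add_def)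
qed

lemma odometer_add_measurable:
  assumes y: "y \<in> odometer_space M"
  shows "odometer_add M y \<in> measurable (odo_borel M) (odo_borel M)"
proof (rule measurable_restrict_space2)
  show "odometer_add M y \<in> space (odo_borel M) \<rightarrow> odometer_space M" using odometer_add_closed[OF y] by auto
  show "odometer_add M y \<in> measurable (odo_borel M) borel"
  proof (rule measurable_coordinatewise_then_product)
    fix k
    have "(\<lambda>z. odometer_add M y z k) \<in> measurable (odo_borel M) (count_space UNIV)"
      unfolding odometer_add_def by measurable
    then show "(\<lambda>z. odometer_add M y z k) \<in> borel_measurable (odo_borel M)"
      unfolding measurable_borel_nat .
  qed
qed

text \<open>Translation permutes the cylinders of each level, which all have the same mass, and
  cylinders determine a measure.\<close>

lemma uniform_odo_haar:
  assumes \<mu>: "uniform_odo M \<mu>"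
  shows "odometer_haar M \<mu>"
proof -
  note U = \<mu>[unfolded uniform_odo_def]
  have p: "prob_space \<mu>" and s: "sets \<mu> = sets (odo_borel M)"
    by (rule conjunct1[OF U], rule conjunct1[OF conjunct2[OF U]])
  have u: "measure \<mu> (odo_cyl M k b) = 1 / real (M k)" if "b < M k" for k b
    using U that by blast
  have sp: "space \<mu> = odometer_space M" using sets_eq_imp_space_eq[OF s] by simp
  interpret prob_space \<mu> by (rule p)
  have "distr \<mu> \<mu> (odometer_add M y) = \<mu>" if y: "y \<in> odometer_space M" for y
  proof -
    have meas: "odometer_add M y \<in> measurable \<mu> \<mu>"
      using odometer_add_measurable[OF y] by (simp only: measurable_cong_sets[OF s s])
    show ?thesis
    proof (rule odo_measure_eqI[OF M])
      show "prob_space (distr \<mu> \<mu> (odometer_add M y))" by (rule prob_space_distr[OF meas])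
      show "measure (distr \<mu> \<mu> (odometer_add M y)) (odo_cyl M k b) = measure \<mu> (odo_cyl M k b)" for k b
      proof (cases "b < M k")
        case False
        then show ?thesis by (simp add: odo_cyl_empty)
      next
        case True
        \<comment> \<open>The residue of \<open>b - y k\<close>, written without negative
          numbers.\<close>
        define c where "c = (b + (M k - y k)) mod M k"
        have yk: "y k < M k" using y by (rule odometer_space_less)
        have c: "c < M k" using moduli_pos[OF M] by (simp add: c_def)
        have iff: "(y k + x) mod M k = b \<longleftrightarrow> x = c" if x: "x < M k" for x
        proof
          assume "(y k + x) mod M k = b"
          then have "c = ((y k + x) mod M k + (M k - y k)) mod M k" by (simp add: c_def)
          also have "\<dots> = (y k + x + (M k - y k)) mod M k" by (rule mod_add_left_eq)
          also have "y k + x + (M k - y k) = x + M k" using yk by simp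
          finally show "x = c" using x by simp
        next
          assume "x = c"
          then have "(y k + x) mod M k = (y k + (b + (M k - y k))) mod M k"
            by (simp add: c_def mod_add_right_eq)
          also have "y k + (b + (M k - y k)) = b + M k" using yk by simp
          finally show "(y k + x) mod M k = b" using True by simp
        qed
        have "measure (distr \<mu> \<mu> (odometer_add M y)) (odo_cyl M k b) =
            measure \<mu> (odometer_add M y -` odo_cyl M k b \<inter> space \<mu>)"
          by (rule measure_distr[OF meas]) (use s in auto)
        also have "odometer_add M y -` odo_cyl M k b \<inter> space \<mu> = odo_cyl M k c"
          using iff odometer_space_less odometer_add_closed[OF y]
          by (auto simp: sp odo_cyl_def) (auto simp: odometer_add_def)
        finally show ?thesis using u[OF c] u[OF True] by simp
      qed
    qed (use p s in auto)
  qed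
  then show ?thesis using p s by (simp add: odometer_haar_def)
qed

lemma odometer_one_in: "odometer_one M \<in> odometer_space M"
  unfolding odometer_space_def odometer_one_def
proof (intro CollectI allI conjI)
  fix k
  show "1 mod M k < M k" using moduli_pos[OF M, of k] by simp
  have "M k dvd M (Suc k)" using M by (simp add: odometer_moduli_def)
  then show "1 mod M (Suc k) mod M k = 1 mod M k" by (rule mod_mod_cancel)
qed

end

lemma odometer_add_one: "odometer_add M (odometer_one M) z k = (z k + 1) mod M k"
  using mod_add_left_eq[of 1 "M k" "z k"] by (simp add: odometer_add_def odometer_one_def)

lemma sum_int_period:
  fixes u :: "int \<Rightarrow> 'a::comm_monoid_add"
  assumes u: "\<And>j. u (j + int m) = u j" and m: "m > 0"
  shows "(\<Sum>b<m. u (int b + j)) = (\<Sum>b<m. u (int b))"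
proof (rule sum.reindex_bij_witness[where i = "\<lambda>b. nat ((int b - j) mod int m)" and j = "\<lambda>b. nat ((int b + j) mod int m)"])
  fix b assume b: "b \<in> {..<m}"
  have "((int b + j) mod int m - j) mod int m = int b mod int m" by (simp add: mod_diff_left_eq)
  then show "nat ((int (nat ((int b + j) mod int m)) - j) mod int m) = b" using b m by simp
  have "((int b - j) mod int m + j) mod int m = int b mod int m" by (simp add: mod_add_left_eq)
  then show "nat ((int (nat ((int b - j) mod int m)) + j) mod int m) = b" using b m by simp
  show "u (int (nat ((int b + j) mod int m))) = u (int b + j)"
    using m int_periodic_mod[of u "int m" "int b + j", OF u] by simp
  show "nat ((int b + j) mod int m) \<in> {..<m}" "nat ((int b - j) mod int m) \<in> {..<m}"
    using m by (auto simp: nat_less_iff)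
qed

text \<open>By monotone convergence the sum of the \<open>u i\<close> has a finite integral, so it
  is finite almost everywhere.\<close>

lemma AE_summable_geometric:
  fixes u :: "nat \<Rightarrow> 'a \<Rightarrow> real"
  assumes meas: "\<And>i. u i \<in> borel_measurable \<mu>" and nn: "\<And>i z. 0 \<le> u i z"
    and le: "\<And>i. (\<integral>\<^sup>+z. ennreal (u i z) \<partial>\<mu>) \<le> ennreal (C * (1 / 2) ^ i)" and C: "C \<ge> 0"
  shows "AE z in \<mu>. summable (\<lambda>i. u i z)"
proof -
  have "(\<integral>\<^sup>+z. (\<Sum>i. ennreal (u i z)) \<partial>\<mu>) = (\<Sum>i. \<integral>\<^sup>+z. ennreal (u i z) \<partial>\<mu>)"
    using meas by (intro nn_integral_suminf) auto
  also have "\<dots> \<le> (\<Sum>i. ennreal (C * (1 / 2) ^ i))"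
    by (intro suminf_le le) auto
  also have "\<dots> = ennreal (\<Sum>i. C * (1 / 2) ^ i)"
    using C by (intro suminf_ennreal2 summable_mult) auto
  finally have "(\<integral>\<^sup>+z. (\<Sum>i. ennreal (u i z)) \<partial>\<mu>) \<noteq> \<infinity>" by (auto simp: top_unique)
  then have "AE z in \<mu>. (\<Sum>i. ennreal (u i z)) \<noteq> \<infinity>"
    using meas by (intro nn_integral_noteq_infinite) auto
  then show ?thesis
    by eventually_elim (use nn in \<open>auto intro: summable_suminf_not_top\<close>)
qed

section \<open>The coding map from the odometer into the shift space\<close>

locale coding_system = odometer_coding +
  fixes \<mu> :: "(nat \<Rightarrow> nat) measure"
  assumes uni: "uniform_odo M \<mu>"
begin

abbreviation Z :: "(nat \<Rightarrow> nat) set" where "Z \<equiv> odometer_space M"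

lemma M_pos [simp]: "M k > 0" using moduli by (rule moduli_pos)

lemma prob_mu: "prob_space \<mu>" using uni by (simp only: uniform_odo_def)

lemma sets_mu: "sets \<mu> = sets (odo_borel M)" using uni by (simp only: uniform_odo_def)

lemma measure_cyl: "b < M k \<Longrightarrow> measure \<mu> (odo_cyl M k b) = 1 / real (M k)"
  using uni unfolding uniform_odo_def by blast

lemma space_mu: "space \<mu> = Z" using sets_eq_imp_space_eq[OF sets_mu] by simp

sublocale prob_space \<mu> by (rule prob_mu)

lemma cyl_sets [measurable]: "odo_cyl M k b \<in> sets \<mu>" unfolding sets_mu by (rule odo_cyl_measurable)

lemma coordinate_measurable [measurable]: "(\<lambda>z. z k) \<in> measurable \<mu> (count_space UNIV)"
  unfolding measurable_cong_sets[OF sets_mu refl] by (rule measurable_odo_coordinate)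

lemma
  fixes u :: "nat \<Rightarrow> 'b::{banach, second_countable_topology}"
  shows integrable_coordinate: "integrable \<mu> (\<lambda>z. u (z k))"
    and integral_coordinate: "(\<integral>z. u (z k) \<partial>\<mu>) = (\<Sum>b<M k. u b) /\<^sub>R real (M k)"
proof -
  have eq: "u (z k) = (\<Sum>b<M k. indicator (odo_cyl M k b) z *\<^sub>R u b)" if "z \<in> space \<mu>" for z
  proof -
    have z: "z \<in> Z" using that by (simp add: space_mu)
    have "(\<Sum>b<M k. indicator (odo_cyl M k b) z *\<^sub>R u b) = (\<Sum>b<M k. if z k = b then u b else 0)"
      using z by (intro sum.cong) (auto simp: odo_cyl_def indicator_def)
    then show ?thesis using odometer_space_less[OF z, of k] by simp
  qed
  have int: "integrable \<mu> (\<lambda>z. indicator (odo_cyl M k b) z *\<^sub>R u b)" for b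
    by (intro integrable_scaleR_left integrable_real_indicator) (auto simp: emeasure_eq_measure)
  show "integrable \<mu> (\<lambda>z. u (z k))"
    by (subst Bochner_Integration.integrable_cong[OF refl eq], assumption)
      (intro Bochner_Integration.integrable_sum int)
  have "(\<integral>z. u (z k) \<partial>\<mu>) = (\<integral>z. (\<Sum>b<M k. indicator (odo_cyl M k b) z *\<^sub>R u b) \<partial>\<mu>)"
    by (rule Bochner_Integration.integral_cong[OF refl eq])
  also have "\<dots> = (\<Sum>b<M k. \<integral>z. indicator (odo_cyl M k b) z *\<^sub>R u b \<partial>\<mu>)"
    by (rule Bochner_Integration.integral_sum) (rule int)
  also have "\<dots> = (\<Sum>b<M k. (1 / real (M k)) *\<^sub>R u b)"
  proof (intro sum.cong refl)
    fix b assume b: "b \<in> {..<M k}"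
    have "odo_cyl M k b \<inter> space \<mu> = odo_cyl M k b" using sets.sets_into_space[OF cyl_sets] by blast
    then have "(\<integral>z. indicator (odo_cyl M k b) z \<partial>\<mu>) = 1 / real (M k)" using measure_cyl b by simp
    moreover have "integrable \<mu> (indicator (odo_cyl M k b) :: _ \<Rightarrow> real)"
      by (intro integrable_real_indicator) (auto simp: emeasure_eq_measure)
    ultimately show "(\<integral>z. indicator (odo_cyl M k b) z *\<^sub>R u b \<partial>\<mu>) = (1 / real (M k)) *\<^sub>R u b"
      by simp
  qed
  also have "\<dots> = (\<Sum>b<M k. u b) /\<^sub>R real (M k)" by (simp add: scaleR_sum_right divide_inverse)
  finally show "(\<integral>z. u (z k) \<partial>\<mu>) = (\<Sum>b<M k. u b) /\<^sub>R real (M k)" .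
qed

lemma nn_integral_coordinate:
  assumes "\<And>b. 0 \<le> u b"
  shows "(\<integral>\<^sup>+z. ennreal (u (z k)) \<partial>\<mu>) = ennreal ((\<Sum>b<M k. u b) / real (M k))"
  using assms by (subst nn_integral_eq_integral[OF integrable_coordinate])
    (auto simp: integral_coordinate divide_inverse mult.commute)

lemma a_mod: "a k (j mod int (M k)) = a k j"
  by (rule int_periodic_mod) (rule per)

lemma a_add_mod: "a k (i mod int (M k) + j) = a k (i + j)"
  using a_mod[of k "i mod int (M k) + j"] a_mod[of k "i + j"] by (simp add: mod_add_left_eq)

definition orb :: "nat \<Rightarrow> (nat \<Rightarrow> nat) \<Rightarrow> int \<Rightarrow> complex" where
  "orb k z j = a k (int (z k) + j)"

text \<open>Where the sequence diverges, \<open>lim\<close> returns an unspecified value; this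
  happens only on a null set.\<close>

definition pi_map :: "(nat \<Rightarrow> nat) \<Rightarrow> int \<Rightarrow> complex" where
  "pi_map z j = lim (\<lambda>k. orb k z j)"

lemma orb_measurable [measurable]: "(\<lambda>z. orb k z j) \<in> borel_measurable \<mu>"
  unfolding orb_def by measurable

lemma pi_coord_measurable [measurable]: "(\<lambda>z. pi_map z j) \<in> borel_measurable \<mu>"
  unfolding pi_map_def by measurable

lemma pi_measurable [measurable]: "pi_map \<in> borel_measurable \<mu>"
  by (rule measurable_coordinatewise_then_product) measurable

lemma orb_eq:
  assumes z: "z \<in> Z" and kl: "k \<le> l"
  shows "orb k z j = a k (int (z l) + j)"
proof -
  have "int (z k) = int (z l) mod int (M k)"
    using odometer_space_mod[OF moduli z kl] by (simp flip: zmod_int)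
  then show ?thesis by (simp add: orb_def a_add_mod)
qed

text \<open>The sum over a full period does not depend on its starting point, so the bound
  \<open>close\<close>, stated at the origin, holds at every coordinate \<open>j\<close>.\<close>

lemma orb_step_nn_integral:
  "(\<integral>\<^sup>+z. ennreal (norm (orb (Suc k) z j - orb k z j)) \<partial>\<mu>) \<le> ennreal ((1 / 2) ^ k)"
proof -
  define u where "u x = norm (a (Suc k) x - a k x)" for x
  have Mdvd: "M k dvd M (Suc k)" using moduli by (simp add: odometer_moduli_def)
  have per_u: "u (x + int (M (Suc k))) = u x" for x
  proof -
    have "a k (x + int (M (Suc k))) = a k x"
      using a_mod[of k "x + int (M (Suc k))"] a_mod[of k x] Mdvd
      by (metis int_dvd_int_iff mod_add_right_eq dvd_eq_mod_eq_0 add.right_neutral)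
    then show ?thesis by (simp add: u_def per)
  qed
  have "(\<integral>\<^sup>+z. ennreal (norm (orb (Suc k) z j - orb k z j)) \<partial>\<mu>) = (\<integral>\<^sup>+z. ennreal (u (int (z (Suc k)) + j)) \<partial>\<mu>)"
    using orb_eq[of _ k "Suc k" j] by (intro nn_integral_cong) (simp add: u_def orb_def space_mu)
  also have "\<dots> = ennreal ((\<Sum>b<M (Suc k). u (int b + j)) / real (M (Suc k)))"
    by (rule nn_integral_coordinate[of "\<lambda>b. u (int b + j)"]) (simp add: u_def)
  also have "(\<Sum>b<M (Suc k). u (int b + j)) = (\<Sum>b<M (Suc k). u (int b))"
    by (rule sum_int_period[of u "M (Suc k)" j, OF per_u M_pos])
  also have "ennreal ((\<Sum>b<M (Suc k). u (int b)) / real (M (Suc k))) \<le> ennreal ((1 / 2) ^ k)"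
    using close[of k] by (intro ennreal_leI) (simp add: u_def)
  finally show ?thesis .
qed

lemma AE_orb_steps_summable: "AE z in \<mu>. \<forall>j. summable (\<lambda>k. norm (orb (Suc k) z j - orb k z j))"
  unfolding AE_all_countable
proof
  fix j
  show "AE z in \<mu>. summable (\<lambda>k. norm (orb (Suc k) z j - orb k z j))"
    by (rule AE_summable_geometric[where C = 1]) (use orb_step_nn_integral in auto)
qed

lemma orb_limit:
  assumes s: "summable (\<lambda>k. norm (orb (Suc k) z j - orb k z j))"
  shows "(\<lambda>k. orb k z j) \<longlonglongrightarrow> pi_map z j"
    and "norm (pi_map z j - orb k z j) \<le> (\<Sum>i. norm (orb (Suc (i + k)) z j - orb (i + k) z j))"
proof -
  let ?d = "\<lambda>k. orb (Suc k) z j - orb k z j"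
  have sd: "summable ?d" using s by (rule summable_norm_cancel)
  have tel: "orb n z j = orb 0 z j + (\<Sum>i<n. ?d i)" for n
    by (induction n) auto
  have "(\<lambda>n. orb 0 z j + (\<Sum>i<n. ?d i)) \<longlonglongrightarrow> orb 0 z j + suminf ?d"
    by (intro tendsto_intros summable_LIMSEQ sd)
  then have L: "(\<lambda>n. orb n z j) \<longlonglongrightarrow> orb 0 z j + suminf ?d" unfolding tel[symmetric] .
  have p: "pi_map z j = orb 0 z j + suminf ?d" unfolding pi_map_def by (rule limI[OF L])
  show "(\<lambda>k. orb k z j) \<longlonglongrightarrow> pi_map z j" using L unfolding p .
  note p
  also have "suminf ?d = (\<Sum>i. ?d (i + k)) + (\<Sum>i<k. ?d i)"
    by (rule suminf_split_initial_segment[OF sd])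
  finally have "pi_map z j - orb k z j = (\<Sum>i. ?d (i + k))" using tel[of k] by simp
  moreover have "summable (\<lambda>i. norm (?d (i + k)))" using s by (subst summable_iff_shift)
  ultimately show "norm (pi_map z j - orb k z j) \<le> (\<Sum>i. norm (?d (i + k)))"
    using summable_norm[of "\<lambda>i. ?d (i + k)"] by simp
qed

text \<open>The bounds of \<open>orb_step_nn_integral\<close> from level \<open>k\<close> on form a
  geometric series with sum \<open>2 * (1 / 2) ^ k\<close>.\<close>

lemma pi_error_nn_integral:
  "(\<integral>\<^sup>+z. ennreal (norm (pi_map z j - orb k z j)) \<partial>\<mu>) \<le> ennreal (2 * (1 / 2) ^ k)"
proof -
  let ?d = "\<lambda>i z. norm (orb (Suc (i + k)) z j - orb (i + k) z j)"
  have "(\<integral>\<^sup>+z. ennreal (norm (pi_map z j - orb k z j)) \<partial>\<mu>) \<le> (\<integral>\<^sup>+z. (\<Sum>i. ennreal (?d i z)) \<partial>\<mu>)"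
  proof (rule nn_integral_mono_AE, use AE_orb_steps_summable in eventually_elim)
    case (elim z)
    then have s: "summable (\<lambda>k. norm (orb (Suc k) z j - orb k z j))" by blast
    have s': "summable (\<lambda>i. ?d i z)" using s by (subst summable_iff_shift)
    have "ennreal (norm (pi_map z j - orb k z j)) \<le> ennreal (\<Sum>i. ?d i z)"
      by (intro ennreal_leI orb_limit(2)[OF s])
    also have "\<dots> = (\<Sum>i. ennreal (?d i z))" using s' by (intro suminf_ennreal2[symmetric]) auto
    finally show ?case .
  qed
  also have "\<dots> = (\<Sum>i. \<integral>\<^sup>+z. ennreal (?d i z) \<partial>\<mu>)"
    by (intro nn_integral_suminf) measurable
  also have "\<dots> \<le> (\<Sum>i. ennreal ((1 / 2) ^ (i + k)))"
    by (intro suminf_le orb_step_nn_integral) auto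
  also have "\<dots> = ennreal (\<Sum>i. (1 / 2) ^ (i + k))"
    by (intro suminf_ennreal2) (auto simp: power_add intro!: summable_mult2)
  also have "(\<Sum>i. (1 / 2) ^ (i + k)) = 2 * ((1 / 2) ^ k :: real)"
    by (simp add: power_add suminf_mult2[symmetric] suminf_geometric)
  finally show ?thesis .
qed

lemma consistent_iter:
  assumes "k \<le> i"
  shows "a k j = (\<Sum>l<M i div M k. a i (j + int (l * M k))) / of_nat (M i div M k)"
  using assms
proof (induction i rule: dec_induct)
  case (step i)
  define d e where "d = M i div M k" and "e = M (Suc i) div M i"
  have d: "M i = d * M k" using moduli_dvd[OF moduli step(1)] by (simp add: d_def)
  have e: "M (Suc i) = e * M i" using moduli by (simp add: e_def odometer_moduli_def)
  have "M (Suc i) = e * d * M k" "M k \<noteq> 0" using d e M_pos[of k] by (simp, linarith)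
  then have ed: "M (Suc i) div M k = e * d" by simp
  have "a k j = (\<Sum>l<d. a i (j + int (l * M k))) / of_nat d" using step by (simp add: d_def)
  also have "\<dots> = (\<Sum>l<d. (\<Sum>l'<e. a (Suc i) (j + int (l * M k) + int (l' * M i))) / of_nat e) / of_nat d"
    unfolding e_def by (subst consistent[of i]) simp
  also have "\<dots> = (\<Sum>l<d. \<Sum>l'<e. a (Suc i) (j + int ((l + l' * d) * M k))) / of_nat (e * d)"
    by (simp add: d sum_divide_distrib[symmetric] algebra_simps)
  also have "(\<Sum>l<d. \<Sum>l'<e. a (Suc i) (j + int ((l + l' * d) * M k))) =
      (\<Sum>l'<e. \<Sum>l<d. a (Suc i) (j + int ((l + l' * d) * M k)))" by (rule sum.swap)
  also have "\<dots> = (\<Sum>l'<e. \<Sum>n\<in>{l' * d..<l' * d + d}. a (Suc i) (j + int (n * M k)))"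
  proof (rule sum.cong[OF refl])
    fix l'
    show "(\<Sum>l<d. a (Suc i) (j + int ((l + l' * d) * M k))) = (\<Sum>n\<in>{l' * d..<l' * d + d}. a (Suc i) (j + int (n * M k)))"
      using sum.shift_bounds_nat_ivl[of "\<lambda>n. a (Suc i) (j + int (n * M k))" 0 "l' * d" d]
      by (simp add: atLeast0LessThan add.commute)
  qed
  also have "\<dots> = (\<Sum>n<e * d. a (Suc i) (j + int (n * M k)))" by (rule sum.nat_group)
  finally show ?case unfolding ed .
qed simp

text \<open>One period of level \<open>i\<close>, sampled with step \<open>M k\<close>. It turns
  \<open>orb i z\<close> into \<open>orb k z\<close> exactly, and so in the limit recovers the
  periodic components of \<open>pi_map z\<close> from that point alone.\<close>

definition block_avg :: "nat \<Rightarrow> nat \<Rightarrow> int \<Rightarrow> (int \<Rightarrow> complex) \<Rightarrow> complex" where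
  "block_avg k i j x = (\<Sum>l<M i div M k. x (j + int (l * M k))) / of_nat (M i div M k)"

lemma block_avg_orb: "z \<in> Z \<Longrightarrow> k \<le> i \<Longrightarrow> block_avg k i j (orb i z) = orb k z j"
  unfolding block_avg_def using orb_eq[of z k i j] consistent_iter[of k i "int (z i) + j"]
  by (simp add: orb_def add.assoc)

lemma block_avg_measurable [measurable]: "(\<lambda>z. block_avg k i j (pi_map z)) \<in> borel_measurable \<mu>"
  unfolding block_avg_def by measurable

text \<open>The block average of \<open>orb i z\<close> is exactly \<open>orb k z\<close>, and each
  coordinate of \<open>pi_map z\<close> is within \<open>2 * (1 / 2) ^ i\<close> of that of
  \<open>orb i z\<close> in mean. Averaging does not increase this error, whatever the number of
  terms, and the geometric bounds give convergence almost everywhere.\<close>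

lemma AE_block_avg: "AE z in \<mu>. \<forall>k j. (\<lambda>i. block_avg k i j (pi_map z)) \<longlonglongrightarrow> orb k z j"
  unfolding AE_all_countable
proof (intro allI)
  fix k j
  have "AE z in \<mu>. summable (\<lambda>i. norm (block_avg k (i + k) j (pi_map z) - orb k z j))"
  proof (rule AE_summable_geometric[where C = 2])
    fix i
    define d where "d = M (i + k) div M k"
    have "M (i + k) = d * M k" using moduli_dvd[OF moduli, of k "i + k"] by (simp add: d_def)
    then have d0: "d > 0" using M_pos[of "i + k"] by (auto intro: gr0I)
    let ?e = "\<lambda>l z. norm (pi_map z (j + int (l * M k)) - orb (i + k) z (j + int (l * M k)))"
    have "(\<integral>\<^sup>+z. ennreal (norm (block_avg k (i + k) j (pi_map z) - orb k z j)) \<partial>\<mu>) \<le>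
       (\<integral>\<^sup>+z. (\<Sum>l<d. ennreal (?e l z) * ennreal (1 / real d)) \<partial>\<mu>)"
    proof (rule nn_integral_mono)
      fix z assume "z \<in> space \<mu>"
      then have z: "z \<in> Z" by (simp add: space_mu)
      have "block_avg k (i + k) j (pi_map z) - orb k z j = block_avg k (i + k) j (pi_map z) - block_avg k (i + k) j (orb (i + k) z)"
        using block_avg_orb[OF z, of k "i + k" j] by simp
      also have "\<dots> = (\<Sum>l<d. pi_map z (j + int (l * M k)) - orb (i + k) z (j + int (l * M k))) / of_nat d"
        by (simp add: block_avg_def d_def[symmetric] sum_subtractf diff_divide_distrib)
      finally have "norm (block_avg k (i + k) j (pi_map z) - orb k z j) \<le> (\<Sum>l<d. ?e l z) / real d"
        by (simp add: norm_divide divide_right_mono norm_sum)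
      also have "\<dots> = (\<Sum>l<d. ?e l z * (1 / real d))" by (simp add: sum_divide_distrib)
      finally have "ennreal (norm (block_avg k (i + k) j (pi_map z) - orb k z j)) \<le> ennreal (\<Sum>l<d. ?e l z * (1 / real d))"
        by (rule ennreal_leI)
      also have "\<dots> = (\<Sum>l<d. ennreal (?e l z * (1 / real d)))" by (rule sum_ennreal[symmetric]) auto
      also have "\<dots> = (\<Sum>l<d. ennreal (?e l z) * ennreal (1 / real d))"
        by (intro sum.cong refl ennreal_mult) auto
      finally show "ennreal (norm (block_avg k (i + k) j (pi_map z) - orb k z j)) \<le>
          (\<Sum>l<d. ennreal (?e l z) * ennreal (1 / real d))" .
    qed
    also have "\<dots> = (\<Sum>l<d. (\<integral>\<^sup>+z. ennreal (?e l z) \<partial>\<mu>) * ennreal (1 / real d))"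
      by (simp add: nn_integral_sum nn_integral_multc)
    also have "\<dots> \<le> (\<Sum>l<d. ennreal (2 * (1 / 2) ^ (i + k)) * ennreal (1 / real d))"
      by (intro sum_mono mult_right_mono pi_error_nn_integral) auto
    also have "\<dots> = (\<Sum>l<d. ennreal ((2 * (1 / 2) ^ (i + k)) * (1 / real d)))"
      by (intro sum.cong refl ennreal_mult[symmetric]) auto
    also have "\<dots> = ennreal (\<Sum>l<d. (2 * (1 / 2) ^ (i + k)) * (1 / real d))"
      by (rule sum_ennreal) auto
    also have "(\<Sum>l<d. (2 * (1 / 2) ^ (i + k)) * (1 / real d)) = 2 * (1 / 2) ^ (i + k)" using d0 by simp
    also have "ennreal (2 * (1 / 2) ^ (i + k)) \<le> ennreal (2 * (1 / 2) ^ i)"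
      by (intro ennreal_leI mult_left_mono power_decreasing) auto
    finally show "(\<integral>\<^sup>+z. ennreal (norm (block_avg k (i + k) j (pi_map z) - orb k z j)) \<partial>\<mu>) \<le> ennreal (2 * (1 / 2) ^ i)" .
  qed auto
  then show "AE z in \<mu>. (\<lambda>i. block_avg k i j (pi_map z)) \<longlonglongrightarrow> orb k z j"
  proof eventually_elim
    case (elim z)
    have "(\<lambda>i. norm (block_avg k (i + k) j (pi_map z) - orb k z j)) \<longlonglongrightarrow> 0"
      by (rule summable_LIMSEQ_zero[OF elim])
    then have "(\<lambda>i. block_avg k (i + k) j (pi_map z)) \<longlonglongrightarrow> orb k z j"
      by (rule LIM_zero_cancel[OF tendsto_norm_zero_cancel])
    then show ?case by (rule LIMSEQ_offset)
  qed
qed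

abbreviation T :: "(nat \<Rightarrow> nat) \<Rightarrow> nat \<Rightarrow> nat" where "T \<equiv> odometer_add M (odometer_one M)"

lemma T_in: "z \<in> Z \<Longrightarrow> T z \<in> Z"
  by (rule odometer_add_closed[OF moduli odometer_one_in[OF moduli]])

lemma haar: "odometer_haar M \<mu>"
  by (rule uniform_odo_haar[OF moduli uni])

lemma T_measurable [measurable]: "T \<in> measurable \<mu> \<mu>"
  unfolding measurable_cong_sets[OF sets_mu sets_mu]
  by (rule odometer_add_measurable[OF moduli odometer_one_in[OF moduli]])

lemma distr_T: "distr \<mu> \<mu> T = \<mu>"
  using haar odometer_one_in[OF moduli] by (auto simp: odometer_haar_def)

lemma measure_T: "A \<in> sets \<mu> \<Longrightarrow> measure \<mu> (T -` A \<inter> space \<mu>) = measure \<mu> A"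
  using measure_distr[OF T_measurable, of A] distr_T by simp

lemma T_preserving: "measure_preserving_system \<mu> T"
  unfolding measure_preserving_system_def using prob_mu distr_T T_measurable by blast

lemma orb_T: "orb k (T z) j = orb k z (j + 1)"
proof -
  have "int (T z k) = (int (z k) + 1) mod int (M k)"
    by (simp add: odometer_add_one zmod_int add.commute)
  then show ?thesis by (simp only: orb_def a_add_mod add.assoc add.commute[of 1])
qed

lemma pi_T: "pi_map (T z) = shift_by 1 (pi_map z)"
  by (rule ext) (simp add: pi_map_def shift_by_def orb_T)

text \<open>\<open>T\<close> moves the cylinders of one level cyclically, so an invariant set meets
  them all in equal mass. Hence \<open>\<mu>\<close> conditioned on a non-null invariant set agrees
  with \<open>\<mu>\<close> on cylinders, and so everywhere.\<close>

lemma T_ergodic: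
  assumes A: "A \<in> sets \<mu>" and inv: "T -` A \<inter> space \<mu> = A"
  shows "measure \<mu> A = 0 \<or> measure \<mu> A = 1"
proof (rule disjCI)
  assume "measure \<mu> A \<noteq> 1"
  show "measure \<mu> A = 0"
  proof (rule ccontr)
    assume nz: "measure \<mu> A \<noteq> 0"
    have step: "measure \<mu> (A \<inter> odo_cyl M k b) = measure \<mu> (A \<inter> odo_cyl M k (Suc b))" if b: "Suc b < M k" for k b
    proof -
      have "A \<inter> odo_cyl M k b = T -` (A \<inter> odo_cyl M k (Suc b)) \<inter> space \<mu>"
      proof -
        \<comment> \<open>Since \<open>Suc b\<close> is positive, no point reaches it by wrapping
          around to 0.\<close>
        have "T z k = Suc b \<longleftrightarrow> z k = b" if z: "z \<in> Z" for z
        proof (cases "Suc (z k) = M k")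
          case True
          then show ?thesis using b by (simp add: odometer_add_one)
        next
          case False
          then have "Suc (z k) < M k" using odometer_space_less[OF z, of k] by simp
          then show ?thesis by (simp add: odometer_add_one)
        qed
        then have "odo_cyl M k b = T -` odo_cyl M k (Suc b) \<inter> space \<mu>"
          using T_in by (auto simp: odo_cyl_def space_mu)
        then show ?thesis using inv by blast
      qed
      then show ?thesis using measure_T[of "A \<inter> odo_cyl M k (Suc b)"] A by simp
    qed
    have const: "measure \<mu> (A \<inter> odo_cyl M k b) = measure \<mu> (A \<inter> odo_cyl M k 0)" if "b < M k" for k b
      using that by (induction b) (use step in auto)
    have cyl: "measure \<mu> (A \<inter> odo_cyl M k b) = measure \<mu> A / real (M k)" if b: "b < M k" for k b
    proof -
      have U: "(\<Union>c<M k. A \<inter> odo_cyl M k c) = A"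
        using sets.sets_into_space[OF A] odometer_space_less[of _ M k] by (auto simp: odo_cyl_def space_mu)
      have "measure \<mu> (\<Union>c<M k. A \<inter> odo_cyl M k c) = (\<Sum>c<M k. measure \<mu> (A \<inter> odo_cyl M k c))"
      proof (rule finite_measure_finite_Union)
        show "(\<lambda>c. A \<inter> odo_cyl M k c) ` {..<M k} \<subseteq> sets \<mu>" using A by auto
        show "disjoint_family_on (\<lambda>c. A \<inter> odo_cyl M k c) {..<M k}"
          by (auto simp: disjoint_family_on_def odo_cyl_def)
      qed simp
      then have "measure \<mu> A = (\<Sum>c<M k. measure \<mu> (A \<inter> odo_cyl M k c))" unfolding U .
      also have "\<dots> = (\<Sum>c<M k. measure \<mu> (A \<inter> odo_cyl M k b))"
      proof (rule sum.cong[OF refl])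
        fix c assume "c \<in> {..<M k}"
        then have "c < M k" by simp
        from trans[OF const[OF this] const[OF b, symmetric]]
        show "measure \<mu> (A \<inter> odo_cyl M k c) = measure \<mu> (A \<inter> odo_cyl M k b)" .
      qed
      finally show ?thesis by simp
    qed
    have "uniform_measure \<mu> A = \<mu>"
    proof (rule odo_measure_eqI[OF moduli])
      show "prob_space (uniform_measure \<mu> A)"
        using nz by (intro prob_space_uniform_measure) (auto simp: emeasure_eq_measure)
      show "measure (uniform_measure \<mu> A) (odo_cyl M k b) = measure \<mu> (odo_cyl M k b)" for k b
      proof (cases "b < M k")
        case True
        then show ?thesis using nz A cyl[OF True] measure_cyl[OF True]
          by (subst measure_uniform_measure) (auto simp: emeasure_eq_measure)
      qed (simp add: odo_cyl_empty)
    qed (auto simp: prob_mu sets_mu)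
    then have "measure \<mu> A = measure (uniform_measure \<mu> A) A" by simp
    also have "\<dots> = 1" using nz A by (subst measure_uniform_measure) (auto simp: emeasure_eq_measure)
    finally show False using \<open>measure \<mu> A \<noteq> 1\<close> by simp
  qed
qed

end

section \<open>Furstenberg systems\<close>

definition unit_cube :: "(int \<Rightarrow> complex) set" where
  "unit_cube = {x. \<forall>j. norm (x j) \<le> 1}"

lemma compact_unit_cube: "compact unit_cube"
proof -
  have eq: "unit_cube = Pi\<^sub>E UNIV (\<lambda>_. cball 0 1)" by (auto simp: unit_cube_def)
  have "compactin (product_topology (\<lambda>i::int. euclidean :: complex topology) UNIV) (Pi\<^sub>E UNIV (\<lambda>_. cball 0 1))"
    by (subst compactin_PiE) (simp add: compactin_euclidean_iff)
  then show ?thesis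
    unfolding eq euclidean_product_topology[symmetric] compactin_euclidean_iff[symmetric] .
qed

lemma continuous_coordinate [continuous_intros]: "continuous_on A (\<lambda>x::'i \<Rightarrow> 'b::topological_space. x i)"
  by (rule continuous_on_subset[OF continuous_on_product_coordinates]) simp

lemma continuous_shift_by: "continuous_on A (shift_by n)"
  unfolding shift_by_def by (intro continuous_on_coordinatewise_then_product continuous_coordinate)

text \<open>Uniform continuity on a compact set, in linear form. If finitely many coordinates are
  close, the variation is below \<open>\<epsilon>\<close>; otherwise \<open>C\<close> times their
  distance reaches twice a bound of \<open>\<phi>\<close>. A linear majorant can be averaged and
  integrated, as approximation in mean requires.\<close>

lemma cube_modulus:
  fixes \<phi> :: "(int \<Rightarrow> complex) \<Rightarrow> 'b::real_normed_vector"
  assumes cont: "continuous_on unit_cube \<phi>" and e: "\<epsilon> > 0"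
  obtains C J where "C \<ge> 0" "finite J"
    "\<And>x y. x \<in> unit_cube \<Longrightarrow> y \<in> unit_cube \<Longrightarrow> norm (\<phi> x - \<phi> y) \<le> \<epsilon> + C * (\<Sum>j\<in>J. norm (x j - y j))"
proof -
  have "uniformly_continuous_on unit_cube \<phi>"
    by (rule compact_uniformly_continuous[OF cont compact_unit_cube])
  then obtain \<delta> where d: "\<delta> > 0"
    and uc: "\<And>x y. x \<in> unit_cube \<Longrightarrow> y \<in> unit_cube \<Longrightarrow> dist y x < \<delta> \<Longrightarrow> dist (\<phi> y) (\<phi> x) < \<epsilon>"
    using e unfolding uniformly_continuous_on_def by metis
  have "bounded (\<phi> ` unit_cube)"
    by (intro compact_imp_bounded compact_continuous_image cont compact_unit_cube)
  then obtain B where B: "B > 0" "\<And>x. x \<in> unit_cube \<Longrightarrow> norm (\<phi> x) \<le> B"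
    unfolding bounded_pos by auto
  \<comment> \<open>In the product metric the coordinates of index up to \<open>N\<close> contribute
    less than \<open>2 * (\<delta> / 4)\<close> and the others at most \<open>(1 / 2) ^ N\<close>;
    together this stays below \<open>\<delta>\<close>.\<close>
  obtain N where N: "(1 / 2) ^ N < \<delta> / 2"
    using real_arch_pow_inv[of "\<delta> / 2" "1 / 2"] d by auto
  define J where "J = (from_nat :: nat \<Rightarrow> int) ` {..N}"
  define C where "C = 8 * B / \<delta>"
  show ?thesis
  proof
    show "C \<ge> 0" using B d by (simp add: C_def)
    show "finite J" by (simp add: J_def)
    fix x y assume xy: "x \<in> unit_cube" "y \<in> unit_cube"
    define s where "s = (\<Sum>j\<in>J. norm (x j - y j))"
    have s0: "s \<ge> 0" unfolding s_def by (rule sum_nonneg) simp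
    show "norm (\<phi> x - \<phi> y) \<le> \<epsilon> + C * (\<Sum>j\<in>J. norm (x j - y j))"
    proof (cases "s < \<delta> / 4")
      case True
      let ?D = "{dist (x (from_nat n)) (y (from_nat n))|n. n \<le> N}"
      have img: "?D = (\<lambda>n. dist (x (from_nat n)) (y (from_nat n))) ` {..N}" by auto
      have "Max ?D \<le> s"
      proof (rule Max.boundedI)
        show "finite ?D" unfolding img by simp
        show "?D \<noteq> {}" unfolding img by simp
        fix r assume "r \<in> ?D"
        then obtain n where n: "r = norm (x (from_nat n) - y (from_nat n))" "n \<le> N" by (auto simp: dist_norm)
        show "r \<le> s" unfolding n(1) s_def
          by (rule member_le_sum[of "from_nat n" J "\<lambda>j. norm (x j - y j)"]) (use n in \<open>auto simp: J_def\<close>)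
      qed
      moreover have "dist x y \<le> 2 * Max ?D + (1 / 2) ^ N" by (rule dist_fun_le_dist_first_terms)
      ultimately have "dist x y < \<delta>" using True N by linarith
      then have "norm (\<phi> x - \<phi> y) < \<epsilon>" using uc[OF xy(2,1)] by (simp add: dist_norm)
      moreover have "C * s \<ge> 0" using s0 B d by (simp add: C_def)
      ultimately show ?thesis by (simp add: s_def)
    next
      case False
      have "norm (\<phi> x - \<phi> y) \<le> B + B"
        by (rule order_trans[OF norm_triangle_ineq4]) (intro add_mono B xy)
      also have "\<dots> = C * (\<delta> / 4)" using d by (simp add: C_def)
      also have "\<dots> \<le> C * s" using False B d by (intro mult_left_mono) (auto simp: C_def)
      finally show ?thesis using e by (simp add: s_def)
    qed
  qed
qed

text \<open>The continuous functions \<open>max 0 (1 - k * infdist x C)\<close> decrease to the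
  indicator of a nonempty closed set \<open>C\<close>, and the closed sets are a generator stable
  under intersection.\<close>

lemma prob_measure_eqI_continuous:
  fixes X :: "'a::metric_space set" and \<nu>1 \<nu>2 :: "'a measure"
  assumes X: "closed X" and \<nu>: "\<nu>1 \<in> prob_measures_on X" "\<nu>2 \<in> prob_measures_on X"
    and eq: "\<And>\<phi> :: 'a \<Rightarrow> complex. continuous_on X \<phi> \<Longrightarrow> integral\<^sup>L \<nu>1 \<phi> = integral\<^sup>L \<nu>2 \<phi>"
  shows "\<nu>1 = \<nu>2"
proof -
  have lim: "(\<lambda>k. \<integral>x. complex_of_real (max 0 (1 - real k * infdist x C)) \<partial>\<nu>) \<longlonglongrightarrow> complex_of_real (measure \<nu> (C \<inter> X))"
    if \<nu>: "\<nu> \<in> prob_measures_on X" and C: "closed C" "C \<noteq> {}" for \<nu> C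
  proof -
    have p: "prob_space \<nu>" and s: "sets \<nu> = sets (restrict_space borel X)" using \<nu> by (auto simp: prob_measures_on_def)
    interpret prob_space \<nu> by (rule p)
    have sp: "space \<nu> = X" using sets_eq_imp_space_eq[OF s] by (simp add: space_restrict_space)
    have meas: "(\<lambda>x. complex_of_real (max 0 (1 - real k * infdist x C))) \<in> borel_measurable \<nu>" for k
      unfolding measurable_cong_sets[OF s refl]
      by (rule borel_measurable_continuous_on_restrict) (intro continuous_intros)
    have CX: "C \<inter> X \<in> sets \<nu>" unfolding s sets_restrict_space using C by auto
    have "(\<lambda>k. \<integral>x. complex_of_real (max 0 (1 - real k * infdist x C)) \<partial>\<nu>) \<longlonglongrightarrow> (\<integral>x. complex_of_real (indicator (C \<inter> X) x) \<partial>\<nu>)"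
    proof (rule integral_dominated_convergence[where w = "\<lambda>_. 1"])
      show "AE x in \<nu>. (\<lambda>k. complex_of_real (max 0 (1 - real k * infdist x C))) \<longlonglongrightarrow> complex_of_real (indicator (C \<inter> X) x)"
      proof (rule AE_I2)
        fix x assume "x \<in> space \<nu>"
        then have x: "x \<in> X" by (simp add: sp)
        show "(\<lambda>k. complex_of_real (max 0 (1 - real k * infdist x C))) \<longlonglongrightarrow> complex_of_real (indicator (C \<inter> X) x)"
        proof (cases "x \<in> C")
          case True
          then show ?thesis using x by simp
        next
          case False
          then have pos: "infdist x C > 0" using infdist_pos_not_in_closed[OF C(1,2)] by blast
          obtain n :: nat where n: "real n > 1 / infdist x C" using reals_Archimedean2 by blast
          have "\<forall>\<^sub>F k in sequentially. complex_of_real (max 0 (1 - real k * infdist x C)) = 0"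
          proof (rule eventually_sequentiallyI[of n])
            fix k assume "n \<le> k"
            then have "real k > 1 / infdist x C" using n by linarith
            then have "real k * infdist x C > 1" using pos by (simp add: field_simps)
            then show "complex_of_real (max 0 (1 - real k * infdist x C)) = 0" by simp
          qed
          then have "(\<lambda>k. complex_of_real (max 0 (1 - real k * infdist x C))) \<longlonglongrightarrow> 0" by (rule tendsto_eventually)
          then show ?thesis using False by simp
        qed
      qed
      show "AE x in \<nu>. norm (complex_of_real (max 0 (1 - real k * infdist x C))) \<le> 1" for k
      proof (rule AE_I2)
        fix x
        have "real k * infdist x C \<ge> 0" by (simp add: infdist_nonneg)
        then show "norm (complex_of_real (max 0 (1 - real k * infdist x C))) \<le> 1" unfolding norm_of_real by linarith
      qed
      show "(\<lambda>x. complex_of_real (indicator (C \<inter> X) x)) \<in> borel_measurable \<nu>" using CX by measurable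
    qed (use meas in auto)
    moreover have "(\<integral>x. complex_of_real (indicator (C \<inter> X) x) \<partial>\<nu>) = complex_of_real (measure \<nu> (C \<inter> X))"
      using sp by (simp add: Int_assoc)
    ultimately show ?thesis by simp
  qed
  have closed_eq: "measure \<nu>1 (C \<inter> X) = measure \<nu>2 (C \<inter> X)" if C: "closed C" for C
  \<comment> \<open>The distance \<open>infdist\<close> to the empty set is 0 by convention, so the
    limit formula fails there.\<close>
  proof (cases "C = {}")
    case False
    have "complex_of_real (measure \<nu>1 (C \<inter> X)) = complex_of_real (measure \<nu>2 (C \<inter> X))"
    proof (rule LIMSEQ_unique[OF lim[OF \<nu>(1) C False]])
      have "(\<integral>x. complex_of_real (max 0 (1 - real k * infdist x C)) \<partial>\<nu>1) =
          (\<integral>x. complex_of_real (max 0 (1 - real k * infdist x C)) \<partial>\<nu>2)" for k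
        by (rule eq) (intro continuous_intros)
      then show "(\<lambda>k. \<integral>x. complex_of_real (max 0 (1 - real k * infdist x C)) \<partial>\<nu>1) \<longlonglongrightarrow> complex_of_real (measure \<nu>2 (C \<inter> X))"
        using lim[OF \<nu>(2) C False] by simp
    qed
    then show ?thesis by simp
  qed simp
  have p: "prob_space \<nu>1" "prob_space \<nu>2" and s: "sets \<nu>1 = sets (restrict_space borel X)" "sets \<nu>2 = sets (restrict_space borel X)"
    using \<nu> by (auto simp: prob_measures_on_def)
  have sp: "space \<nu>1 = X" "space \<nu>2 = X"
    using sets_eq_imp_space_eq[OF s(1)] sets_eq_imp_space_eq[OF s(2)] by (auto simp: space_restrict_space)
  interpret \<nu>1: prob_space \<nu>1 by (rule p)
  interpret \<nu>2: prob_space \<nu>2 by (rule p)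
  have id: "(\<lambda>x. x) \<in> measurable \<nu>1 borel" "(\<lambda>x. x) \<in> measurable \<nu>2 borel"
    unfolding measurable_cong_sets[OF s(1) refl] measurable_cong_sets[OF s(2) refl]
    by (rule measurable_restrict_space1, simp)+
  have d: "emeasure (distr \<nu>1 borel (\<lambda>x. x)) A = ennreal (measure \<nu>1 (A \<inter> X))"
    "emeasure (distr \<nu>2 borel (\<lambda>x. x)) A = ennreal (measure \<nu>2 (A \<inter> X))" if "A \<in> sets borel" for A
    using that by (simp_all add: emeasure_distr id sp \<nu>1.emeasure_eq_measure \<nu>2.emeasure_eq_measure)
  have borel_eq: "distr \<nu>1 borel (\<lambda>x. x) = distr \<nu>2 borel (\<lambda>x. x)"
  proof (rule measure_eqI_generator_eq[where E = "Collect closed" and \<Omega> = UNIV and A = "\<lambda>_. UNIV"])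
    show "Int_stable (Collect closed :: 'a set set)" by (auto simp: Int_stable_def)
    show "emeasure (distr \<nu>1 borel (\<lambda>x. x)) C = emeasure (distr \<nu>2 borel (\<lambda>x. x)) C" if "C \<in> Collect closed" for C
      using that by (simp add: d closed_eq)
    have "sets (borel :: 'a measure) = sigma_sets UNIV (Collect closed)"
      by (subst borel_eq_closed) (simp add: sets_measure_of)
    then show "sets (distr \<nu>1 borel (\<lambda>x. x)) = sigma_sets UNIV (Collect closed)"
      "sets (distr \<nu>2 borel (\<lambda>x. x)) = sigma_sets UNIV (Collect closed)" by simp_all
  qed (auto simp: d)
  show ?thesis
  proof (rule measure_eqI)
    show "sets \<nu>1 = sets \<nu>2" using s by simp
    fix A assume "A \<in> sets \<nu>1"
    then obtain B where B: "B \<in> sets borel" "A = X \<inter> B" unfolding s(1) sets_restrict_space by auto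
    then have "A = B \<inter> X" by auto
    then show "emeasure \<nu>1 A = emeasure \<nu>2 A"
      using d[OF B(1)] borel_eq by (simp add: \<nu>1.emeasure_eq_measure \<nu>2.emeasure_eq_measure)
  qed
qed

lemma closed_orbit_closure: "closed (orbit_closure f)"
  by (simp add: orbit_closure_def)

lemma shift_in_orbit_closure: "shift_by n (extend_by_zero f) \<in> orbit_closure f"
  unfolding orbit_closure_def using closure_subset[of "range (\<lambda>n. shift_by n (extend_by_zero f))"] by blast

lemma shift_by_shift_by: "shift_by m (shift_by n x) = shift_by (m + n) x"
  by (simp add: shift_by_def add.assoc)

lemma shift_by_0: "shift_by 0 x = x"
  by (simp add: shift_by_def)

lemma orbit_closure_shift:
  assumes "x \<in> orbit_closure f"
  shows "shift_by m x \<in> orbit_closure f"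
proof -
  have "shift_by m ` orbit_closure f \<subseteq> orbit_closure f"
    unfolding orbit_closure_def
    by (rule image_closure_subset[OF continuous_shift_by])
      (use shift_in_orbit_closure[unfolded orbit_closure_def] in \<open>auto simp: shift_by_shift_by\<close>)
  then show ?thesis using assms by blast
qed

lemma orbit_closure_shift_iff: "shift_by 1 x \<in> orbit_closure f \<longleftrightarrow> x \<in> orbit_closure f"
  using orbit_closure_shift[of x f 1] orbit_closure_shift[of "shift_by 1 x" f "- 1"]
  by (auto simp: shift_by_shift_by shift_by_0)

lemma shift_extend_in_cube:
  assumes "\<And>n. n > 0 \<Longrightarrow> norm (f n) \<le> 1"
  shows "shift_by n (extend_by_zero f) \<in> unit_cube"
  using assms by (auto simp: unit_cube_def shift_by_def extend_by_zero_def)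

lemma orbit_closure_subset_cube:
  assumes "\<And>n. n > 0 \<Longrightarrow> norm (f n) \<le> 1"
  shows "orbit_closure f \<subseteq> unit_cube"
  unfolding orbit_closure_def
  by (rule closure_minimal) (use shift_extend_in_cube[OF assms] compact_imp_closed[OF compact_unit_cube] in auto)

lemma integral_empirical_measure:
  fixes \<phi> :: "(int \<Rightarrow> complex) \<Rightarrow> complex"
  assumes \<phi>: "continuous_on (orbit_closure f) \<phi>"
  shows "integral\<^sup>L (empirical_measure f N) \<phi> = avg (\<lambda>n. \<phi> (shift_by (int n) (extend_by_zero f))) N"
proof -
  have "integral\<^sup>L (empirical_measure f N) \<phi> =
      (\<integral>n. \<phi> (shift_by (int n) (extend_by_zero f)) \<partial>uniform_count_measure {1..N})"
    unfolding empirical_measure_def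
  proof (rule integral_distr)
    show "(\<lambda>n. shift_by (int n) (extend_by_zero f)) \<in> uniform_count_measure {1..N} \<rightarrow>\<^sub>M restrict_space borel (orbit_closure f)"
      by (rule measurableI) (auto simp: space_restrict_space shift_in_orbit_closure)
    show "\<phi> \<in> borel_measurable (restrict_space borel (orbit_closure f))"
      by (rule borel_measurable_continuous_on_restrict[OF \<phi>])
  qed
  also have "\<dots> = avg (\<lambda>n. \<phi> (shift_by (int n) (extend_by_zero f))) N"
    unfolding uniform_count_measure_def
    by (subst lebesgue_integral_point_measure_finite) (auto simp: avg_def scaleR_sum_right divide_inverse)
  finally show ?thesis .
qed

text \<open>A unit shift in either direction gains one term and loses another, both in
  [0, 2].\<close>

lemma sum_int_shift_le:
  fixes w :: "int \<Rightarrow> real"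
  assumes w: "\<And>j. 0 \<le> w j" "\<And>j. w j \<le> 2"
  shows "(\<Sum>n\<in>{1..N}. w (int n + j)) \<le> (\<Sum>n\<in>{1..N}. w (int n)) + 2 * real_of_int \<bar>j\<bar>"
proof -
  have tel: "(\<Sum>n\<in>{1..N}. w (int n + (j + 1))) + w (j + 1) = (\<Sum>n\<in>{1..N}. w (int n + j)) + w (int N + (j + 1))" for j
    by (induction N) (auto simp: algebra_simps)
  have up: "(\<Sum>n\<in>{1..N}. w (int n + (j + 1))) \<le> (\<Sum>n\<in>{1..N}. w (int n + j)) + 2" for j
    using tel[of j] w(1)[of "j + 1"] w(2)[of "int N + (j + 1)"] by linarith
  have down: "(\<Sum>n\<in>{1..N}. w (int n + j)) \<le> (\<Sum>n\<in>{1..N}. w (int n + (j + 1))) + 2" for j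
    using tel[of j] w(2)[of "j + 1"] w(1)[of "int N + (j + 1)"] by linarith
  have pos: "(\<Sum>n\<in>{1..N}. w (int n + int m)) \<le> (\<Sum>n\<in>{1..N}. w (int n)) + 2 * real m" for m
  proof (induction m)
    case (Suc m)
    have "(\<Sum>n\<in>{1..N}. w (int n + int (Suc m))) = (\<Sum>n\<in>{1..N}. w (int n + (int m + 1)))"
      by (simp add: add.commute)
    also have "\<dots> \<le> (\<Sum>n\<in>{1..N}. w (int n + int m)) + 2" by (rule up)
    also have "\<dots> \<le> (\<Sum>n\<in>{1..N}. w (int n)) + 2 * real m + 2" using Suc by (rule add_right_mono)
    finally show ?case by simp
  qed simp
  have neg: "(\<Sum>n\<in>{1..N}. w (int n + (- int m))) \<le> (\<Sum>n\<in>{1..N}. w (int n)) + 2 * real m" for m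
  proof (induction m)
    case (Suc m)
    have "(\<Sum>n\<in>{1..N}. w (int n + - int (Suc m))) \<le> (\<Sum>n\<in>{1..N}. w (int n + (- int (Suc m) + 1))) + 2"
      by (rule down)
    also have "(\<Sum>n\<in>{1..N}. w (int n + (- int (Suc m) + 1))) = (\<Sum>n\<in>{1..N}. w (int n + - int m))" by simp
    also have "\<dots> + 2 \<le> (\<Sum>n\<in>{1..N}. w (int n)) + 2 * real m + 2" using Suc by (rule add_right_mono)
    finally show ?case by simp
  qed simp
  show ?thesis
  proof (cases "j \<ge> 0")
    case True
    then show ?thesis using pos[of "nat j"] by simp
  next
    case False
    then show ?thesis using neg[of "nat (- j)"] by simp
  qed
qed

section \<open>The limit measure of a RAP sequence\<close>

locale rap_system = coding_system + bounded_RAP +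
  assumes approx: "\<forall>\<^sub>F N in sequentially. avg (\<lambda>n. norm (f n - a k (int n))) N < (1 / 2) ^ k"
begin

abbreviation f_hat :: "int \<Rightarrow> complex" where "f_hat \<equiv> extend_by_zero f"

abbreviation X :: "(int \<Rightarrow> complex) set" where "X \<equiv> orbit_closure f"

lemma X_subset_cube: "X \<subseteq> unit_cube"
  by (rule orbit_closure_subset_cube[OF f_bound])

lemma compact_X: "compact X"
  using compact_Int_closed[OF compact_unit_cube closed_orbit_closure, of f] X_subset_cube by (simp add: Int_absorb1)

lemma AE_pi_cube: "AE z in \<mu>. pi_map z \<in> unit_cube"
  using AE_orb_steps_summable
proof eventually_elim
  case (elim z)
  have "norm (pi_map z j) \<le> 1" for j
    by (rule tendsto_upperbound[OF tendsto_norm[OF orb_limit(1)]]) (use elim bound in \<open>auto simp: orb_def\<close>)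
  then show ?case by (simp add: unit_cube_def)
qed

lemma orb_in_cube: "orb k z \<in> unit_cube"
  using bound by (simp add: orb_def unit_cube_def)

lemma integrable_pi:
  fixes \<phi> :: "(int \<Rightarrow> complex) \<Rightarrow> 'b::{banach, second_countable_topology}"
  assumes cont: "continuous_on UNIV \<phi>"
  shows "integrable \<mu> (\<lambda>z. \<phi> (pi_map z))"
proof -
  have "bounded (\<phi> ` unit_cube)"
    using cont by (intro compact_imp_bounded compact_continuous_image compact_unit_cube) (rule continuous_on_subset, auto)
  then obtain B where B: "\<And>x. x \<in> unit_cube \<Longrightarrow> norm (\<phi> x) \<le> B" unfolding bounded_pos by auto
  have "\<phi> \<in> borel_measurable borel" by (rule borel_measurable_continuous_onI[OF cont])
  then have meas: "(\<lambda>z. \<phi> (pi_map z)) \<in> borel_measurable \<mu>"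
    by (rule measurable_compose[OF pi_measurable])
  show ?thesis
    by (rule integrable_const_bound[OF _ meas, of B]) (use AE_pi_cube in eventually_elim, rule B)
qed

lemma pi_error_integral:
  "integrable \<mu> (\<lambda>z. norm (pi_map z j - orb k z j))"
  "(\<integral>z. norm (pi_map z j - orb k z j) \<partial>\<mu>) \<le> 2 * (1 / 2) ^ k"
proof -
  show "integrable \<mu> (\<lambda>z. norm (pi_map z j - orb k z j))"
  proof (rule integrable_const_bound[of _ 2])
    show "AE z in \<mu>. norm (norm (pi_map z j - orb k z j)) \<le> 2"
      using AE_pi_cube
    proof eventually_elim
      case (elim z)
      have "norm (pi_map z j - orb k z j) \<le> 1 + 1"
        using elim orb_in_cube[of k z]
        by (intro order_trans[OF norm_triangle_ineq4 add_mono]) (auto simp: unit_cube_def)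
      then show ?case by simp
    qed
  qed measurable
  show "(\<integral>z. norm (pi_map z j - orb k z j) \<partial>\<mu>) \<le> 2 * (1 / 2) ^ k"
    by (rule integral_real_bounded[OF _ pi_error_nn_integral]) simp
qed

lemma avg_shifted_error:
  "\<forall>\<^sub>F N in sequentially. avg (\<lambda>n. norm (f_hat (j + int n) - a k (j + int n))) N \<le> 2 * (1 / 2) ^ k"
proof -
  have "(1 / 2) ^ k > (0::real)" by simp
  from order_tendstoD(2)[OF lim_const_over_n this]
  have "\<forall>\<^sub>F N in sequentially. 2 * real_of_int \<bar>j\<bar> / real N < (1 / 2) ^ k" .
  with approx[of k] show ?thesis
  proof eventually_elim
    case (elim N)
    have fb: "norm (f_hat i) \<le> 1" for i using f_bound by (simp add: extend_by_zero_def)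
    have "(\<Sum>n\<in>{1..N}. norm (f_hat (int n + j) - a k (int n + j))) \<le>
      (\<Sum>n\<in>{1..N}. norm (f_hat (int n) - a k (int n))) + 2 * real_of_int \<bar>j\<bar>"
    proof (rule sum_int_shift_le[of "\<lambda>i. norm (f_hat i - a k i)"])
      show "norm (f_hat i - a k i) \<le> 2" for i
        using order_trans[OF norm_triangle_ineq4 add_mono[OF fb bound], of i k i] by simp
    qed simp
    also have "(\<Sum>n\<in>{1..N}. norm (f_hat (int n) - a k (int n))) = (\<Sum>n\<in>{1..N}. norm (f n - a k (int n)))"
      by (intro sum.cong) (auto simp: extend_by_zero_def)
    finally have "avg (\<lambda>n. norm (f_hat (j + int n) - a k (j + int n))) N \<le>
       ((\<Sum>n\<in>{1..N}. norm (f n - a k (int n))) + 2 * real_of_int \<bar>j\<bar>) / real N"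
      unfolding avg_real add.commute[of j] by (rule divide_right_mono) simp
    also have "\<dots> = avg (\<lambda>n. norm (f n - a k (int n))) N + 2 * real_of_int \<bar>j\<bar> / real N"
      by (simp add: avg_real add_divide_distrib)
    finally show ?case using elim by linarith
  qed
qed

text \<open>At level \<open>k\<close> the values of \<open>\<phi>\<close> along the orbit are close
  in mean to a function of \<open>n\<close> modulo \<open>M k\<close>, whose average tends to the
  integral of \<open>\<phi> (orb k z)\<close>. This integral is close to that of
  \<open>\<phi> (pi_map z)\<close>. Both comparisons use the linear bound of
  \<open>cube_modulus\<close>.\<close>

lemma empirical_convergence:
  fixes \<phi> :: "(int \<Rightarrow> complex) \<Rightarrow> complex"
  assumes cont: "continuous_on UNIV \<phi>"
  shows "avg (\<lambda>n. \<phi> (shift_by (int n) f_hat)) \<longlonglongrightarrow> (\<integral>z. \<phi> (pi_map z) \<partial>\<mu>)"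
proof (rule LIMSEQ_I)
  fix r :: real assume r: "r > 0"
  \<comment> \<open>The three comparisons cost at most \<open>2 * \<epsilon>\<close>,
    \<open>\<epsilon>\<close> and \<open>2 * \<epsilon>\<close>.\<close>
  define \<epsilon> where "\<epsilon> = r / 8"
  have e: "\<epsilon> > 0" using r by (simp add: \<epsilon>_def)
  obtain C J where C: "C \<ge> 0" and J: "finite J" and mod: "\<And>x y. x \<in> unit_cube \<Longrightarrow> y \<in> unit_cube \<Longrightarrow>
      norm (\<phi> x - \<phi> y) \<le> \<epsilon> + C * (\<Sum>j\<in>J. norm (x j - y j))"
    using cube_modulus[OF continuous_on_subset[OF cont subset_UNIV] e] by metis
  define D where "D = C * real (card J) * 2"
  have D: "D \<ge> 0" using C by (simp add: D_def)
  obtain k where "(1 / 2) ^ k < \<epsilon> / (D + 1)"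
    using real_arch_pow_inv[of "\<epsilon> / (D + 1)" "1 / 2"] e D by auto
  then have "(1 / 2) ^ k * (D + 1) < \<epsilon>" using D by (simp add: pos_less_divide_eq)
  then have "(1 / 2) ^ k + D * (1 / 2) ^ k < \<epsilon>" by (simp add: algebra_simps)
  moreover have "(1 / 2) ^ k > (0::real)" by simp
  ultimately have k: "D * (1 / 2) ^ k < \<epsilon>" by linarith
  define u where "u b = \<phi> (\<lambda>j. a k (int b + j))" for b :: nat
  have u_orb: "\<phi> (orb k z) = u (z k)" for z by (simp add: u_def orb_def[abs_def])
  have limu: "avg u \<longlonglongrightarrow> (\<Sum>b<M k. u b) /\<^sub>R real (M k)"
  proof (rule avg_periodic_tendsto)
    have "a k (int (n + M k) + j) = a k (int n + j)" for n j
      using per[of k "int n + j"] by (simp add: algebra_simps)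
    then show "u (n + M k) = u n" for n by (simp only: u_def)
  qed simp
  have int1: "norm ((\<Sum>b<M k. u b) /\<^sub>R real (M k) - (\<integral>z. \<phi> (pi_map z) \<partial>\<mu>)) \<le> 2 * \<epsilon>"
  proof -
    have i1: "integrable \<mu> (\<lambda>z. u (z k))" by (rule integrable_coordinate)
    have i2: "integrable \<mu> (\<lambda>z. \<phi> (pi_map z))" by (rule integrable_pi[OF cont])
    have i3: "integrable \<mu> (\<lambda>z. \<epsilon> + C * (\<Sum>j\<in>J. norm (pi_map z j - orb k z j)))"
      by (intro Bochner_Integration.integrable_add integrable_mult_right Bochner_Integration.integrable_sum
          pi_error_integral) simp
    have "norm ((\<Sum>b<M k. u b) /\<^sub>R real (M k) - (\<integral>z. \<phi> (pi_map z) \<partial>\<mu>)) = norm (\<integral>z. u (z k) - \<phi> (pi_map z) \<partial>\<mu>)"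
      using i1 i2 by (simp add: integral_coordinate)
    also have "\<dots> \<le> (\<integral>z. norm (u (z k) - \<phi> (pi_map z)) \<partial>\<mu>)" by (rule integral_norm_bound)
    also have "\<dots> \<le> (\<integral>z. \<epsilon> + C * (\<Sum>j\<in>J. norm (pi_map z j - orb k z j)) \<partial>\<mu>)"
    proof (rule integral_mono_AE)
      show "integrable \<mu> (\<lambda>z. norm (u (z k) - \<phi> (pi_map z)))" using i1 i2 by simp
      show "AE z in \<mu>. norm (u (z k) - \<phi> (pi_map z)) \<le> \<epsilon> + C * (\<Sum>j\<in>J. norm (pi_map z j - orb k z j))"
        using AE_pi_cube
        by eventually_elim (use mod[OF _ orb_in_cube] in \<open>auto simp: u_orb[symmetric] norm_minus_commute\<close>)
    qed (rule i3)
    also have "\<dots> = \<epsilon> + C * (\<Sum>j\<in>J. \<integral>z. norm (pi_map z j - orb k z j) \<partial>\<mu>)"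
      using pi_error_integral(1) by (simp add: prob_space)
    also have "\<dots> \<le> \<epsilon> + C * (\<Sum>j\<in>J. 2 * (1 / 2) ^ k)"
      using C by (intro add_left_mono mult_left_mono sum_mono pi_error_integral(2))
    also have "\<dots> = \<epsilon> + D * (1 / 2) ^ k" by (simp add: D_def)
    finally show ?thesis using k by linarith
  qed
  have "\<forall>\<^sub>F N in sequentially. \<forall>j\<in>J. avg (\<lambda>n. norm (f_hat (j + int n) - a k (j + int n))) N \<le> 2 * (1 / 2) ^ k"
    using J avg_shifted_error by (intro eventually_ball_finite) auto
  moreover have "\<forall>\<^sub>F N in sequentially. norm (avg u N - (\<Sum>b<M k. u b) /\<^sub>R real (M k)) < \<epsilon>"
    using tendstoD[OF limu e] by (simp add: dist_norm)
  ultimately have "\<forall>\<^sub>F N in sequentially. norm (avg (\<lambda>n. \<phi> (shift_by (int n) f_hat)) N - (\<integral>z. \<phi> (pi_map z) \<partial>\<mu>)) < r"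
  proof eventually_elim
    case (elim N)
    have "norm (avg (\<lambda>n. \<phi> (shift_by (int n) f_hat)) N - avg u N) \<le> avg (\<lambda>n. norm (\<phi> (shift_by (int n) f_hat) - u n)) N"
      unfolding avg_diff[symmetric] by (rule norm_avg_le)
    also have "\<dots> \<le> avg (\<lambda>n. \<epsilon> + C * (\<Sum>j\<in>J. norm (f_hat (j + int n) - a k (j + int n)))) N"
    proof (rule avg_mono)
      fix n
      have "norm (\<phi> (shift_by (int n) f_hat) - \<phi> (\<lambda>j. a k (int n + j))) \<le>
          \<epsilon> + C * (\<Sum>j\<in>J. norm (shift_by (int n) f_hat j - a k (int n + j)))"
        by (rule mod) (use shift_extend_in_cube[OF f_bound] bound in \<open>auto simp: unit_cube_def\<close>)
      then show "norm (\<phi> (shift_by (int n) f_hat) - u n) \<le> \<epsilon> + C * (\<Sum>j\<in>J. norm (f_hat (j + int n) - a k (j + int n)))"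
        by (simp add: u_def shift_by_def add.commute)
    qed
    also have "\<dots> = avg (\<lambda>_. \<epsilon>) N + C * (\<Sum>j\<in>J. avg (\<lambda>n. norm (f_hat (j + int n) - a k (j + int n))) N)"
      by (simp add: avg_add avg_mult_left avg_sum)
    also have "\<dots> \<le> \<epsilon> + C * (\<Sum>j\<in>J. 2 * (1 / 2) ^ k)"
    proof (rule add_mono)
      show "avg (\<lambda>_. \<epsilon>) N \<le> \<epsilon>" using e by (intro avg_le_bound) auto
    qed (use elim(1) C in \<open>intro mult_left_mono sum_mono, auto\<close>)
    also have "\<dots> = \<epsilon> + D * (1 / 2) ^ k" by (simp add: D_def)
    finally have "norm (avg (\<lambda>n. \<phi> (shift_by (int n) f_hat)) N - avg u N) \<le> 2 * \<epsilon>" using k by linarith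
    then have "norm ((avg (\<lambda>n. \<phi> (shift_by (int n) f_hat)) N - avg u N) + (avg u N - (\<Sum>b<M k. u b) /\<^sub>R real (M k))
        + ((\<Sum>b<M k. u b) /\<^sub>R real (M k) - (\<integral>z. \<phi> (pi_map z) \<partial>\<mu>))) \<le> 2 * \<epsilon> + \<epsilon> + 2 * \<epsilon>"
      using elim(2) int1 by (intro norm_triangle_mono) auto
    then show ?case using e by (simp add: \<epsilon>_def)
  qed
  then show "\<exists>no. \<forall>n\<ge>no. norm (avg (\<lambda>n. \<phi> (shift_by (int n) f_hat)) n - (\<integral>z. \<phi> (pi_map z) \<partial>\<mu>)) < r"
    unfolding eventually_sequentially .
qed

text \<open>The distance to \<open>X\<close> is a continuous observable that vanishes along the
  orbit of \<open>f\<close>, so its integral is 0.\<close>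

lemma AE_pi_X: "AE z in \<mu>. pi_map z \<in> X"
proof -
  have ne: "X \<noteq> {}" using shift_in_orbit_closure[of 0 f] by blast
  have "avg (\<lambda>n. complex_of_real (infdist (shift_by (int n) f_hat) X)) \<longlonglongrightarrow> (\<integral>z. complex_of_real (infdist (pi_map z) X) \<partial>\<mu>)"
    by (rule empirical_convergence) (intro continuous_intros)
  moreover have "avg (\<lambda>n. complex_of_real (infdist (shift_by (int n) f_hat) X)) = (\<lambda>N. 0)"
    by (rule ext) (simp add: avg_def shift_in_orbit_closure)
  ultimately have "(\<integral>z. complex_of_real (infdist (pi_map z) X) \<partial>\<mu>) = 0"
    using LIMSEQ_unique[OF _ tendsto_const] by metis
  then have zero: "(\<integral>z. infdist (pi_map z) X \<partial>\<mu>) = 0" by simp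
  have int: "integrable \<mu> (\<lambda>z. infdist (pi_map z) X)"
    by (rule integrable_pi) (intro continuous_intros)
  have "AE z in \<mu>. infdist (pi_map z) X = 0"
    using integral_nonneg_eq_0_iff_AE[OF int] zero by (simp add: infdist_nonneg)
  then show ?thesis
    by eventually_elim (use in_closed_iff_infdist_zero[OF closed_orbit_closure ne] in blast)
qed

lemma X_borel [measurable]: "X \<in> sets borel"
  by (intro borel_closed closed_orbit_closure)

definition nu :: "(int \<Rightarrow> complex) measure" where
  "nu = restrict_space (distr \<mu> borel pi_map) X"

lemma sets_nu: "sets nu = sets (restrict_space borel X)"
  unfolding nu_def by (intro sets_restrict_space_cong) simp

lemma space_nu: "space nu = X" by (simp add: nu_def space_restrict_space)

lemma sets_nu_iff: "A \<in> sets nu \<longleftrightarrow> A \<in> sets borel \<and> A \<subseteq> X"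
  unfolding sets_nu by (subst sets_restrict_space_iff) auto

lemma measure_nu: "A \<in> sets nu \<Longrightarrow> measure nu A = measure \<mu> (pi_map -` A \<inter> space \<mu>)"
proof -
  assume "A \<in> sets nu"
  then have A: "A \<in> sets borel" "A \<subseteq> X" by (simp_all add: sets_nu_iff)
  show ?thesis unfolding nu_def
    by (subst measure_restrict_space) (use A in \<open>auto simp: measure_distr\<close>)
qed

lemma measure_pi_X: "measure \<mu> (pi_map -` X \<inter> space \<mu>) = 1"
proof -
  have "pi_map -` X \<inter> space \<mu> = {z\<in>space \<mu>. pi_map z \<in> X}" by auto
  moreover have "{z\<in>space \<mu>. pi_map z \<in> X} \<in> events" by measurable
  ultimately show ?thesis using AE_pi_X prob_eq_1[of "{z\<in>space \<mu>. pi_map z \<in> X}"] by auto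
qed

lemma prob_nu: "prob_space nu"
proof -
  have "emeasure nu (space nu) = emeasure \<mu> (pi_map -` X \<inter> space \<mu>)"
    unfolding space_nu unfolding nu_def by (subst emeasure_restrict_space) (auto simp: emeasure_distr)
  also have "\<dots> = 1" using measure_pi_X by (simp add: emeasure_eq_measure)
  finally show ?thesis by (rule prob_spaceI)
qed

lemma nu_in: "nu \<in> prob_measures_on X"
  using prob_nu sets_nu by (simp add: prob_measures_on_def)

lemma integral_nu:
  fixes \<phi> :: "(int \<Rightarrow> complex) \<Rightarrow> complex"
  assumes cont: "continuous_on UNIV \<phi>"
  shows "integral\<^sup>L nu \<phi> = (\<integral>z. \<phi> (pi_map z) \<partial>\<mu>)"
proof -
  have m: "\<phi> \<in> borel_measurable borel" by (rule borel_measurable_continuous_onI[OF cont])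
  then have m2: "(\<lambda>x. indicator X x *\<^sub>R \<phi> x) \<in> borel_measurable borel" by measurable
  have "integral\<^sup>L nu \<phi> = (\<integral>x. indicator X x *\<^sub>R \<phi> x \<partial>distr \<mu> borel pi_map)"
    unfolding nu_def by (rule integral_restrict_space) simp
  also have "\<dots> = (\<integral>z. indicator X (pi_map z) *\<^sub>R \<phi> (pi_map z) \<partial>\<mu>)"
    by (rule integral_distr[OF pi_measurable m2])
  also have "\<dots> = (\<integral>z. \<phi> (pi_map z) \<partial>\<mu>)"
  proof (rule integral_cong_AE)
    show "(\<lambda>z. indicator X (pi_map z) *\<^sub>R \<phi> (pi_map z)) \<in> borel_measurable \<mu>"
      using measurable_compose[OF pi_measurable m2] .
    show "(\<lambda>z. \<phi> (pi_map z)) \<in> borel_measurable \<mu>" using measurable_compose[OF pi_measurable m] .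
    show "AE z in \<mu>. indicator X (pi_map z) *\<^sub>R \<phi> (pi_map z) = \<phi> (pi_map z)"
      using AE_pi_X by eventually_elim simp
  qed
  finally show ?thesis .
qed

text \<open>Observables are given on \<open>X\<close> only; Tietze's theorem extends them to the
  whole space, where \<open>empirical_convergence\<close> applies.\<close>

lemma weak_star_nu: "weak_star_tendsto X (empirical_measure f) nu"
  unfolding weak_star_tendsto_def
proof (intro allI impI)
  fix \<phi> :: "(int \<Rightarrow> complex) \<Rightarrow> complex" assume cont: "continuous_on X \<phi>"
  have "bounded (\<phi> ` X)" by (intro compact_imp_bounded compact_continuous_image cont compact_X)
  then obtain B where B: "B > 0" "\<And>x. x \<in> X \<Longrightarrow> norm (\<phi> x) \<le> B" unfolding bounded_pos by auto
  obtain \<psi> where \<psi>: "continuous_on UNIV \<psi>" "\<And>x. x \<in> X \<Longrightarrow> \<psi> x = \<phi> x"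
    by (rule Tietze[OF cont, of UNIV B]) (use B closed_orbit_closure[of f] in \<open>auto simp: less_imp_le\<close>)
  have "integral\<^sup>L nu \<phi> = integral\<^sup>L nu \<psi>"
    by (rule Bochner_Integration.integral_cong) (auto simp: space_nu \<psi>)
  also have "\<dots> = (\<integral>z. \<psi> (pi_map z) \<partial>\<mu>)" by (rule integral_nu[OF \<psi>(1)])
  finally have "avg (\<lambda>n. \<psi> (shift_by (int n) f_hat)) \<longlonglongrightarrow> integral\<^sup>L nu \<phi>"
    using empirical_convergence[OF \<psi>(1)] by simp
  moreover have "integral\<^sup>L (empirical_measure f N) \<phi> = avg (\<lambda>n. \<psi> (shift_by (int n) f_hat)) N" for N
    unfolding integral_empirical_measure[OF cont] by (simp add: \<psi>(2) shift_in_orbit_closure)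
  ultimately show "(\<lambda>N. integral\<^sup>L (empirical_measure f N) \<phi>) \<longlonglongrightarrow> integral\<^sup>L nu \<phi>" by simp
qed

lemma generic: "generic f"
  unfolding generic_def using nu_in weak_star_nu by blast

lemma shift_measurable: "shift_by 1 \<in> measurable nu nu"
  unfolding measurable_cong_sets[OF sets_nu sets_nu]
proof (rule measurable_restrict_space2)
  show "shift_by 1 \<in> space (restrict_space borel X) \<rightarrow> X"
    by (auto simp: space_restrict_space orbit_closure_shift)
  show "shift_by 1 \<in> borel_measurable (restrict_space borel X)"
    by (rule borel_measurable_continuous_on_restrict[OF continuous_shift_by])
qed

lemma pi_T_X: "pi_map (T z) \<in> X \<longleftrightarrow> pi_map z \<in> X"
  by (simp add: pi_T orbit_closure_shift_iff)

lemma preimage_shift: "pi_map -` (shift_by 1 -` A \<inter> X) \<inter> space \<mu> = T -` (pi_map -` A \<inter> space \<mu>) \<inter> space \<mu>" if "A \<subseteq> X"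
  using that T_in by (auto simp: pi_T space_mu orbit_closure_shift_iff)

lemma pi_vimage_sets: "A \<in> sets nu \<Longrightarrow> pi_map -` A \<inter> space \<mu> \<in> sets \<mu>"
  unfolding sets_nu_iff by (intro measurable_sets[OF pi_measurable]) auto

lemma nu_preserving: "measure_preserving_system nu (shift_by 1)"
  unfolding measure_preserving_system_def
proof (intro conjI prob_nu shift_measurable)
  interpret nu: prob_space nu by (rule prob_nu)
  show "distr nu nu (shift_by 1) = nu"
  proof (rule measure_eqI)
    fix A assume "A \<in> sets (distr nu nu (shift_by 1))"
    then have A: "A \<in> sets nu" by simp
    then have AX: "A \<subseteq> X" by (simp add: sets_nu_iff)
    have S: "shift_by 1 -` A \<inter> X \<in> sets nu" using measurable_sets[OF shift_measurable A] by (simp add: space_nu)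
    have "emeasure (distr nu nu (shift_by 1)) A = emeasure nu (shift_by 1 -` A \<inter> X)"
      using emeasure_distr[OF shift_measurable A] by (simp add: space_nu)
    also have "measure nu (shift_by 1 -` A \<inter> X) = measure nu A"
      unfolding measure_nu[OF S] measure_nu[OF A] preimage_shift[OF AX] by (rule measure_T[OF pi_vimage_sets[OF A]])
    then have "emeasure nu (shift_by 1 -` A \<inter> X) = emeasure nu A" by (simp add: nu.emeasure_eq_measure)
    finally show "emeasure (distr nu nu (shift_by 1)) A = emeasure nu A" .
  qed simp
qed

text \<open>The preimage of an invariant set under the equivariant map \<open>pi_map\<close> is
  invariant under \<open>T\<close>, so ergodicity of the odometer passes to
  \<open>nu\<close>.\<close>

lemma nu_ergodic: "ergodic_system nu (shift_by 1)"
  unfolding ergodic_system_def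
proof (intro conjI nu_preserving ballI impI)
  fix A assume A: "A \<in> sets nu" and inv: "shift_by 1 -` A \<inter> space nu = A"
  have AX: "A \<subseteq> X" using A by (simp add: sets_nu_iff)
  have "T -` (pi_map -` A \<inter> space \<mu>) \<inter> space \<mu> = pi_map -` A \<inter> space \<mu>"
    by (rule preimage_shift[OF AX, unfolded inv[unfolded space_nu], symmetric])
  then show "measure nu A = 0 \<or> measure nu A = 1"
    unfolding measure_nu[OF A] by (rule T_ergodic[OF pi_vimage_sets[OF A]])
qed

end

lemma pred_tendsto:
  fixes u :: "nat \<Rightarrow> 'a \<Rightarrow> 'b::{second_countable_topology, real_normed_vector}"
  assumes [measurable]: "\<And>i. u i \<in> borel_measurable N" "l \<in> borel_measurable N"
  shows "Measurable.pred N (\<lambda>x. (\<lambda>i. u i x) \<longlonglongrightarrow> l x)"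
proof -
  have "(\<lambda>i. u i x) \<longlonglongrightarrow> l x \<longleftrightarrow> (\<forall>m::nat. \<exists>I. \<forall>i\<ge>I. norm (u i x - l x) < inverse (real (Suc m)))" for x
  proof
    assume "(\<lambda>i. u i x) \<longlonglongrightarrow> l x"
    then show "\<forall>m::nat. \<exists>I. \<forall>i\<ge>I. norm (u i x - l x) < inverse (real (Suc m))"
      using LIMSEQ_D[of "\<lambda>i. u i x" "l x"] by simp
  next
    assume A: "\<forall>m::nat. \<exists>I. \<forall>i\<ge>I. norm (u i x - l x) < inverse (real (Suc m))"
    show "(\<lambda>i. u i x) \<longlonglongrightarrow> l x"
    proof (rule LIMSEQ_I)
      fix r :: real assume "r > 0"
      then obtain m where m: "inverse (real (Suc m)) < r" using reals_Archimedean by blast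
      from A obtain I where "\<forall>i\<ge>I. norm (u i x - l x) < inverse (real (Suc m))" by blast
      then show "\<exists>no. \<forall>n\<ge>no. norm (u n x - l x) < r" using m less_trans by blast
    qed
  qed
  then show ?thesis by simp
qed

section \<open>The isomorphism with the odometer\<close>

context rap_system
begin

text \<open>Reads the residue modulo \<open>M k\<close> off the block averages. Taking the least
  candidate keeps the choice measurable; for images of points of \<open>good\<close> there is only
  one candidate.\<close>

definition rho :: "(int \<Rightarrow> complex) \<Rightarrow> nat \<Rightarrow> nat" where
  "rho x k = (LEAST b. b < M k \<and> (\<forall>j. (\<lambda>i. block_avg k i j x) \<longlonglongrightarrow> a k (int b + j)))"

definition good :: "(nat \<Rightarrow> nat) set" where
  "good = {z \<in> Z. pi_map z \<in> X \<and> (\<forall>k j. (\<lambda>i. block_avg k i j (pi_map z)) \<longlonglongrightarrow> orb k z j)}"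

text \<open>Two candidates give the same translate of \<open>a k\<close>, so their difference is a
  period, and by minimality a multiple of \<open>M k\<close>.\<close>

lemma rho_pi:
  assumes z: "z \<in> good"
  shows "rho (pi_map z) = z"
proof
  fix k
  have zZ: "z \<in> Z" and lim: "\<And>j. (\<lambda>i. block_avg k i j (pi_map z)) \<longlonglongrightarrow> a k (int (z k) + j)"
    using z by (auto simp: good_def orb_def)
  have unique: "b = z k" if b: "b < M k" "\<forall>j. (\<lambda>i. block_avg k i j (pi_map z)) \<longlonglongrightarrow> a k (int b + j)" for b
  proof -
    have eq: "a k (int b + j) = a k (int (z k) + j)" for j
      by (rule LIMSEQ_unique[OF b(2)[rule_format] lim])
    have "int (M k) dvd int b - int (z k)"
    proof (rule minimal)
      show "a k (j + (int b - int (z k))) = a k j" for j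
        using eq[of "j - int (z k)"] by (simp add: algebra_simps)
    qed
    then have "int b mod int (M k) = int (z k) mod int (M k)" by (simp add: mod_eq_dvd_iff)
    then show ?thesis using b(1) odometer_space_less[OF zZ, of k] by simp
  qed
  show "rho (pi_map z) k = z k"
    unfolding rho_def
  proof (rule Least_equality)
    show "z k < M k \<and> (\<forall>j. (\<lambda>i. block_avg k i j (pi_map z)) \<longlonglongrightarrow> a k (int (z k) + j))"
      using lim odometer_space_less[OF zZ] by blast
    show "z k \<le> b" if "b < M k \<and> (\<forall>j. (\<lambda>i. block_avg k i j (pi_map z)) \<longlonglongrightarrow> a k (int b + j))" for b
      using unique[of b] that by simp
  qed
qed

lemma block_avg_borel [measurable]: "block_avg k i j \<in> borel_measurable borel"
  unfolding block_avg_def divide_inverse by (intro borel_measurable_continuous_onI continuous_intros)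

lemma rho_measurable [measurable]: "rho \<in> borel_measurable nu"
proof (rule measurable_coordinatewise_then_product)
  fix k
  have b: "block_avg k i j \<in> borel_measurable nu" for i j
    unfolding measurable_cong_sets[OF sets_nu refl] by (rule measurable_restrict_space1) measurable
  have [measurable]: "Measurable.pred nu (\<lambda>x. (\<lambda>i. block_avg k i j x) \<longlonglongrightarrow> a k (int c + j))" for c j
    by (rule pred_tendsto) (use b in auto)
  have "(\<lambda>x. rho x k) \<in> measurable nu (count_space UNIV)"
    unfolding rho_def by measurable
  then show "(\<lambda>x. rho x k) \<in> borel_measurable nu" unfolding measurable_borel_nat .
qed

lemma pi_borel_measurable: "(\<lambda>z. pi_map z j) \<in> borel_measurable borel"
  unfolding pi_map_def
proof (rule borel_measurable_lim_metric)
  fix k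
  show "(\<lambda>z. orb k z j) \<in> borel_measurable borel" unfolding orb_def by measurable
qed

lemma good_sets [measurable]: "good \<in> sets \<mu>"
proof -
  have [measurable]: "Measurable.pred \<mu> (\<lambda>z. (\<lambda>i. block_avg k i j (pi_map z)) \<longlonglongrightarrow> orb k z j)" for k j
    by (rule pred_tendsto) measurable
  have "{z \<in> space \<mu>. pi_map z \<in> X \<and> (\<forall>k j. (\<lambda>i. block_avg k i j (pi_map z)) \<longlonglongrightarrow> orb k z j)} \<in> sets \<mu>"
    by measurable
  then show ?thesis by (simp add: good_def space_mu)
qed

lemma AE_good: "AE z in \<mu>. z \<in> good"
  using AE_pi_X AE_block_avg AE_space
  by eventually_elim (simp add: good_def space_mu)

lemma good_borel [measurable]: "good \<in> sets borel"
  using good_sets unfolding sets_mu by (simp add: sets_restrict_space_iff)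

lemma good_subset: "good \<subseteq> Z" by (auto simp: good_def)

lemma T_good:
  assumes "z \<in> good"
  shows "T z \<in> good"
proof -
  have "block_avg k i j (pi_map (T z)) = block_avg k i (j + 1) (pi_map z)" for k i j
    by (simp add: block_avg_def pi_T shift_by_def algebra_simps)
  then show ?thesis using assms T_in by (simp add: good_def pi_T_X orb_T)
qed

text \<open>This is the image of \<open>good\<close> under \<open>pi_map\<close>, described from the
  side of the shift space. Its measurability then follows from that of \<open>rho\<close>, without a
  theorem on injective images of Borel sets.\<close>

definition good_orbits :: "(int \<Rightarrow> complex) set" where
  "good_orbits = {x \<in> X. rho x \<in> good \<and> (\<forall>j. pi_map (rho x) j = x j)}"

lemma good_orbits_eq: "good_orbits = pi_map ` good"
proof (intro equalityI subsetI)
  fix x assume "x \<in> good_orbits"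
  then have "rho x \<in> good" "pi_map (rho x) = x" by (auto simp: good_orbits_def)
  then show "x \<in> pi_map ` good" by (metis imageI)
next
  fix x assume "x \<in> pi_map ` good"
  then obtain z where z: "z \<in> good" "x = pi_map z" by auto
  then show "x \<in> good_orbits" by (auto simp: good_orbits_def rho_pi good_def)
qed

lemma good_orbits_sets: "good_orbits \<in> sets nu"
proof -
  have 1: "(\<lambda>x. pi_map (rho x) j) \<in> borel_measurable nu" for j
    by (rule measurable_compose[OF rho_measurable pi_borel_measurable])
  have 2: "(\<lambda>x. x j) \<in> borel_measurable nu" for j
    unfolding measurable_cong_sets[OF sets_nu refl]
    by (rule borel_measurable_continuous_on_restrict[OF continuous_coordinate])
  have [measurable]: "Measurable.pred nu (\<lambda>x. pi_map (rho x) j = x j)" for j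
  proof -
    have "(\<lambda>x. pi_map (rho x) j - x j) -` {0} \<inter> space nu \<in> sets nu"
      by (rule measurable_sets[OF borel_measurable_diff[OF 1 2]]) simp
    also have "(\<lambda>x. pi_map (rho x) j - x j) -` {0} \<inter> space nu = {x \<in> space nu. pi_map (rho x) j = x j}" by auto
    finally show ?thesis unfolding pred_def .
  qed
  have "{x \<in> space nu. rho x \<in> good \<and> (\<forall>j. pi_map (rho x) j = x j)} \<in> sets nu"
    by measurable
  then show ?thesis by (simp add: good_orbits_def space_nu)
qed

lemma measure_pi_vimage_good:
  assumes D: "D \<in> sets nu" and C: "C \<in> sets \<mu>" and eq: "\<And>z. z \<in> good \<Longrightarrow> pi_map z \<in> D \<longleftrightarrow> z \<in> C"
  shows "measure nu D = measure \<mu> C"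
  unfolding measure_nu[OF D]
proof (rule finite_measure_eq_AE)
  show "AE z in \<mu>. z \<in> pi_map -` D \<inter> space \<mu> \<longleftrightarrow> z \<in> C"
    using AE_good AE_space by eventually_elim (use eq in auto)
qed (use C pi_vimage_sets[OF D] in auto)

lemma sets_restrict_mu_good: "sets (restrict_space \<mu> good) = sets (restrict_space borel good)"
  using sets_restrict_space_cong[OF sets_mu, of good] good_subset
  by (simp add: sets_restrict_restrict_space Int_absorb1)

lemma sets_restrict_nu_good: "sets (restrict_space nu good_orbits) = sets (restrict_space borel good_orbits)"
proof -
  have "good_orbits \<subseteq> X" by (auto simp: good_orbits_def)
  then show ?thesis
    using sets_restrict_space_cong[OF sets_nu, of good_orbits] by (simp add: sets_restrict_restrict_space Int_absorb1)
qed

text \<open>The isomorphism is \<open>rho\<close>, from \<open>good_orbits\<close> onto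
  \<open>good\<close>, with inverse \<open>pi_map\<close>. Equivariance is that of
  \<open>pi_map\<close>, transported by the bijection.\<close>

lemma nu_isomorphic: "isomorphic_systems nu (shift_by 1) \<mu> T"
proof -
  interpret nu: prob_space nu by (rule prob_nu)
  have rg: "rho x \<in> good" "pi_map (rho x) = x" if "x \<in> good_orbits" for x
    using that by (auto simp: good_orbits_def)
  have bij: "bij_betw rho good_orbits good"
    by (rule bij_betw_byWitness[where f' = pi_map]) (use rg rho_pi good_orbits_eq in auto)
  have sp: "space (restrict_space nu good_orbits) = good_orbits" "space (restrict_space \<mu> good) = good"
    using good_subset by (auto simp: space_restrict_space space_nu space_mu good_orbits_def)
  have inv: "inv_into good_orbits rho z = pi_map z" if "z \<in> good" for z
    using bij that by (intro inv_into_f_eq) (auto simp: bij_betw_def good_orbits_eq rho_pi)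
  have h: "rho \<in> measurable (restrict_space nu good_orbits) (restrict_space \<mu> good)"
    unfolding measurable_cong_sets[OF refl sets_restrict_mu_good]
  proof (rule measurable_restrict_space2)
    show "rho \<in> space (restrict_space nu good_orbits) \<rightarrow> good" using rg by (auto simp: sp)
    show "rho \<in> borel_measurable (restrict_space nu good_orbits)"
      by (rule measurable_restrict_space1[OF rho_measurable])
  qed
  have pim: "pi_map \<in> measurable (restrict_space \<mu> good) (restrict_space nu good_orbits)"
    unfolding measurable_cong_sets[OF refl sets_restrict_nu_good]
  proof (rule measurable_restrict_space2)
    show "pi_map \<in> space (restrict_space \<mu> good) \<rightarrow> good_orbits" by (auto simp: sp good_orbits_eq)
    show "pi_map \<in> borel_measurable (restrict_space \<mu> good)"
      by (rule measurable_restrict_space1[OF pi_measurable])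
  qed
  then have hinv: "inv_into good_orbits rho \<in> measurable (restrict_space \<mu> good) (restrict_space nu good_orbits)"
    by (rule measurable_cong[THEN iffD2, rotated]) (simp add: sp inv)
  have m\<mu>: "measure \<mu> good = 1" using AE_good prob_eq_1[OF good_sets] by simp
  have m\<nu>: "measure nu good_orbits = 1"
    using measure_pi_vimage_good[OF good_orbits_sets good_sets] m\<mu> by (auto simp: good_orbits_eq)
  have distr: "distr (restrict_space nu good_orbits) (restrict_space \<mu> good) rho = restrict_space \<mu> good"
  proof (rule measure_eqI)
    fix C assume "C \<in> sets (distr (restrict_space nu good_orbits) (restrict_space \<mu> good) rho)"
    then have C: "C \<in> sets (restrict_space \<mu> good)" by simp
    then have C': "C \<in> sets \<mu>" "C \<subseteq> good" by (auto simp: sets_restrict_space_iff)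
    define D where "D = rho -` C \<inter> good_orbits"
    have "D \<in> sets (restrict_space nu good_orbits)"
      using measurable_sets[OF h C] by (simp add: D_def sp)
    then have D: "D \<in> sets nu" "D \<subseteq> good_orbits"
      using good_orbits_sets by (auto simp: sets_restrict_space_iff)
    have "emeasure (distr (restrict_space nu good_orbits) (restrict_space \<mu> good) rho) C =
        emeasure (restrict_space nu good_orbits) D"
      using emeasure_distr[OF h C] by (simp add: D_def sp)
    also have "\<dots> = emeasure nu D"
      using good_orbits_sets D by (intro emeasure_restrict_space) auto
    also have "measure nu D = measure \<mu> C"
      by (rule measure_pi_vimage_good[OF D(1) C'(1)]) (auto simp: D_def rho_pi good_orbits_eq)
    then have "emeasure nu D = emeasure \<mu> C" by (simp add: nu.emeasure_eq_measure emeasure_eq_measure)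
    also have "\<dots> = emeasure (restrict_space \<mu> good) C"
      using C' by (intro emeasure_restrict_space[symmetric]) auto
    finally show "emeasure (distr (restrict_space nu good_orbits) (restrict_space \<mu> good) rho) C =
        emeasure (restrict_space \<mu> good) C" .
  qed simp
  have sub: "shift_by 1 ` good_orbits \<subseteq> good_orbits" "T ` good \<subseteq> good"
    using T_good by (auto simp: good_orbits_eq pi_T[symmetric])
  have equi: "\<forall>x\<in>good_orbits. rho (shift_by 1 x) = T (rho x)"
    using T_good by (auto simp: good_orbits_eq pi_T[symmetric] rho_pi)
  show ?thesis
    unfolding isomorphic_systems_def
    using nu_preserving T_preserving good_orbits_sets good_sets m\<mu> m\<nu> sub bij h hinv distr equi by blast
qed

lemma nu_odometer: "is_odometer nu (shift_by 1)"
  unfolding is_odometer_def using moduli haar nu_isomorphic by blast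

lemma furstenberg_nu: "furstenberg_system f nu"
  unfolding furstenberg_system_def
  using nu_in nu_preserving weak_star_nu filterlim_ident by blast

text \<open>The whole sequence of empirical measures converges to \<open>nu\<close>, so a limit
  along any \<open>N k\<close> integrates continuous functions as \<open>nu\<close> does.\<close>

lemma furstenberg_unique:
  assumes "furstenberg_system f \<nu>"
  shows "\<nu> = nu"
proof (rule prob_measure_eqI_continuous[OF closed_orbit_closure])
  show "\<nu> \<in> prob_measures_on X" using assms by (simp add: furstenberg_system_def)
  fix \<phi> :: "(int \<Rightarrow> complex) \<Rightarrow> complex" assume cont: "continuous_on X \<phi>"
  obtain N where N: "filterlim N at_top sequentially"
    and lim: "weak_star_tendsto X (\<lambda>k. empirical_measure f (N k)) \<nu>"
    using assms unfolding furstenberg_system_def by blast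
  have "(\<lambda>k. integral\<^sup>L (empirical_measure f k) \<phi>) \<longlonglongrightarrow> integral\<^sup>L nu \<phi>"
    using weak_star_nu cont unfolding weak_star_tendsto_def by blast
  then have "(\<lambda>k. integral\<^sup>L (empirical_measure f (N k)) \<phi>) \<longlonglongrightarrow> integral\<^sup>L nu \<phi>"
    by (rule filterlim_compose[OF _ N])
  moreover have "(\<lambda>k. integral\<^sup>L (empirical_measure f (N k)) \<phi>) \<longlonglongrightarrow> integral\<^sup>L \<nu> \<phi>"
    using lim cont unfolding weak_star_tendsto_def by blast
  ultimately show "integral\<^sup>L \<nu> \<phi> = integral\<^sup>L nu \<phi>" using LIMSEQ_unique by blast
qed (rule nu_in)

end

lemma (in bounded_RAP) furstenberg_odometer:
  "generic f \<and> (\<exists>!\<nu>. furstenberg_system f \<nu>) \<and>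
   (\<forall>\<nu>. furstenberg_system f \<nu> \<longrightarrow> ergodic_system \<nu> (shift_by 1) \<and> is_odometer \<nu> (shift_by 1))"
proof -
  obtain M a where coding: "odometer_coding M a"
    and approx: "\<And>k. \<forall>\<^sub>F N in sequentially. avg (\<lambda>n. norm (f n - a k (int n))) N < (1 / 2) ^ k"
    using coding_exists by blast
  interpret odometer_coding M a by (rule coding)
  obtain \<mu> where \<mu>: "uniform_odo M \<mu>" using uniform_odo_exists[OF moduli] by blast
  interpret rap_system M a \<mu> f
    by unfold_locales (rule \<mu>, rule approx)
  show ?thesis
    using generic furstenberg_nu furstenberg_unique nu_ergodic nu_odometer by blast
qed

section \<open>Genericity of pretentious functions, and the equivalences\<close>

lemma generic_convergent:
  fixes \<phi> :: "(int \<Rightarrow> complex) \<Rightarrow> complex"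
  assumes "generic f" and cont: "continuous_on UNIV \<phi>"
  shows "convergent (avg (\<lambda>n. \<phi> (shift_by (int n) (extend_by_zero f))))"
proof -
  have c: "continuous_on (orbit_closure f) \<phi>" using cont by (rule continuous_on_subset) simp
  obtain \<nu> where "weak_star_tendsto (orbit_closure f) (empirical_measure f) \<nu>"
    using assms(1) unfolding generic_def by blast
  then have "(\<lambda>N. integral\<^sup>L (empirical_measure f N) \<phi>) \<longlonglongrightarrow> integral\<^sup>L \<nu> \<phi>"
    using c unfolding weak_star_tendsto_def by blast
  then show ?thesis unfolding integral_empirical_measure[OF c] by (rule convergentI)
qed

context pretentious
begin

lemma generic_window_convergent:
  assumes "generic f"
  shows "convergent (avg (\<lambda>n. (window z L n) ^ Q))"
proof -
  define \<phi> where "\<phi> x = ((\<Sum>m<L. x (int m) * z ^ m) / of_nat L) ^ Q" for x :: "int \<Rightarrow> complex"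
  have "continuous_on UNIV \<phi>"
  \<comment> \<open>For \<open>L = 0\<close> the division by 0 makes \<open>\<phi>\<close>
    constant.\<close>
  proof (cases "L = 0")
    case False
    then show ?thesis unfolding \<phi>_def by (intro continuous_intros) auto
  qed (simp add: \<phi>_def)
  from generic_convergent[OF assms this]
  have c: "convergent (avg (\<lambda>n. \<phi> (shift_by (int n) (extend_by_zero f))))" .
  have "avg (\<lambda>n. \<phi> (shift_by (int n) (extend_by_zero f))) = avg (\<lambda>n. (window z L n) ^ Q)"
  proof (rule ext, rule avg_cong)
    fix n :: nat assume "1 \<le> n"
    then have "shift_by (int n) (extend_by_zero f) (int m) = f (n + m)" for m
      by (simp add: shift_by_def extend_by_zero_def nat_add_distrib add.commute)
    then show "\<phi> (shift_by (int n) (extend_by_zero f)) = (window z L n) ^ Q"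
      by (simp add: \<phi>_def window_def)
  qed
  with c show ?thesis by simp
qed

text \<open>The partial sums of the series up to \<open>N\<close> are \<open>- G N\<close>, with the
  primes taken in increasing order.\<close>

lemma summable_iff_convergent_G:
  assumes "t = 0"
  shows "summable (\<lambda>p. if prime p then 1 / of_nat p * (1 - f p * cnj (chi p)) else 0) \<longleftrightarrow> convergent G"
proof -
  have h_eq: "h p = f p * cnj (chi p)" if "p > 0" for p
    unfolding h_def using that by (simp add: assms twist_0)
  have "(\<Sum>p\<le>N. if prime p then 1 / of_nat p * (1 - f p * cnj (chi p)) else 0) = - G N" for N
  proof -
    have "(\<Sum>p\<le>N. if prime p then 1 / of_nat p * (1 - f p * cnj (chi p)) else 0) =
        (\<Sum>p\<in>{p\<in>{..N}. prime p}. 1 / of_nat p * (1 - f p * cnj (chi p)))"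
      by (rule sum.inter_filter[symmetric]) simp
    also have "{p\<in>{..N}. prime p} = {p. prime p \<and> p \<le> N}" by auto
    also have "(\<Sum>p | prime p \<and> p \<le> N. 1 / of_nat p * (1 - f p * cnj (chi p))) = - G N"
      unfolding G_def sum_negf[symmetric] by (intro sum.cong) (auto simp: h_eq prime_gt_0_nat diff_divide_distrib)
    finally show ?thesis .
  qed
  then show ?thesis
    using convergent_minus_iff[of G] unfolding summable_iff_convergent' by simp
qed

end

text \<open>If the sum of the reciprocals of the primes were finite, the indicator function of \<open>1\<close> would be at
  finite distance from \<open>1\<close> and hence have a positive mean.\<close>

lemma not_summable_inverse_primes: "\<not> summable (\<lambda>p::nat. if prime p then 1 / real p else 0)"
proof
  assume summ: "summable (\<lambda>p::nat. if prime p then 1 / real p else 0)"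
  define f :: "nat \<Rightarrow> complex" where "f n = of_bool (n = 1)" for n
  interpret pretentious f 1 "\<lambda>_. 1" 0
  proof
    show "unit_multiplicative f" by (simp add: unit_multiplicative_def f_def)
    show "f 1 = 1" by (simp add: f_def)
    show "dirichlet_character 1 (\<lambda>_. 1)" by (simp add: dirichlet_character_def)
    have "(\<lambda>p. if prime p then (1 - Re (f p * cnj (1 * twist 0 p))) / real p else 0) = (\<lambda>p. if prime p then 1 / real p else 0)"
      by (rule ext) (auto simp: f_def)
    then show "summable (\<lambda>p. if prime p then (1 - Re (f p * cnj (1 * twist 0 p))) / real p else 0)"
      using summ by simp
  qed
  obtain \<kappa> where \<kappa>: "\<kappa> > 0" "\<forall>\<^sub>F N in sequentially. avg (\<lambda>n. norm (f n)) N \<ge> \<kappa>"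
    using avg_norm_f_lower by blast
  have "(\<lambda>n. norm (f n)) \<longlonglongrightarrow> 0"
    by (rule tendsto_eventually) (use eventually_gt_at_top[of 1] in eventually_elim, simp add: f_def)
  then have "avg (\<lambda>n. norm (f n)) \<longlonglongrightarrow> 0" by (rule avg_tendsto_0)
  then have "\<kappa> \<le> 0" using \<kappa>(2) by (rule tendsto_lowerbound) simp
  with \<kappa>(1) show False by simp
qed

text \<open>The distance sums over the set of primes without an order. For nonnegative terms its
  finiteness bounds all partial sums of the ordered series.\<close>

lemma pretentious_summable:
  assumes f: "unit_multiplicative f" and g: "\<And>p. prime p \<Longrightarrow> norm (g p) \<le> 1"
    and d: "pretentious_dist f g < \<infinity>"
  shows "summable (\<lambda>p. if prime p then (1 - Re (f p * cnj (g p))) / real p else 0)"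
proof -
  define u where "u p = (if prime p then (1 - Re (f p * cnj (g p))) / real p else 0)" for p
  have u0: "u p \<ge> 0" for p
  proof (cases "prime p")
    case True
    have "norm (f p) * norm (g p) \<le> 1 * 1"
      using unit_multiplicative_norm[OF f prime_gt_0_nat[OF True]] g[OF True] by (intro mult_mono) auto
    then have "Re (f p * cnj (g p)) \<le> 1"
      using complex_Re_le_cmod[of "f p * cnj (g p)"] by (simp add: norm_mult)
    then show ?thesis by (simp add: u_def)
  qed (simp add: u_def)
  define D where "D = pretentious_dist_sq f g"
  have D: "D \<noteq> \<infinity>" using d by (auto simp: pretentious_dist_def D_def split: if_splits)
  have le: "(\<Sum>p<n. u p) \<le> enn2real D" for n
  proof -
    define A where "A = {p. prime p \<and> p < n}"
    have A: "finite A" "A \<subseteq> {p. prime p}" by (auto simp: A_def)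
    have "(\<Sum>p<n. u p) = (\<Sum>p\<in>A. u p)"
      by (rule sum.mono_neutral_right) (auto simp: A_def u_def)
    also have "ennreal \<dots> = (\<Sum>p\<in>A. ennreal (u p))" using u0 by (intro sum_ennreal[symmetric])
    also have "\<dots> = (\<Sum>p\<in>A. ennreal (1 / real p * (1 - Re (f p * cnj (g p)))))"
      by (intro sum.cong) (auto simp: A_def u_def)
    also have "\<dots> \<le> D"
      unfolding D_def pretentious_dist_sq_def
      by (subst nonneg_infsum_complete) (use A in \<open>auto intro!: SUP_upper2[of A]\<close>)
    finally have "ennreal (\<Sum>p<n. u p) \<le> D" by simp
    then show ?thesis using D by (metis enn2real_ennreal enn2real_mono infinity_ennreal_def sum_nonneg top.not_eq_extremum u0)
  qed
  show ?thesis unfolding u_def[symmetric] by (rule summableI_nonneg_bounded[OF u0 le])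
qed

theorem theorem0p5:
  fixes f :: "nat \<Rightarrow> complex" and q :: nat and chi :: "nat \<Rightarrow> complex" and t :: real
  assumes "unit_multiplicative f"
    and "primitive_character q chi"
    and "pretentious_dist f (\<lambda>n. chi n * of_nat n powr (\<i> * of_real t)) < \<infinity>"
  shows "(generic f \<longleftrightarrow>
            t = 0 \<and> summable (\<lambda>p. if prime p then 1 / of_nat p * (1 - f p * cnj (chi p)) else 0)) \<and>
         (generic f \<longleftrightarrow> RAP f) \<and>
         (generic f \<longrightarrow>
            (\<exists>!\<nu>. furstenberg_system f \<nu>) \<and>
            (\<forall>\<nu>. furstenberg_system f \<nu> \<longrightarrow>
               ergodic_system \<nu> (shift_by 1) \<and> is_odometer \<nu> (shift_by 1)))"
proof -
  have chi: "dirichlet_character q chi" using assms(2) by (simp add: primitive_character_def)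
  have summ: "summable (\<lambda>p. if prime p then (1 - Re (f p * cnj (chi p * twist t p))) / real p else 0)"
  proof (rule pretentious_summable[OF assms(1)])
    show "norm (chi p * twist t p) \<le> 1" if "prime p" for p
      using that by (simp add: norm_mult norm_twist prime_gt_0_nat dirichlet_character_norm[OF chi])
    show "pretentious_dist f (\<lambda>p. chi p * twist t p) < \<infinity>" using assms(3) by (simp add: twist_def)
  qed
  \<comment> \<open>Otherwise \<open>f\<close> vanishes at all positive integers, and the squared
    distance is the divergent sum of the reciprocals of the primes.\<close>
  have f1: "f 1 = 1"
  proof (rule ccontr)
    assume ne: "f 1 \<noteq> 1"
    have mult: "f (m * n) = f m * f n" if "m > 0" "n > 0" "coprime m n" for m n
      using assms(1) that by (simp add: unit_multiplicative_def)
    have "f 1 * (f 1 - 1) = 0" using mult[of 1 1] by (simp add: algebra_simps)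
    then have "f 1 = 0" using ne by simp
    then have "f n = 0" if "n > 0" for n using mult[of n 1] that by simp
    then have "(\<lambda>p. if prime p then (1 - Re (f p * cnj (chi p * twist t p))) / real p else 0) =
        (\<lambda>p. if prime p then 1 / real p else 0)"
      by (intro ext) (simp add: prime_gt_0_nat)
    then show False using summ not_summable_inverse_primes by simp
  qed
  interpret pretentious f q chi t
    by unfold_locales (fact assms(1) f1 chi summ)+
  have 1: "t = 0 \<and> convergent G" if "generic f"
    by (rule convergence_criterion) (rule generic_window_convergent[OF that])
  have 2: "RAP f" if "t = 0" "convergent G" by (rule RAP_if_convergent[OF that])
  have 3: "generic f \<and> (\<exists>!\<nu>. furstenberg_system f \<nu>) \<and>
     (\<forall>\<nu>. furstenberg_system f \<nu> \<longrightarrow> ergodic_system \<nu> (shift_by 1) \<and> is_odometer \<nu> (shift_by 1))" if "RAP f"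
  proof -
    interpret bounded_RAP f by unfold_locales (use norm_f that in auto)
    show ?thesis by (rule furstenberg_odometer)
  qed
  have gen_RAP: "generic f \<longleftrightarrow> RAP f" using 1 2 3 by blast
  have gen_G: "generic f \<longleftrightarrow> t = 0 \<and> convergent G" using 1 2 3 by blast
  have "generic f \<longleftrightarrow> t = 0 \<and> summable (\<lambda>p. if prime p then 1 / of_nat p * (1 - f p * cnj (chi p)) else 0)"
    unfolding gen_G using summable_iff_convergent_G by blast
  moreover have "generic f \<longrightarrow> (\<exists>!\<nu>. furstenberg_system f \<nu>) \<and>
     (\<forall>\<nu>. furstenberg_system f \<nu> \<longrightarrow> ergodic_system \<nu> (shift_by 1) \<and> is_odometer \<nu> (shift_by 1))"
    using gen_RAP 3 by blast
  ultimately show ?thesis using gen_RAP by blast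
qed

end
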